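(* Let $A$ be a unital algebra over $\mathbb{C}$ and let $L$ be a weak left line $A$-module. Then $T_{\mathbb{Z}}(L)=\bigoplus_{n\in\mathbb{Z}}L^n$, with the product given by $\otimes_A$ combined with $\mathrm{ev}$ and $\mathrm{coev}^{-1}$ (as specified in the context), is an associative algebra.
   Context: For an $A$-bimodule $E$, $E^\circ={}_A\mathrm{Hom}(E,A)$ (left module maps), a bimodule with $(\alpha.a)(e)=\alpha(e)a$ and $(a.\alpha)(e)=\alpha(e.a)$. If $E$ is finitely generated projective as a left module, with dual basis $e^i\in E$, $e_i\in E^\circ$ ($f=\sum_i e_i(f).e^i$ for all $f\in E$), there are bimodule maps $\mathrm{ev}:E\otimes_A E^\circ\to A$, $\mathrm{ev}(e\otimes\alpha)=\alpha(e)$, and $\mathrm{coev}:A\to E^\circ\otimes_A E$, $\mathrm{coev}(1)=\sum_i e_i\otimes e^i$. A weak left line module is an $A$-bimodule $L$, finitely generated projective as a left $A$-module, such that $\mathrm{coev}:A\to L^\circ\otimes_A L$ is an isomorphism. Put $L^0=A$, $L^n=L^{\otimes_A n}$ and $L^{-n}=(L^\circ)^{\otimes_A n}$ for $n\ge1$. Define recursively $\mathrm{ev}^1=\mathrm{ev}$, $\mathrm{ev}^{n+1}=\mathrm{ev}(\mathrm{id}\otimes\mathrm{ev}^n\otimes\mathrm{id}):L^{n+1}\otimes_A L^{-n-1}\to A$ and $\tilde{\mathrm{ev}}^1=\mathrm{coev}^{-1}$, $\tilde{\mathrm{ev}}^{n+1}=\mathrm{coev}^{-1}(\mathrm{id}\otimes\tilde{\mathrm{ev}}^n\otimes\mathrm{id}):L^{-n-1}\otimes_A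 L^{n+1}\to A$. The product $L^n\otimes_A L^m\to L^{n+m}$ is $\otimes_A$ if $n,m$ have the same sign (and the $A$-action if one of them is $0$). For $n,m>0$, the product on $L^{-n}\otimes_A L^m\to L^{m-n}$ is $\tilde{\mathrm{ev}}^n\otimes\mathrm{id}$ if $m\ge n$ and $\mathrm{id}\otimes\tilde{\mathrm{ev}}^m$ if $m\le n$; the product on $L^n\otimes_A L^{-m}\to L^{n-m}$ is $\mathrm{ev}^n\otimes\mathrm{id}$ if $m\ge n$ and $\mathrm{id}\otimes\mathrm{ev}^m$ if $m\le n$. *)

theory Defs
  imports "HOL-Algebra.Algebraic_Closure_Type" "HOL-Algebra.Free_Abelian_Groups"
begin

section \<open>Unital algebras over the complex numbers\<close>

text \<open>The locale \<^locale>\<open>ring\<close> is that of associative unital rings, not necessarily commutative,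
  with 1 = 0 permitted. The locale \<^locale>\<open>algebra\<close> of the library is not used because it
  requires commutativity.\<close>

locale complex_algebra =
  ring A + module "ring_of_type_algebra :: complex ring" A
  for A :: "(complex, 'a) module" (structure) +
  assumes smult_mult_left:
      "\<lbrakk>x \<in> carrier A; y \<in> carrier A\<rbrakk> \<Longrightarrow> (c \<odot>\<^bsub>A\<^esub> x) \<otimes> y = c \<odot>\<^bsub>A\<^esub> (x \<otimes> y)"
    and smult_mult_right:
      "\<lbrakk>x \<in> carrier A; y \<in> carrier A\<rbrakk> \<Longrightarrow> x \<otimes> (c \<odot>\<^bsub>A\<^esub> y) = c \<odot>\<^bsub>A\<^esub> (x \<otimes> y)"


section \<open>Bimodules\<close>

text \<open>As in the record \<^type>\<open>module\<close>, the additive group of a bimodule is given by the fields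
  \<open>carrier\<close>, \<open>zero\<close> and \<open>add\<close>; the fields \<open>mult\<close> and \<open>one\<close> carry no information.\<close>

record ('a, 'e) bimodule = "'e ring" +
  lact :: "'a \<Rightarrow> 'e \<Rightarrow> 'e"
  ract :: "'e \<Rightarrow> 'a \<Rightarrow> 'e"

text \<open>The complex numbers act on a bimodule through the unit of the algebra. The axiom
  \<open>central\<close> says that the two resulting actions agree.\<close>

locale bimodule =
  A?: complex_algebra A + E?: abelian_group E
  for A :: "(complex, 'a) module" and E :: "('a, 'e) bimodule" +
  assumes lact_closed: "\<lbrakk>a \<in> carrier A; x \<in> carrier E\<rbrakk> \<Longrightarrow> lact E a x \<in> carrier E"
    and ract_closed: "\<lbrakk>a \<in> carrier A; x \<in> carrier E\<rbrakk> \<Longrightarrow> ract E x a \<in> carrier E"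
    and lact_add: "\<lbrakk>a \<in> carrier A; x \<in> carrier E; y \<in> carrier E\<rbrakk> \<Longrightarrow>
      lact E a (x \<oplus>\<^bsub>E\<^esub> y) = lact E a x \<oplus>\<^bsub>E\<^esub> lact E a y"
    and add_lact: "\<lbrakk>a \<in> carrier A; b \<in> carrier A; x \<in> carrier E\<rbrakk> \<Longrightarrow>
      lact E (a \<oplus>\<^bsub>A\<^esub> b) x = lact E a x \<oplus>\<^bsub>E\<^esub> lact E b x"
    and lact_mult: "\<lbrakk>a \<in> carrier A; b \<in> carrier A; x \<in> carrier E\<rbrakk> \<Longrightarrow>
      lact E (a \<otimes>\<^bsub>A\<^esub> b) x = lact E a (lact E b x)"
    and lact_one: "x \<in> carrier E \<Longrightarrow> lact E \<one>\<^bsub>A\<^esub> x = x"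
    and ract_add: "\<lbrakk>a \<in> carrier A; x \<in> carrier E; y \<in> carrier E\<rbrakk> \<Longrightarrow>
      ract E (x \<oplus>\<^bsub>E\<^esub> y) a = ract E x a \<oplus>\<^bsub>E\<^esub> ract E y a"
    and add_ract: "\<lbrakk>a \<in> carrier A; b \<in> carrier A; x \<in> carrier E\<rbrakk> \<Longrightarrow>
      ract E x (a \<oplus>\<^bsub>A\<^esub> b) = ract E x a \<oplus>\<^bsub>E\<^esub> ract E x b"
    and ract_mult: "\<lbrakk>a \<in> carrier A; b \<in> carrier A; x \<in> carrier E\<rbrakk> \<Longrightarrow>
      ract E x (a \<otimes>\<^bsub>A\<^esub> b) = ract E (ract E x a) b"
    and ract_one: "x \<in> carrier E \<Longrightarrow> ract E x \<one>\<^bsub>A\<^esub> = x"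
    and lact_ract: "\<lbrakk>a \<in> carrier A; b \<in> carrier A; x \<in> carrier E\<rbrakk> \<Longrightarrow>
      ract E (lact E a x) b = lact E a (ract E x b)"
    and central: "x \<in> carrier E \<Longrightarrow> lact E (c \<odot>\<^bsub>A\<^esub> \<one>\<^bsub>A\<^esub>) x = ract E x (c \<odot>\<^bsub>A\<^esub> \<one>\<^bsub>A\<^esub>)"

definition regular :: "(complex, 'a) module \<Rightarrow> ('a, 'a) bimodule" where
  "regular A = \<lparr>carrier = carrier A, monoid.mult = (\<otimes>\<^bsub>A\<^esub>), one = \<one>\<^bsub>A\<^esub>, ring.zero = \<zero>\<^bsub>A\<^esub>, ring.add = (\<oplus>\<^bsub>A\<^esub>),
     lact = (\<otimes>\<^bsub>A\<^esub>), ract = (\<otimes>\<^bsub>A\<^esub>)\<rparr>"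

text \<open>Left module maps do not refer to the right actions.\<close>

definition left_hom ::
    "(complex, 'a) module \<Rightarrow> ('a, 'e) bimodule \<Rightarrow> ('a, 'f) bimodule \<Rightarrow> ('e \<Rightarrow> 'f) \<Rightarrow> bool" where
  "left_hom A E F f \<longleftrightarrow>
     f \<in> carrier E \<rightarrow> carrier F \<and>
     (\<forall>x\<in>carrier E. \<forall>y\<in>carrier E. f (x \<oplus>\<^bsub>E\<^esub> y) = f x \<oplus>\<^bsub>F\<^esub> f y) \<and>
     (\<forall>a\<in>carrier A. \<forall>x\<in>carrier E. f (lact E a x) = lact F a (f x))"

definition bimodule_iso ::
    "(complex, 'a) module \<Rightarrow> ('a, 'e) bimodule \<Rightarrow> ('a, 'f) bimodule \<Rightarrow> ('e \<Rightarrow> 'f) \<Rightarrow> bool" where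
  "bimodule_iso A E F f \<longleftrightarrow>
     left_hom A E F f \<and>
     (\<forall>a\<in>carrier A. \<forall>x\<in>carrier E. f (ract E x a) = ract F (f x) a) \<and>
     bij_betw f (carrier E) (carrier F)"

text \<open>Elements of the dual are extensional functions, so that two left module maps agreeing on
  \<open>carrier E\<close> are equal.\<close>

definition dual :: "(complex, 'a) module \<Rightarrow> ('a, 'e) bimodule \<Rightarrow> ('a, 'e \<Rightarrow> 'a) bimodule" where
  "dual A E = \<lparr>carrier = {\<alpha> \<in> extensional (carrier E). left_hom A E (regular A) \<alpha>},
     monoid.mult = undefined, one = undefined,
     ring.zero = (\<lambda>e\<in>carrier E. \<zero>\<^bsub>A\<^esub>),
     ring.add = (\<lambda>\<alpha> \<beta>. \<lambda>e\<in>carrier E. \<alpha> e \<oplus>\<^bsub>A\<^esub> \<beta> e),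
     lact = (\<lambda>a \<alpha>. \<lambda>e\<in>carrier E. \<alpha> (ract E e a)),
     ract = (\<lambda>\<alpha> a. \<lambda>e\<in>carrier E. \<alpha> e \<otimes>\<^bsub>A\<^esub> a)\<rparr>"

definition free_module :: "(complex, 'a) module \<Rightarrow> nat \<Rightarrow> ('a, nat \<Rightarrow> 'a) bimodule" where
  "free_module A n = \<lparr>carrier = {..<n} \<rightarrow>\<^sub>E carrier A,
     monoid.mult = undefined, one = undefined,
     ring.zero = (\<lambda>i\<in>{..<n}. \<zero>\<^bsub>A\<^esub>),
     ring.add = (\<lambda>x y. \<lambda>i\<in>{..<n}. x i \<oplus>\<^bsub>A\<^esub> y i),
     lact = (\<lambda>a x. \<lambda>i\<in>{..<n}. a \<otimes>\<^bsub>A\<^esub> x i),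
     ract = (\<lambda>x a. \<lambda>i\<in>{..<n}. x i \<otimes>\<^bsub>A\<^esub> a)\<rparr>"

text \<open>Finitely generated projective left modules are the direct summands (retracts) of the free
  left modules of finite rank.\<close>

definition fgp_left :: "(complex, 'a) module \<Rightarrow> ('a, 'e) bimodule \<Rightarrow> bool" where
  "fgp_left A E \<longleftrightarrow> (\<exists>n \<iota> \<pi>. left_hom A E (free_module A n) \<iota> \<and> left_hom A (free_module A n) E \<pi> \<and>
     (\<forall>e\<in>carrier E. \<pi> (\<iota> e) = e))"

definition dual_basis ::
    "(complex, 'a) module \<Rightarrow> ('a, 'e) bimodule \<Rightarrow> 'e list \<Rightarrow> ('e \<Rightarrow> 'a) list \<Rightarrow> bool" where
  "dual_basis A E es \<epsilon>s \<longleftrightarrow>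
     length es = length \<epsilon>s \<and> set es \<subseteq> carrier E \<and> set \<epsilon>s \<subseteq> carrier (dual A E) \<and>
     (\<forall>f\<in>carrier E. f = (\<Oplus>\<^bsub>E\<^esub>i\<in>{..<length es}. lact E ((\<epsilon>s ! i) f) (es ! i)))"


section \<open>Tensor products over A\<close>

text \<open>The tensor product of a nonempty list of bimodules \<open>E\<^sub>0, \<dots>, E\<^sub>k\<close> whose elements share a
  common type is the free abelian group on the words \<open>[x\<^sub>0, \<dots>, x\<^sub>k]\<close> with \<open>x\<^sub>i\<close> in \<open>E\<^sub>i\<close>, modulo
  additivity in each letter and the relations that move a scalar between adjacent letters. In this
  form the tensor product is strictly associative, and a list \<open>[E]\<close> of length one gives \<open>E\<close> up to the
  canonical isomorphism taking \<open>x\<close> to the class of \<open>[x]\<close>.\<close>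

definition words :: "('a, 'u) bimodule list \<Rightarrow> 'u list set" where
  "words Es = listset (map carrier Es)"

definition tensor_rels ::
    "(complex, 'a) module \<Rightarrow> ('a, 'u) bimodule list \<Rightarrow> ('u list \<Rightarrow>\<^sub>0 int) set" where
  "tensor_rels A Es =
     {frag_of (w[i := x \<oplus>\<^bsub>Es ! i\<^esub> y]) - frag_of (w[i := x]) - frag_of (w[i := y]) | w i x y.
        w \<in> words Es \<and> i < length Es \<and> x \<in> carrier (Es ! i) \<and> y \<in> carrier (Es ! i)} \<union>
     {frag_of (w[i := ract (Es ! i) (w ! i) a]) -
      frag_of (w[Suc i := lact (Es ! Suc i) a (w ! Suc i)]) | w i a.
        w \<in> words Es \<and> Suc i < length Es \<and> a \<in> carrier A}"

definition tensor_group ::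
    "(complex, 'a) module \<Rightarrow> ('a, 'u) bimodule list \<Rightarrow> ('u list \<Rightarrow>\<^sub>0 int) set monoid" where
  "tensor_group A Es =
     free_Abelian_group (words Es) Mod generate (free_Abelian_group (words Es)) (tensor_rels A Es)"

definition tensor_class ::
    "(complex, 'a) module \<Rightarrow> ('a, 'u) bimodule list \<Rightarrow> ('u list \<Rightarrow>\<^sub>0 int) \<Rightarrow> ('u list \<Rightarrow>\<^sub>0 int) set" where
  "tensor_class A Es z =
     generate (free_Abelian_group (words Es)) (tensor_rels A Es) #>\<^bsub>free_Abelian_group (words Es)\<^esub> z"

definition word_lact :: "('a, 'u) bimodule list \<Rightarrow> 'a \<Rightarrow> 'u list \<Rightarrow> 'u list" where
  "word_lact Es a w = w[0 := lact (hd Es) a (hd w)]"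

definition word_ract :: "('a, 'u) bimodule list \<Rightarrow> 'u list \<Rightarrow> 'a \<Rightarrow> 'u list" where
  "word_ract Es w a = w[length w - 1 := ract (last Es) (last w) a]"

text \<open>Maps on tensor products are given on words, extended additively by \<^const>\<open>frag_extend\<close> and
  passed to classes by a union over representatives, as in \<^theory>\<open>HOL.Equiv_Relations\<close>: the union is
  itself a class exactly when the map does not depend on the representative.\<close>

definition tensor ::
    "(complex, 'a) module \<Rightarrow> ('a, 'u) bimodule list \<Rightarrow> ('a, ('u list \<Rightarrow>\<^sub>0 int) set) bimodule" where
  "tensor A Es = \<lparr>carrier = carrier (tensor_group A Es),
     monoid.mult = undefined, one = undefined,
     ring.zero = \<one>\<^bsub>tensor_group A Es\<^esub>,
     ring.add = (\<otimes>\<^bsub>tensor_group A Es\<^esub>),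
     lact = (\<lambda>a P. \<Union>x\<in>P. tensor_class A Es (frag_extend (\<lambda>w. frag_of (word_lact Es a w)) x)),
     ract = (\<lambda>P a. \<Union>x\<in>P. tensor_class A Es (frag_extend (\<lambda>w. frag_of (word_ract Es w a)) x))\<rparr>"


section \<open>Weak left line modules\<close>

text \<open>The algebra, the bimodule L and its dual are copied into one type of letters, so that they can
  occur in the same tensor product.\<close>

datatype ('a, 'm) letter = Sca (sca: 'a) | Vec (vec: 'm) | Cov (cov: "'m \<Rightarrow> 'a")

definition relabel :: "('e \<Rightarrow> 'u) \<Rightarrow> ('u \<Rightarrow> 'e) \<Rightarrow> ('a, 'e) bimodule \<Rightarrow> ('a, 'u) bimodule" where
  "relabel c s E = \<lparr>carrier = c ` carrier E,
     monoid.mult = undefined, one = undefined,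
     ring.zero = c \<zero>\<^bsub>E\<^esub>,
     ring.add = (\<lambda>x y. c (s x \<oplus>\<^bsub>E\<^esub> s y)),
     lact = (\<lambda>a x. c (lact E a (s x))),
     ract = (\<lambda>x a. c (ract E (s x) a))\<rparr>"

definition A_bim :: "(complex, 'a) module \<Rightarrow> ('a, ('a, 'm) letter) bimodule" where
  "A_bim A = relabel Sca sca (regular A)"

definition L_bim :: "('a, 'm) bimodule \<Rightarrow> ('a, ('a, 'm) letter) bimodule" where
  "L_bim L = relabel Vec vec L"

definition D_bim :: "(complex, 'a) module \<Rightarrow> ('a, 'm) bimodule \<Rightarrow> ('a, ('a, 'm) letter) bimodule" where
  "D_bim A L = relabel Cov cov (dual A L)"

text \<open>The class of \<open>\<Sum>\<^sub>i e\<^sub>i \<otimes> e\<^sup>i\<close> in \<open>L\<degree> \<otimes>\<^sub>A L\<close> does not depend on the chosen dual basis.\<close>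

definition coev_one :: "(complex, 'a) module \<Rightarrow> ('a, 'm) bimodule \<Rightarrow> (('a, 'm) letter list \<Rightarrow>\<^sub>0 int) set" where
  "coev_one A L =
     (let (es, \<epsilon>s) = (SOME (es, \<epsilon>s). dual_basis A L es \<epsilon>s)
      in tensor_class A [D_bim A L, L_bim L]
           (\<Sum>i<length es. frag_of [Cov (\<epsilon>s ! i), Vec (es ! i)]))"

definition coev :: "(complex, 'a) module \<Rightarrow> ('a, 'm) bimodule \<Rightarrow> 'a \<Rightarrow> (('a, 'm) letter list \<Rightarrow>\<^sub>0 int) set" where
  "coev A L a = lact (tensor A [D_bim A L, L_bim L]) a (coev_one A L)"

definition weak_left_line_module :: "(complex, 'a) module \<Rightarrow> ('a, 'm) bimodule \<Rightarrow> bool" where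
  "weak_left_line_module A L \<longleftrightarrow>
     bimodule A L \<and> fgp_left A L \<and>
     bimodule_iso A (regular A) (tensor A [D_bim A L, L_bim L]) (coev A L)"


section \<open>The algebra \<open>T\<^sub>\<int>(L)\<close>\<close>

definition pow_factor ::
    "(complex, 'a) module \<Rightarrow> ('a, 'm) bimodule \<Rightarrow> int \<Rightarrow> ('a, ('a, 'm) letter) bimodule" where
  "pow_factor A L n = (if n = 0 then A_bim A else if n > 0 then L_bim L else D_bim A L)"

definition pow_factors ::
    "(complex, 'a) module \<Rightarrow> ('a, 'm) bimodule \<Rightarrow> int \<Rightarrow> ('a, ('a, 'm) letter) bimodule list" where
  "pow_factors A L n = (if n = 0 then [A_bim A] else replicate (nat \<bar>n\<bar>) (pow_factor A L n))"

definition L_pow :: "(complex, 'a) module \<Rightarrow> ('a, 'm) bimodule \<Rightarrow> int \<Rightarrow>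
    ('a, (('a, 'm) letter list \<Rightarrow>\<^sub>0 int) set) bimodule" where
  "L_pow A L n = tensor A (pow_factors A L n)"

definition ev :: "('a, 'm) letter \<Rightarrow> ('a, 'm) letter \<Rightarrow> 'a" where
  "ev x \<alpha> = cov \<alpha> (vec x)"

definition coev_inv ::
    "(complex, 'a) module \<Rightarrow> ('a, 'm) bimodule \<Rightarrow> ('a, 'm) letter \<Rightarrow> ('a, 'm) letter \<Rightarrow> 'a" where
  "coev_inv A L \<alpha> x =
     inv_into (carrier A) (coev A L) (tensor_class A [D_bim A L, L_bim L] (frag_of [\<alpha>, x]))"

text \<open>For \<open>p\<close> = \<^const>\<open>ev\<close> or \<^const>\<open>coev_inv\<close>, this is the value of the n-fold pairing, defined by the recursion
  \<open>p\<^sup>n = p(id \<otimes> p\<^sup>n\<^sup>-\<^sup>1 \<otimes> id)\<close>, on a word of length n followed by another of length n. The innermost letters are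
  paired first; \<open>E\<close> is the bimodule containing the letters of the first word.\<close>

fun nested :: "('u \<Rightarrow> 'u \<Rightarrow> 'a) \<Rightarrow> ('a, 'u) bimodule \<Rightarrow> 'u list \<Rightarrow> 'u list \<Rightarrow> 'a" where
  "nested p E [x] [y] = p x y"
| "nested p E (x # x' # xs) ys = p (ract E x (nested p E (x' # xs) (butlast ys))) (last ys)"

text \<open>The product \<open>L\<^sup>n \<otimes>\<^sub>A L\<^sup>m \<rightarrow> L\<^sup>n\<^sup>+\<^sup>m\<close> on words.\<close>

definition word_prod :: "(complex, 'a) module \<Rightarrow> ('a, 'm) bimodule \<Rightarrow> int \<Rightarrow> int \<Rightarrow>
    ('a, 'm) letter list \<Rightarrow> ('a, 'm) letter list \<Rightarrow> ('a, 'm) letter list" where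
  "word_prod A L n m u v =
     (if n = 0 then word_lact (pow_factors A L m) (sca (hd u)) v
      else if m = 0 then word_ract (pow_factors A L n) u (sca (hd v))
      else if sgn n = sgn m then u @ v
      else
        let p = nested (if n > 0 then ev else coev_inv A L) (pow_factor A L n);
            k = nat \<bar>n\<bar>; l = nat \<bar>m\<bar>
        in if k = l then [Sca (p u v)]
           else if k < l then word_lact (pow_factors A L (n + m)) (p u (take k v)) (drop k v)
           else word_ract (pow_factors A L (n + m)) (take (k - l) u) (p (drop (k - l) u) v))"

definition pow_mult :: "(complex, 'a) module \<Rightarrow> ('a, 'm) bimodule \<Rightarrow> int \<Rightarrow> int \<Rightarrow>
    (('a, 'm) letter list \<Rightarrow>\<^sub>0 int) set \<Rightarrow> (('a, 'm) letter list \<Rightarrow>\<^sub>0 int) set \<Rightarrow>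
    (('a, 'm) letter list \<Rightarrow>\<^sub>0 int) set" where
  "pow_mult A L n m P Q =
     (\<Union>x\<in>P. \<Union>y\<in>Q. tensor_class A (pow_factors A L (n + m))
        (frag_extend (\<lambda>u. frag_extend (\<lambda>v. frag_of (word_prod A L n m u v)) y) x))"

definition TZ :: "(complex, 'a) module \<Rightarrow> ('a, 'm) bimodule \<Rightarrow>
    (complex, int \<Rightarrow> (('a, 'm) letter list \<Rightarrow>\<^sub>0 int) set) module" where
  "TZ A L = \<lparr>
     carrier = {t. (\<forall>n. t n \<in> carrier (L_pow A L n)) \<and> finite {n. t n \<noteq> \<zero>\<^bsub>L_pow A L n\<^esub>}},
     monoid.mult = (\<lambda>s t k. \<Oplus>\<^bsub>L_pow A L k\<^esub>n\<in>{n. s n \<noteq> \<zero>\<^bsub>L_pow A L n\<^esub>}. pow_mult A L n (k - n) (s n) (t (k - n))),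
     one = (\<lambda>n. if n = 0 then tensor_class A [A_bim A] (frag_of [Sca \<one>\<^bsub>A\<^esub>]) else \<zero>\<^bsub>L_pow A L n\<^esub>),
     ring.zero = (\<lambda>n. \<zero>\<^bsub>L_pow A L n\<^esub>),
     ring.add = (\<lambda>s t n. s n \<oplus>\<^bsub>L_pow A L n\<^esub> t n),
     module.smult = (\<lambda>c t n. lact (L_pow A L n) (c \<odot>\<^bsub>A\<^esub> \<one>\<^bsub>A\<^esub>) (t n))\<rparr>"

end

theory Submission
  imports Defs
begin

text \<open>Write \<open>\<langle>x, y\<rangle>\<close> for ev on \<open>L \<otimes> L\<degree>\<close> and for the inverse of coev on \<open>L\<degree> \<otimes> L\<close>. Both pairings
  are bilinear and balanced, and they satisfy the zigzag identity \<open>x\<langle>y, z\<rangle> = \<langle>x, y\<rangle>z\<close>: for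
  \<open>\<alpha> \<otimes> y = coev(b) = \<Sum>\<^sub>i b e\<^sub>i \<otimes> e\<^sup>i\<close> with \<open>b = \<langle>\<alpha>, y\<rangle>\<close>, the dual basis expansion gives
  \<open>\<langle>x, \<alpha>\<rangle>y = \<Sum>\<^sub>i e\<^sub>i(xb) e\<^sup>i = xb\<close>, and similarly for \<open>\<alpha>\<langle>y, \<beta>\<rangle>\<close>.

  The product of two words of opposite sign is computed by pairing the two innermost letters and
  moving the resulting scalar between the remaining words. By induction along this cancellation the
  product is additive in each letter and balanced, so it is defined on classes. For associativity,
  the elements \<open>Q\<close> with \<open>(PQ)R = P(QR)\<close> for all \<open>P\<close> and \<open>R\<close> are closed under differences and products,
  so it is enough that they contain the scalars and the single letters. If \<open>Q\<close> is a letter and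
  \<open>P\<close>, \<open>R\<close> are words, both sides agree after one cancellation step, except when both neighbours
  of \<open>Q\<close> can be paired with it; that case is the zigzag identity.\<close>

section \<open>Generators and relations of tensor products\<close>

text \<open>The product of words of opposite signs depends on which word is longer, so a direct
  proof of associativity would compare the lengths of three words in every sign pattern. A single
  letter in the middle avoids this, since it can meet at most one partner on either side; closure of
  the nucleus under products then supplies longer words. Three obstacles shape the rest. The actions
  and the product are unions over representatives, so each has a usable value only once the map on
  words is known to respect the relations. Words for the same tensor may differ in the place of a
  scalar, so some identities hold for words and others only for their classes. The inverse of coev
  has no formula on letters: its properties are read off after applying coev, and the only explicit
  information is the expansion of coev in the dual basis chosen in \<open>coev_one\<close>. The
  complex structure is then cheap, because scalar multiplication in \<open>TZ\<close> is
  multiplication by a central element of degree 0.\<close>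

lemma listset_iff:
  "w \<in> listset Ss \<longleftrightarrow> length w = length Ss \<and> (\<forall>i<length Ss. w ! i \<in> Ss ! i)"
proof (induction Ss arbitrary: w)
  case (Cons S Ss)
  show ?case
    by (cases w) (auto simp: set_Cons_def Cons.IH nth_Cons split: nat.splits)
qed simp

lemma words_iff:
  "w \<in> words Es \<longleftrightarrow> length w = length Es \<and> (\<forall>i<length Es. w ! i \<in> carrier (Es ! i))"
  by (auto simp: words_def listset_iff)

lemma words_update:
  "\<lbrakk>w \<in> words Es; i < length Es \<Longrightarrow> x \<in> carrier (Es ! i)\<rbrakk> \<Longrightarrow> w[i := x] \<in> words Es"
  by (cases "i < length Es") (auto simp: words_iff nth_list_update)

text \<open>Apart from closedness, the clauses are the relations of \<open>tensor_rels\<close>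
  turned into equations in \<open>G\<close>. Only the additive structure of \<open>G\<close>
  matters, so the values may lie in a tensor product, in \<open>L\<close> or in \<open>A\<close>
  itself.\<close>

definition balanced_map ::
    "(complex, 'a) module \<Rightarrow> ('a, 'u) bimodule list \<Rightarrow> ('g, 'h) ring_scheme \<Rightarrow> ('u list \<Rightarrow> 'g) \<Rightarrow> bool" where
  "balanced_map A Es G \<phi> \<longleftrightarrow>
     (\<forall>w\<in>words Es. \<phi> w \<in> carrier G) \<and>
     (\<forall>w i x y. w \<in> words Es \<longrightarrow> i < length Es \<longrightarrow> x \<in> carrier (Es ! i) \<longrightarrow> y \<in> carrier (Es ! i) \<longrightarrow>
        \<phi> (w[i := x \<oplus>\<^bsub>Es ! i\<^esub> y]) = \<phi> (w[i := x]) \<oplus>\<^bsub>G\<^esub> \<phi> (w[i := y])) \<and>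
     (\<forall>w i a. w \<in> words Es \<longrightarrow> Suc i < length Es \<longrightarrow> a \<in> carrier A \<longrightarrow>
        \<phi> (w[i := ract (Es ! i) (w ! i) a]) = \<phi> (w[Suc i := lact (Es ! Suc i) a (w ! Suc i)]))"

text \<open>Stated for differences because induction in the form
  \<open>free_Abelian_group_induct\<close> builds elements from generators by subtraction.\<close>

lemma frag_hom_diff:
  assumes h: "h \<in> hom (free_Abelian_group S) (add_monoid G)" and G: "abelian_group G"
    and x: "Poly_Mapping.keys x \<subseteq> S" and y: "Poly_Mapping.keys y \<subseteq> S"
  shows "h (x - y) = h x \<ominus>\<^bsub>G\<^esub> h y"
proof -
  interpret G: abelian_group G by (fact G)
  interpret group_hom "free_Abelian_group S" "add_monoid G" h
    using h G.a_group by (simp add: group_hom_def group_hom_axioms_def)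
  have "h (- y) = \<ominus>\<^bsub>G\<^esub> h y"
    using hom_inv[of y] y by (simp add: a_inv_def)
  moreover have "h (x + - y) = h x \<oplus>\<^bsub>G\<^esub> h (- y)"
    using hom_mult[of x "- y"] x y by simp
  ultimately show ?thesis by (simp add: a_minus_def)
qed

lemma frag_hom_eqI:
  assumes g: "g \<in> hom (free_Abelian_group S) (add_monoid G)"
    and h: "h \<in> hom (free_Abelian_group S) (add_monoid G)" and G: "abelian_group G"
    and gh: "\<And>w. w \<in> S \<Longrightarrow> g (frag_of w) = h (frag_of w)"
    and x: "Poly_Mapping.keys x \<subseteq> S"
  shows "g x = h x"
proof (rule free_Abelian_group_induct[OF x, where P = "\<lambda>x. g x = h x"])
  show "g 0 = h 0"
    using hom_one[OF g] hom_one[OF h] abelian_group.a_group[OF G] by simp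
qed (simp_all add: gh frag_hom_diff[OF g G] frag_hom_diff[OF h G])

section \<open>The tensor product as a quotient group and its universal property\<close>

locale bimodule_list =
  fixes A :: "(complex, 'a) module" and Es :: "('a, 'u) bimodule list"
  assumes bimodules: "E \<in> set Es \<Longrightarrow> bimodule A E"
begin

abbreviation "FG \<equiv> free_Abelian_group (words Es)"
abbreviation "rel_span \<equiv> generate FG (tensor_rels A Es)"
abbreviation "gen w \<equiv> tensor_class A Es (frag_of w)"

lemma nth_bimodule: "i < length Es \<Longrightarrow> bimodule A (Es ! i)"
  by (simp add: bimodules)

lemma rels_closed: "tensor_rels A Es \<subseteq> carrier FG"
proof -
  have "frag_of (w[i := x \<oplus>\<^bsub>Es ! i\<^esub> y]) - frag_of (w[i := x]) - frag_of (w[i := y]) \<in> carrier FG"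
    if "w \<in> words Es" "i < length Es" "x \<in> carrier (Es ! i)" "y \<in> carrier (Es ! i)" for w i x y
  proof -
    interpret bimodule A "Es ! i" using nth_bimodule that by blast
    show ?thesis
      using that by (simp add: keys_diff[THEN order_trans] words_update)
  qed
  moreover have "frag_of (w[i := ract (Es ! i) (w ! i) a]) -
      frag_of (w[Suc i := lact (Es ! Suc i) a (w ! Suc i)]) \<in> carrier FG"
    if "w \<in> words Es" "Suc i < length Es" "a \<in> carrier A" for w i a
  proof -
    interpret E: bimodule A "Es ! i" using nth_bimodule that by simp
    interpret F: bimodule A "Es ! Suc i" using nth_bimodule that by simp
    have "w ! i \<in> carrier (Es ! i)" "w ! Suc i \<in> carrier (Es ! Suc i)"
      using that by (auto simp: words_iff)
    then show ?thesis
      using that by (simp add: keys_diff[THEN order_trans] words_update E.ract_closed F.lact_closed)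
  qed
  ultimately show ?thesis
    unfolding tensor_rels_def by blast
qed

lemma FG_comm: "comm_group FG"
  by (rule abelian_free_Abelian_group)

lemma rel_span_subgroup: "subgroup rel_span FG"
  using group.generate_is_subgroup[OF group_free_Abelian_group rels_closed] .

lemma rel_span_normal: "normal rel_span FG"
  using comm_group.subgroup_imp_normal[OF FG_comm rel_span_subgroup] .

lemma rel_span_keys: "z \<in> rel_span \<Longrightarrow> Poly_Mapping.keys z \<subseteq> words Es"
  using subgroup.mem_carrier[OF rel_span_subgroup] by simp

lemma tensor_class_eq_iff:
  assumes "Poly_Mapping.keys y \<subseteq> words Es" "Poly_Mapping.keys z \<subseteq> words Es"
  shows "tensor_class A Es y = tensor_class A Es z \<longleftrightarrow> y - z \<in> rel_span"
proof -
  interpret F: group FG by simp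
  interpret N: subgroup rel_span FG by (rule rel_span_subgroup)
  have "tensor_class A Es y = tensor_class A Es z \<longleftrightarrow> y \<in> rel_span #>\<^bsub>FG\<^esub> z"
    unfolding tensor_class_def
    using F.repr_independence[OF _ _ rel_span_subgroup, of y z] F.rcos_self[OF _ rel_span_subgroup, of y] assms
    by auto
  also have "\<dots> \<longleftrightarrow> y - z \<in> rel_span"
    using N.rcos_module[OF F.is_group, of z y] assms by simp
  finally show ?thesis .
qed

text \<open>The actions and the product are unions over the members of a class; this turns the
  choice of a member into an equation between classes.\<close>

lemma mem_tensor_class_iff:
  assumes "Poly_Mapping.keys z \<subseteq> words Es"
  shows "y \<in> tensor_class A Es z \<longleftrightarrow>
    Poly_Mapping.keys y \<subseteq> words Es \<and> tensor_class A Es y = tensor_class A Es z"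
proof -
  interpret F: group FG by simp
  interpret N: subgroup rel_span FG by (rule rel_span_subgroup)
  show ?thesis
    using F.repr_independence[OF _ _ rel_span_subgroup, of y z] F.rcos_self[OF _ rel_span_subgroup, of y] assms
      N.elemrcos_carrier[OF F.is_group, of z y]
    unfolding tensor_class_def by auto
qed

lemma tensor_carrier_iff:
  "P \<in> carrier (tensor A Es) \<longleftrightarrow> (\<exists>z. Poly_Mapping.keys z \<subseteq> words Es \<and> P = tensor_class A Es z)"
  unfolding tensor_def tensor_group_def tensor_class_def by (simp add: carrier_FactGroup image_iff Bex_def)

lemma tensor_class_closed:
  "Poly_Mapping.keys z \<subseteq> words Es \<Longrightarrow> tensor_class A Es z \<in> carrier (tensor A Es)"
  by (auto simp: tensor_carrier_iff)

lemma tensor_class_add: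
  assumes "Poly_Mapping.keys y \<subseteq> words Es" "Poly_Mapping.keys z \<subseteq> words Es"
  shows "tensor_class A Es (y + z) = tensor_class A Es y \<oplus>\<^bsub>tensor A Es\<^esub> tensor_class A Es z"
  using normal.rcos_sum[OF rel_span_normal, of y z] assms
  by (simp add: tensor_def tensor_group_def tensor_class_def)

lemma tensor_zero: "\<zero>\<^bsub>tensor A Es\<^esub> = tensor_class A Es 0"
  using group.coset_mult_one[OF group_free_Abelian_group subgroup.subset[OF rel_span_subgroup]]
  by (simp add: tensor_def tensor_group_def tensor_class_def)

lemma tensor_abelian: "abelian_group (tensor A Es)"
proof -
  interpret Q: comm_group "tensor_group A Es"
    unfolding tensor_group_def by (rule comm_group.abelian_FactGroup[OF FG_comm rel_span_subgroup])
  have [simp]: "carrier (tensor A Es) = carrier (tensor_group A Es)"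
    "ring.add (tensor A Es) = monoid.mult (tensor_group A Es)"
    "\<zero>\<^bsub>tensor A Es\<^esub> = \<one>\<^bsub>tensor_group A Es\<^esub>"
    by (simp_all add: tensor_def)
  show ?thesis
  proof (rule abelian_groupI)
    fix x assume "x \<in> carrier (tensor A Es)"
    then show "\<exists>y\<in>carrier (tensor A Es). y \<oplus>\<^bsub>tensor A Es\<^esub> x = \<zero>\<^bsub>tensor A Es\<^esub>"
      by (auto intro!: bexI[of _ "inv\<^bsub>tensor_group A Es\<^esub> x"])
  next
    fix x y assume "x \<in> carrier (tensor A Es)" "y \<in> carrier (tensor A Es)"
    then show "x \<oplus>\<^bsub>tensor A Es\<^esub> y = y \<oplus>\<^bsub>tensor A Es\<^esub> x"
      using Q.m_comm[of x y] by simp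
  qed (simp_all add: Q.m_assoc)
qed

lemma tensor_class_hom: "tensor_class A Es \<in> hom FG (add_monoid (tensor A Es))"
  by (rule homI) (simp_all add: tensor_class_closed tensor_class_add)

lemmas tensor_class_diff = frag_hom_diff[OF tensor_class_hom tensor_abelian]

lemma gen_closed: "w \<in> words Es \<Longrightarrow> gen w \<in> carrier (tensor A Es)"
  by (simp add: tensor_class_closed)

lemma gen_balanced: "balanced_map A Es (tensor A Es) gen"
proof -
  interpret T: abelian_group "tensor A Es" by (rule tensor_abelian)
  have "gen (w[i := x \<oplus>\<^bsub>Es ! i\<^esub> y]) = gen (w[i := x]) \<oplus>\<^bsub>tensor A Es\<^esub> gen (w[i := y])"
    if *: "w \<in> words Es" "i < length Es" "x \<in> carrier (Es ! i)" "y \<in> carrier (Es ! i)" for w i x y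
  proof -
    interpret bimodule A "Es ! i" using nth_bimodule that by blast
    have "frag_of (w[i := x \<oplus>\<^bsub>Es ! i\<^esub> y]) - frag_of (w[i := x]) - frag_of (w[i := y]) \<in> tensor_rels A Es"
      unfolding tensor_rels_def using * by blast
    then have "frag_of (w[i := x \<oplus>\<^bsub>Es ! i\<^esub> y]) - (frag_of (w[i := x]) + frag_of (w[i := y])) \<in> rel_span"
      by (auto simp: algebra_simps intro: generate.incl)
    then have "gen (w[i := x \<oplus>\<^bsub>Es ! i\<^esub> y]) = tensor_class A Es (frag_of (w[i := x]) + frag_of (w[i := y]))"
      using * keys_add[of "frag_of (w[i := x])" "frag_of (w[i := y])"]
      by (subst tensor_class_eq_iff) (auto simp: words_update)
    then show ?thesis
      using * by (simp add: tensor_class_add words_update)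
  qed
  moreover have "gen (w[i := ract (Es ! i) (w ! i) a]) = gen (w[Suc i := lact (Es ! Suc i) a (w ! Suc i)])"
    if *: "w \<in> words Es" "Suc i < length Es" "a \<in> carrier A" for w i a
  proof -
    interpret E: bimodule A "Es ! i" using nth_bimodule that by simp
    interpret F: bimodule A "Es ! Suc i" using nth_bimodule that by simp
    have "w ! i \<in> carrier (Es ! i)" "w ! Suc i \<in> carrier (Es ! Suc i)"
      using * by (auto simp: words_iff)
    moreover have "frag_of (w[i := ract (Es ! i) (w ! i) a]) -
      frag_of (w[Suc i := lact (Es ! Suc i) a (w ! Suc i)]) \<in> tensor_rels A Es"
      unfolding tensor_rels_def using * by blast
    ultimately show ?thesis
      using * by (subst tensor_class_eq_iff) (auto simp: words_update E.ract_closed F.lact_closed intro: generate.incl)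
  qed
  ultimately show ?thesis
    unfolding balanced_map_def by (auto simp: gen_closed)
qed

text \<open>Each relator is the left side minus the right side of an instance of balancedness, hence
  is killed by \<open>h\<close>; the kernel of \<open>h\<close> is a subgroup and so contains all
  that the relators generate.\<close>

lemma balanced_hom_rel_span:
  assumes h: "h \<in> hom FG (add_monoid G)" and G: "abelian_group G"
    and bal: "balanced_map A Es G (\<lambda>w. h (frag_of w))" and z: "z \<in> rel_span"
  shows "h z = \<zero>\<^bsub>G\<^esub>"
proof -
  interpret G: abelian_group G by (fact G)
  interpret H: group_hom FG "add_monoid G" h
    using h G.a_group by (simp add: group_hom_def group_hom_axioms_def)
  have rel0: "h r = \<zero>\<^bsub>G\<^esub>" if "r \<in> tensor_rels A Es" for r
    using that unfolding tensor_rels_def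
  proof (elim UnE CollectE exE conjE)
    fix w i x y
    assume r: "r = frag_of (w[i := x \<oplus>\<^bsub>Es ! i\<^esub> y]) - frag_of (w[i := x]) - frag_of (w[i := y])"
      and *: "w \<in> words Es" "i < length Es" "x \<in> carrier (Es ! i)" "y \<in> carrier (Es ! i)"
    interpret bimodule A "Es ! i" using nth_bimodule * by blast
    have "h (frag_of (w[i := x \<oplus>\<^bsub>Es ! i\<^esub> y])) = h (frag_of (w[i := x])) \<oplus>\<^bsub>G\<^esub> h (frag_of (w[i := y]))"
      using bal * unfolding balanced_map_def by blast
    moreover have c: "h (frag_of (w[i := x])) \<in> carrier G" "h (frag_of (w[i := y])) \<in> carrier G"
      using bal * unfolding balanced_map_def by (auto simp: words_update)
    ultimately have "h (frag_of (w[i := x \<oplus>\<^bsub>Es ! i\<^esub> y])) \<ominus>\<^bsub>G\<^esub> h (frag_of (w[i := x])) = h (frag_of (w[i := y]))"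
      by (simp add: G.minus_eq G.a_comm[of "h (frag_of (w[i := x]))"] G.a_assoc G.r_neg)
    then show ?thesis
      unfolding r using * c
      by (simp add: frag_hom_diff[OF h G] keys_diff[THEN order_trans] words_update G.minus_eq G.r_neg)
  next
    fix w i a
    assume r: "r = frag_of (w[i := ract (Es ! i) (w ! i) a]) -
      frag_of (w[Suc i := lact (Es ! Suc i) a (w ! Suc i)])"
      and *: "w \<in> words Es" "Suc i < length Es" "a \<in> carrier A"
    interpret E: bimodule A "Es ! i" using nth_bimodule * by simp
    interpret F: bimodule A "Es ! Suc i" using nth_bimodule * by simp
    have w: "w ! i \<in> carrier (Es ! i)" "w ! Suc i \<in> carrier (Es ! Suc i)"
      using * by (auto simp: words_iff)
    have "h (frag_of (w[i := ract (Es ! i) (w ! i) a])) = h (frag_of (w[Suc i := lact (Es ! Suc i) a (w ! Suc i)]))"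
      using bal * unfolding balanced_map_def by blast
    moreover have "h (frag_of (w[Suc i := lact (Es ! Suc i) a (w ! Suc i)])) \<in> carrier G"
      using bal * w unfolding balanced_map_def by (auto simp: words_update F.lact_closed)
    ultimately show ?thesis
      unfolding r using * w
      by (simp add: frag_hom_diff[OF h G] words_update E.ract_closed F.lact_closed G.minus_eq G.r_neg)
  qed
  from z show ?thesis
  proof (induction rule: generate.induct)
    case one
    then show ?case using H.hom_one by simp
  next
    case (inv r)
    then have r: "r \<in> carrier FG" using rels_closed by blast
    then show ?case using H.hom_inv[OF r] rel0[OF inv] by (simp add: a_inv_def[symmetric])
  next
    case (eng y z)
    then have "y \<in> carrier FG" "z \<in> carrier FG" using rel_span_keys by auto
    then show ?case using H.hom_mult[of y z] eng by simp
  qed (rule rel0)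
qed

text \<open>The difference of two representatives lies in \<open>rel_span\<close>. Every later proof
  that a map on words is well defined on classes rests on this.\<close>

lemma balanced_hom_eq:
  assumes h: "h \<in> hom FG (add_monoid G)" and G: "abelian_group G"
    and bal: "balanced_map A Es G (\<lambda>w. h (frag_of w))"
    and yz: "Poly_Mapping.keys y \<subseteq> words Es" "Poly_Mapping.keys z \<subseteq> words Es"
      "tensor_class A Es y = tensor_class A Es z"
  shows "h y = h z"
proof -
  interpret G: abelian_group G by (fact G)
  have "h y \<in> carrier G" "h z \<in> carrier G" using hom_in_carrier[OF h] yz by auto
  moreover have "h y \<ominus>\<^bsub>G\<^esub> h z = \<zero>\<^bsub>G\<^esub>"
    using balanced_hom_rel_span[OF h G bal, of "y - z"] yz tensor_class_eq_iff
    by (simp add: frag_hom_diff[OF h G])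
  ultimately show ?thesis using G.minus_equality[of "h y" "\<ominus>\<^bsub>G\<^esub> h z"]
    by (metis G.minus_eq G.a_comm G.a_inv_closed G.minus_minus)
qed

text \<open>Induction on a representative in the free group, carried through the quotient map;
  subtraction as the only operation makes sums and negatives one case.\<close>

lemma tensor_induct [consumes 1, case_names zero gen diff]:
  assumes "P \<in> carrier (tensor A Es)"
    and "Q \<zero>\<^bsub>tensor A Es\<^esub>" "\<And>w. w \<in> words Es \<Longrightarrow> Q (gen w)"
    and "\<And>x y. \<lbrakk>x \<in> carrier (tensor A Es); y \<in> carrier (tensor A Es); Q x; Q y\<rbrakk> \<Longrightarrow> Q (x \<ominus>\<^bsub>tensor A Es\<^esub> y)"
  shows "Q P"
proof -
  obtain z where z: "Poly_Mapping.keys z \<subseteq> words Es" and P: "P = tensor_class A Es z"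
    using assms(1) by (auto simp: tensor_carrier_iff)
  show ?thesis
    unfolding P
  proof (rule free_Abelian_group_induct[OF z])
    show "Q (tensor_class A Es 0)" using assms(2) by (simp add: tensor_zero)
  qed (use assms(3,4) in \<open>simp_all add: tensor_class_diff tensor_class_closed\<close>)
qed

end

lemma frag_extend_hom:
  assumes "\<And>w. w \<in> S \<Longrightarrow> Poly_Mapping.keys (f w) \<subseteq> S'"
  shows "frag_extend f \<in> hom (free_Abelian_group S) (free_Abelian_group S')"
proof (rule homI)
  fix z assume z: "z \<in> carrier (free_Abelian_group S)"
  have "(\<Union>w\<in>Poly_Mapping.keys z. Poly_Mapping.keys (f w)) \<subseteq> S'"
    using z assms by auto
  with keys_frag_extend show "frag_extend f z \<in> carrier (free_Abelian_group S')"
    unfolding carrier_free_Abelian_group_iff by (rule order_trans)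
qed (simp add: frag_extend_add)

text \<open>By \<open>balanced_hom_eq\<close> all sets in the union over representatives are the
  same class, and \<open>z\<close> itself shows that the union is not empty, so it collapses to that
  class.\<close>

lemma tensor_lift:
  assumes Es: "bimodule_list A Es" and Fs: "bimodule_list A Fs"
    and f: "\<And>w. w \<in> words Es \<Longrightarrow> f w \<in> words Fs"
    and bal: "balanced_map A Es (tensor A Fs) (\<lambda>w. tensor_class A Fs (frag_of (f w)))"
    and z: "Poly_Mapping.keys z \<subseteq> words Es"
  shows "(\<Union>x\<in>tensor_class A Es z. tensor_class A Fs (frag_extend (\<lambda>w. frag_of (f w)) x)) =
    tensor_class A Fs (frag_extend (\<lambda>w. frag_of (f w)) z)"
proof -
  interpret E: bimodule_list A Es by (fact Es)
  interpret F: bimodule_list A Fs by (fact Fs)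
  let ?h = "tensor_class A Fs \<circ> frag_extend (\<lambda>w. frag_of (f w))"
  have h: "?h \<in> hom E.FG (add_monoid (tensor A Fs))"
    by (rule Group.hom_compose[OF frag_extend_hom F.tensor_class_hom]) (use f in simp)
  have "balanced_map A Es (tensor A Fs) (\<lambda>w. ?h (frag_of w))"
    using bal by simp
  note eq = E.balanced_hom_eq[OF h F.tensor_abelian this]
  have "tensor_class A Fs (frag_extend (\<lambda>w. frag_of (f w)) x) = tensor_class A Fs (frag_extend (\<lambda>w. frag_of (f w)) z)"
    if "x \<in> tensor_class A Es z" for x
  proof -
    have "Poly_Mapping.keys x \<subseteq> words Es" "tensor_class A Es x = tensor_class A Es z"
      using that E.mem_tensor_class_iff[OF z] by blast+
    from eq[OF this(1) z this(2)] show ?thesis by (simp only: o_apply)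
  qed
  moreover have "z \<in> tensor_class A Es z"
    unfolding E.mem_tensor_class_iff[OF z] using z by blast
  ultimately show ?thesis by blast
qed

lemma frag_hom_sum:
  assumes h: "h \<in> hom (free_Abelian_group S) (add_monoid G)" and G: "abelian_group G"
    and fin: "finite I" and f: "\<And>i. i \<in> I \<Longrightarrow> Poly_Mapping.keys (f i) \<subseteq> S"
  shows "h (\<Sum>i\<in>I. f i) = (\<Oplus>\<^bsub>G\<^esub>i\<in>I. h (f i))"
  using fin f
proof (induction I rule: finite_induct)
  case empty
  then show ?case
    using hom_one[OF h] abelian_group.a_group[OF G]
    by (simp add: abelian_monoid.finsum_empty[OF abelian_group.axioms(1)[OF G]])
next
  case (insert j I)
  interpret G: abelian_group G by (fact G)
  have "h (f i) \<in> carrier G" if "i \<in> insert j I" for i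
    using hom_in_carrier[OF h] insert.prems[OF that] by auto
  moreover have "Poly_Mapping.keys (\<Sum>i\<in>I. f i) \<subseteq> S"
    using sum_closed_free_Abelian_group[of I f S] insert.prems by auto
  ultimately show ?case
    using insert hom_mult[OF h, of "f j" "\<Sum>i\<in>I. f i"] by simp
qed

section \<open>Copies and duals of bimodules\<close>

lemma regular_simps [simp]:
  "carrier (regular A) = carrier A" "\<zero>\<^bsub>regular A\<^esub> = \<zero>\<^bsub>A\<^esub>" "x \<oplus>\<^bsub>regular A\<^esub> y = x \<oplus>\<^bsub>A\<^esub> y"
  "lact (regular A) a x = a \<otimes>\<^bsub>A\<^esub> x" "ract (regular A) x a = x \<otimes>\<^bsub>A\<^esub> a"
  by (simp_all add: regular_def)

lemma (in complex_algebra) scalar_closed: "c \<odot>\<^bsub>A\<^esub> \<one>\<^bsub>A\<^esub> \<in> carrier A"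
  by (simp add: smult_closed ring_of_type_algebra_def)

text \<open>Both products equal \<open>c \<odot> x\<close>, since a complex scalar can be pulled out
  of either factor.\<close>

lemma (in complex_algebra) scalar_central:
  assumes "x \<in> carrier A"
  shows "(c \<odot>\<^bsub>A\<^esub> \<one>\<^bsub>A\<^esub>) \<otimes>\<^bsub>A\<^esub> x = x \<otimes>\<^bsub>A\<^esub> (c \<odot>\<^bsub>A\<^esub> \<one>\<^bsub>A\<^esub>)"
  using assms by (simp add: smult_mult_left smult_mult_right)

lemma regular_bimodule:
  assumes "complex_algebra A"
  shows "bimodule A (regular A)"
proof -
  interpret A: ring A
    using assms by (simp add: complex_algebra_def)
  have central: "(c \<odot>\<^bsub>A\<^esub> \<one>\<^bsub>A\<^esub>) \<otimes>\<^bsub>A\<^esub> x = x \<otimes>\<^bsub>A\<^esub> (c \<odot>\<^bsub>A\<^esub> \<one>\<^bsub>A\<^esub>)" if "x \<in> carrier A" for c x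
    using complex_algebra.scalar_central[OF assms that] .
  have "abelian_group (regular A)"
    by (rule abelian_groupI) (auto simp: A.a_assoc intro: A.a_comm A.l_neg)
  then show ?thesis
    by (intro bimodule.intro bimodule_axioms.intro assms)
      (simp_all add: A.l_distr A.r_distr A.m_assoc central)
qed

lemma relabel_simps [simp]:
  "carrier (relabel c s E) = c ` carrier E" "\<zero>\<^bsub>relabel c s E\<^esub> = c \<zero>\<^bsub>E\<^esub>"
  "x \<oplus>\<^bsub>relabel c s E\<^esub> y = c (s x \<oplus>\<^bsub>E\<^esub> s y)"
  "lact (relabel c s E) a x = c (lact E a (s x))" "ract (relabel c s E) x a = c (ract E (s x) a)"
  by (simp_all add: relabel_def)

lemma relabel_bimodule:
  assumes "bimodule A E" and [simp]: "\<And>x. s (c x) = x"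
  shows "bimodule A (relabel c s E)"
proof -
  interpret bimodule A E by fact
  have "abelian_group (relabel c s E)"
  proof (rule abelian_groupI)
    fix x assume "x \<in> carrier (relabel c s E)"
    then obtain e where e: "e \<in> carrier E" "x = c e" by auto
    then have "\<ominus>\<^bsub>E\<^esub> e \<oplus>\<^bsub>E\<^esub> e = \<zero>\<^bsub>E\<^esub>" by (intro E.l_neg)
    with e show "\<exists>y\<in>carrier (relabel c s E). y \<oplus>\<^bsub>relabel c s E\<^esub> x = \<zero>\<^bsub>relabel c s E\<^esub>"
      by (intro bexI[of _ "c (\<ominus>\<^bsub>E\<^esub> e)"]) simp_all
  qed (auto simp: E.a_ac)
  then show ?thesis
    by (intro bimodule.intro bimodule_axioms.intro A.complex_algebra_axioms)
      (auto simp: lact_closed ract_closed lact_add add_lact lact_mult lact_one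
        ract_add add_ract ract_mult ract_one lact_ract central)
qed

lemma dual_simps:
  "carrier (dual A E) = {\<alpha> \<in> extensional (carrier E). left_hom A E (regular A) \<alpha>}"
  "\<zero>\<^bsub>dual A E\<^esub> = (\<lambda>e\<in>carrier E. \<zero>\<^bsub>A\<^esub>)"
  "\<alpha> \<oplus>\<^bsub>dual A E\<^esub> \<beta> = (\<lambda>e\<in>carrier E. \<alpha> e \<oplus>\<^bsub>A\<^esub> \<beta> e)"
  "lact (dual A E) a \<alpha> = (\<lambda>e\<in>carrier E. \<alpha> (ract E e a))"
  "ract (dual A E) \<alpha> a = (\<lambda>e\<in>carrier E. \<alpha> e \<otimes>\<^bsub>A\<^esub> a)"
  by (simp_all add: dual_def)

section \<open>Duals of bimodules and dual bases\<close>

context bimodule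
begin

lemma dual_closed: "\<lbrakk>\<alpha> \<in> carrier (dual A E); e \<in> carrier E\<rbrakk> \<Longrightarrow> \<alpha> e \<in> carrier A"
  and dual_add: "\<lbrakk>\<alpha> \<in> carrier (dual A E); e \<in> carrier E; f \<in> carrier E\<rbrakk> \<Longrightarrow>
    \<alpha> (e \<oplus>\<^bsub>E\<^esub> f) = \<alpha> e \<oplus>\<^bsub>A\<^esub> \<alpha> f"
  and dual_lact: "\<lbrakk>\<alpha> \<in> carrier (dual A E); a \<in> carrier A; e \<in> carrier E\<rbrakk> \<Longrightarrow>
    \<alpha> (lact E a e) = a \<otimes>\<^bsub>A\<^esub> \<alpha> e"
  by (auto simp: dual_simps left_hom_def)

lemma dual_zero:
  assumes "\<alpha> \<in> carrier (dual A E)" shows "\<alpha> \<zero>\<^bsub>E\<^esub> = \<zero>\<^bsub>A\<^esub>"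
  using dual_add[OF assms, of "\<zero>\<^bsub>E\<^esub>" "\<zero>\<^bsub>E\<^esub>"] dual_closed[OF assms, of "\<zero>\<^bsub>E\<^esub>"] by simp

lemma dual_memI:
  assumes "\<And>e. e \<in> carrier E \<Longrightarrow> f e \<in> carrier A"
    and "\<And>e e'. \<lbrakk>e \<in> carrier E; e' \<in> carrier E\<rbrakk> \<Longrightarrow> f (e \<oplus>\<^bsub>E\<^esub> e') = f e \<oplus>\<^bsub>A\<^esub> f e'"
    and "\<And>a e. \<lbrakk>a \<in> carrier A; e \<in> carrier E\<rbrakk> \<Longrightarrow> f (lact E a e) = a \<otimes>\<^bsub>A\<^esub> f e"
  shows "(\<lambda>e\<in>carrier E. f e) \<in> carrier (dual A E)"
  using assms by (auto simp: dual_simps left_hom_def lact_closed)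

lemma dual_abelian: "abelian_group (dual A E)"
proof (rule abelian_groupI)
  fix \<alpha> \<beta> assume *: "\<alpha> \<in> carrier (dual A E)" "\<beta> \<in> carrier (dual A E)"
  show "\<alpha> \<oplus>\<^bsub>dual A E\<^esub> \<beta> \<in> carrier (dual A E)"
    unfolding dual_simps(3) by (rule dual_memI)
      (auto simp: * dual_closed dual_add dual_lact A.a_ac A.r_distr)
next
  show z: "\<zero>\<^bsub>dual A E\<^esub> \<in> carrier (dual A E)"
    unfolding dual_simps(2) by (rule dual_memI) auto
  fix \<alpha> assume *: "\<alpha> \<in> carrier (dual A E)"
  show "\<zero>\<^bsub>dual A E\<^esub> \<oplus>\<^bsub>dual A E\<^esub> \<alpha> = \<alpha>"
    using * by (auto simp: dual_simps(2,3) dual_closed intro!: extensionalityI[of _ "carrier E" \<alpha>])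
      (auto simp: dual_simps)
  have "(\<lambda>e\<in>carrier E. \<ominus>\<^bsub>A\<^esub> \<alpha> e) \<in> carrier (dual A E)"
    by (rule dual_memI) (auto simp: * dual_closed dual_add dual_lact A.minus_add A.r_minus A.a_comm)
  moreover have "(\<lambda>e\<in>carrier E. \<ominus>\<^bsub>A\<^esub> \<alpha> e) \<oplus>\<^bsub>dual A E\<^esub> \<alpha> = \<zero>\<^bsub>dual A E\<^esub>"
    by (auto simp: dual_simps(2,3) * dual_closed A.l_neg intro!: restrict_ext)
  ultimately show "\<exists>\<beta>\<in>carrier (dual A E). \<beta> \<oplus>\<^bsub>dual A E\<^esub> \<alpha> = \<zero>\<^bsub>dual A E\<^esub>"
    by blast
qed (auto simp: dual_simps(3) dual_closed A.a_ac intro!: restrict_ext)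

text \<open>The left action precomposes with the right action on \<open>E\<close>, and two reversals
  of order make it a left action; the right action multiplies values on the right, which preserves
  left linearity. The two commute because one acts on arguments and the other on values.\<close>

lemma dual_bimodule: "bimodule A (dual A E)"
proof (intro bimodule.intro bimodule_axioms.intro A.complex_algebra_axioms dual_abelian)
  fix a \<alpha> assume *: "a \<in> carrier A" "\<alpha> \<in> carrier (dual A E)"
  show l: "lact (dual A E) a \<alpha> \<in> carrier (dual A E)"
    unfolding dual_simps(4) by (rule dual_memI)
      (auto simp: * dual_closed dual_add dual_lact ract_add lact_ract ract_closed)
  show r: "ract (dual A E) \<alpha> a \<in> carrier (dual A E)"
    unfolding dual_simps(5) by (rule dual_memI)
      (auto simp: * dual_closed dual_add dual_lact A.l_distr A.m_assoc)
  fix b assume b: "b \<in> carrier A"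
  show "lact (dual A E) (a \<oplus>\<^bsub>A\<^esub> b) \<alpha> = lact (dual A E) a \<alpha> \<oplus>\<^bsub>dual A E\<^esub> lact (dual A E) b \<alpha>"
    using * b by (auto simp: dual_simps(3,4) add_ract dual_add ract_closed intro!: restrict_ext)
  show "lact (dual A E) (a \<otimes>\<^bsub>A\<^esub> b) \<alpha> = lact (dual A E) a (lact (dual A E) b \<alpha>)"
    using * b by (auto simp: dual_simps(4) ract_mult ract_closed intro!: restrict_ext)
  show "ract (dual A E) \<alpha> (a \<oplus>\<^bsub>A\<^esub> b) = ract (dual A E) \<alpha> a \<oplus>\<^bsub>dual A E\<^esub> ract (dual A E) \<alpha> b"
    using * b by (auto simp: dual_simps(3,5) A.r_distr dual_closed intro!: restrict_ext)
  show "ract (dual A E) \<alpha> (a \<otimes>\<^bsub>A\<^esub> b) = ract (dual A E) (ract (dual A E) \<alpha> a) b"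
    using * b by (auto simp: dual_simps(5) A.m_assoc dual_closed intro!: restrict_ext)
  show "ract (dual A E) (lact (dual A E) a \<alpha>) b = lact (dual A E) a (ract (dual A E) \<alpha> b)"
    using * b by (auto simp: dual_simps(4,5) ract_closed intro!: restrict_ext)
  fix \<beta> assume \<beta>: "\<beta> \<in> carrier (dual A E)"
  show "lact (dual A E) a (\<alpha> \<oplus>\<^bsub>dual A E\<^esub> \<beta>) = lact (dual A E) a \<alpha> \<oplus>\<^bsub>dual A E\<^esub> lact (dual A E) a \<beta>"
    using * by (auto simp: dual_simps(3,4) ract_closed intro!: restrict_ext)
  show "ract (dual A E) (\<alpha> \<oplus>\<^bsub>dual A E\<^esub> \<beta>) a = ract (dual A E) \<alpha> a \<oplus>\<^bsub>dual A E\<^esub> ract (dual A E) \<beta> a"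
    using * \<beta> by (auto simp: dual_simps(3,5) A.l_distr dual_closed intro!: restrict_ext)
next
  fix \<alpha> c assume *: "\<alpha> \<in> carrier (dual A E)"
  then have ext: "\<alpha> \<in> extensional (carrier E)" by (simp add: dual_simps)
  show "lact (dual A E) \<one>\<^bsub>A\<^esub> \<alpha> = \<alpha>"
    by (rule extensionalityI[OF _ ext]) (auto simp: dual_simps(4) ract_one)
  show "ract (dual A E) \<alpha> \<one>\<^bsub>A\<^esub> = \<alpha>"
    by (rule extensionalityI[OF _ ext]) (auto simp: dual_simps(5) dual_closed[OF *])
  \<comment> \<open>For a complex scalar c, viewed in \<open>A\<close>: \<alpha>(e.c) =
    \<alpha>(c.e) = c \<alpha>(e) = \<alpha>(e) c.\<close>
  show "lact (dual A E) (c \<odot>\<^bsub>A\<^esub> \<one>\<^bsub>A\<^esub>) \<alpha> = ract (dual A E) \<alpha> (c \<odot>\<^bsub>A\<^esub> \<one>\<^bsub>A\<^esub>)"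
    using * by (auto simp: dual_simps(4,5) central[symmetric] dual_lact A.scalar_closed
      A.scalar_central dual_closed intro!: restrict_ext)
qed

text \<open>The vectors are the images under \<open>\<pi>\<close> of the standard basis of the free
  module, and the functionals are the coordinates of \<open>\<iota>\<close>; expanding
  \<open>\<pi> (\<iota> f)\<close> in coordinates gives the dual basis formula.\<close>

lemma dual_basis_exists:
  assumes "fgp_left A E"
  shows "\<exists>es \<epsilon>s. dual_basis A E es \<epsilon>s"
proof -
  obtain n \<iota> \<pi> where \<iota>: "left_hom A E (free_module A n) \<iota>" and \<pi>: "left_hom A (free_module A n) E \<pi>"
    and \<pi>\<iota>: "\<And>e. e \<in> carrier E \<Longrightarrow> \<pi> (\<iota> e) = e"
    using assms unfolding fgp_left_def by blast
  let ?F = "free_module A n"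
  define \<delta> where "\<delta> i = (\<lambda>j\<in>{..<n}. if j = i then \<one>\<^bsub>A\<^esub> else \<zero>\<^bsub>A\<^esub>)" for i
  define \<epsilon> where "\<epsilon> i = (\<lambda>e\<in>carrier E. \<iota> e i)" for i
  have F: "carrier ?F = {..<n} \<rightarrow>\<^sub>E carrier A" by (simp add: free_module_def)
  have \<delta>: "\<delta> i \<in> carrier ?F" for i by (auto simp: F \<delta>_def)
  have \<pi>_closed: "\<pi> x \<in> carrier E" if "x \<in> carrier ?F" for x
    using \<pi> that by (auto simp: left_hom_def)
  have \<pi>_add: "\<pi> (x \<oplus>\<^bsub>?F\<^esub> y) = \<pi> x \<oplus>\<^bsub>E\<^esub> \<pi> y" if "x \<in> carrier ?F" "y \<in> carrier ?F" for x y
    using \<pi> that by (auto simp: left_hom_def)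
  have \<pi>_lact: "\<pi> (lact ?F a x) = lact E a (\<pi> x)" if "a \<in> carrier A" "x \<in> carrier ?F" for a x
    using \<pi> that by (auto simp: left_hom_def)
  have \<iota>_closed: "\<iota> e \<in> {..<n} \<rightarrow>\<^sub>E carrier A" if "e \<in> carrier E" for e
    using \<iota> that by (auto simp: left_hom_def F)
  have \<epsilon>: "\<epsilon> i \<in> carrier (dual A E)" if "i < n" for i
    unfolding \<epsilon>_def
  proof (rule dual_memI)
    fix e e' a assume "e \<in> carrier E"
    then show "\<iota> e i \<in> carrier A" using \<iota>_closed that by blast
    show "\<iota> (e \<oplus>\<^bsub>E\<^esub> e') i = \<iota> e i \<oplus>\<^bsub>A\<^esub> \<iota> e' i" if "e' \<in> carrier E"
      using \<iota> \<open>e \<in> carrier E\<close> that \<open>i < n\<close> by (auto simp: left_hom_def free_module_def)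
    show "\<iota> (lact E a e) i = a \<otimes>\<^bsub>A\<^esub> \<iota> e i" if "a \<in> carrier A"
      using \<iota> \<open>e \<in> carrier E\<close> that \<open>i < n\<close> by (auto simp: left_hom_def free_module_def)
  qed
  \<comment> \<open>Coordinates are added one at a time: the sum over the first \<open>k\<close>
    indices is \<open>\<pi>\<close> of the vector truncated after its first \<open>k\<close>
    entries.\<close>
  have expand: "\<pi> (\<lambda>i\<in>{..<n}. if i < k then x i else \<zero>\<^bsub>A\<^esub>) = (\<Oplus>\<^bsub>E\<^esub>i\<in>{..<k}. lact E (x i) (\<pi> (\<delta> i)))"
    if "k \<le> n" and x: "x \<in> {..<n} \<rightarrow>\<^sub>E carrier A" for k x
    using \<open>k \<le> n\<close>
  proof (induction k)
    case 0
    let ?z = "\<lambda>i\<in>{..<n}. \<zero>\<^bsub>A\<^esub>"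
    have z: "?z \<in> carrier ?F" by (auto simp: F)
    \<comment> \<open>\<open>left_hom\<close> has no clause for zero; the image of the zero vector
      is zero because it equals its own double.\<close>
    have "?z \<oplus>\<^bsub>?F\<^esub> ?z = ?z" by (auto simp: free_module_def)
    then have "\<pi> ?z \<oplus>\<^bsub>E\<^esub> \<pi> ?z = \<pi> ?z" using \<pi>_add[OF z z] by simp
    then have z0: "\<pi> ?z = \<zero>\<^bsub>E\<^esub>" using \<pi>_closed[OF z] by simp
    have eq: "(\<lambda>i\<in>{..<n}. if i < 0 then x i else \<zero>\<^bsub>A\<^esub>) = ?z"
      by (simp only: not_less0 if_False)
    show ?case unfolding eq z0 by simp
  next
    case (Suc k)
    let ?t = "\<lambda>i\<in>{..<n}. if i < k then x i else \<zero>\<^bsub>A\<^esub>"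
    have xi: "x i \<in> carrier A" if "i < n" for i using x that by auto
    have k: "k < n" "x k \<in> carrier A" using Suc.prems xi by simp_all
    have t: "?t \<in> carrier ?F" unfolding F using xi by (intro restrict_PiE_iff[THEN iffD2]) simp
    have l: "lact ?F (x k) (\<delta> k) \<in> carrier ?F"
      unfolding F using k by (simp add: free_module_def \<delta>_def restrict_PiE_iff)
    have "(\<lambda>i\<in>{..<n}. if i < Suc k then x i else \<zero>\<^bsub>A\<^esub>) = ?t \<oplus>\<^bsub>?F\<^esub> lact ?F (x k) (\<delta> k)"
      using xi k by (simp add: free_module_def \<delta>_def restrict_def fun_eq_iff less_Suc_eq)
    then have "\<pi> (\<lambda>i\<in>{..<n}. if i < Suc k then x i else \<zero>\<^bsub>A\<^esub>) = \<pi> ?t \<oplus>\<^bsub>E\<^esub> lact E (x k) (\<pi> (\<delta> k))"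
      by (simp only: \<pi>_add[OF t l] \<pi>_lact[OF k(2) \<delta>])
    also have "\<pi> ?t = (\<Oplus>\<^bsub>E\<^esub>i\<in>{..<k}. lact E (x i) (\<pi> (\<delta> i)))"
      by (rule Suc.IH) (use k in simp)
    also have "\<dots> \<oplus>\<^bsub>E\<^esub> lact E (x k) (\<pi> (\<delta> k)) = (\<Oplus>\<^bsub>E\<^esub>i\<in>{..<Suc k}. lact E (x i) (\<pi> (\<delta> i)))"
    proof -
      have c: "lact E (x i) (\<pi> (\<delta> i)) \<in> carrier E" if "i \<le> k" for i
        using that k xi by (intro lact_closed \<pi>_closed \<delta>) simp
      then have "(\<lambda>i. lact E (x i) (\<pi> (\<delta> i))) \<in> {..<k} \<rightarrow> carrier E" by simp
      from E.finsum_insert[OF finite_lessThan _ this c[OF order_refl]]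
      show ?thesis using c[OF order_refl] \<open>_ \<in> {..<k} \<rightarrow> carrier E\<close>
        by (simp add: lessThan_Suc E.a_comm)
    qed
    finally show ?case .
  qed
  have "dual_basis A E (map (\<lambda>i. \<pi> (\<delta> i)) [0..<n]) (map \<epsilon> [0..<n])"
    unfolding dual_basis_def
  proof (intro conjI ballI)
    fix f assume f: "f \<in> carrier E"
    have "(\<lambda>i\<in>{..<n}. if i < n then \<iota> f i else \<zero>\<^bsub>A\<^esub>) = \<iota> f"
      using \<iota>_closed[OF f] by (auto simp: fun_eq_iff PiE_def extensional_def)
    then have "f = (\<Oplus>\<^bsub>E\<^esub>i\<in>{..<n}. lact E (\<iota> f i) (\<pi> (\<delta> i)))"
      using expand[OF order_refl \<iota>_closed[OF f]] \<pi>\<iota>[OF f] by simp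
    also have "\<dots> = (\<Oplus>\<^bsub>E\<^esub>i\<in>{..<n}. lact E ((map \<epsilon> [0..<n] ! i) f) (map (\<lambda>i. \<pi> (\<delta> i)) [0..<n] ! i))"
    proof (rule E.finsum_cong'[OF refl])
      fix i assume "i \<in> {..<n}"
      then show "lact E (\<iota> f i) (\<pi> (\<delta> i)) = lact E ((map \<epsilon> [0..<n] ! i) f) (map (\<lambda>i. \<pi> (\<delta> i)) [0..<n] ! i)"
        using f by (simp add: \<epsilon>_def)
    next
      have "lact E (\<epsilon> i f) (\<pi> (\<delta> i)) \<in> carrier E" if "i < n" for i
        by (intro lact_closed \<pi>_closed \<delta> dual_closed[OF \<epsilon>] that f)
      then show "(\<lambda>i. lact E ((map \<epsilon> [0..<n] ! i) f) (map (\<lambda>i. \<pi> (\<delta> i)) [0..<n] ! i)) \<in> {..<n} \<rightarrow> carrier E"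
        by simp
    qed
    finally show "f = (\<Oplus>\<^bsub>E\<^esub>i\<in>{..<length (map (\<lambda>i. \<pi> (\<delta> i)) [0..<n])}.
        lact E ((map \<epsilon> [0..<n] ! i) f) (map (\<lambda>i. \<pi> (\<delta> i)) [0..<n] ! i))"
      by simp
  qed (auto simp: \<pi>_closed \<delta> \<epsilon>)
  then show ?thesis by blast
qed

lemma dual_finsum:
  assumes \<beta>: "\<beta> \<in> carrier (dual A E)" and "finite I" and "\<And>i. i \<in> I \<Longrightarrow> f i \<in> carrier E"
  shows "\<beta> (\<Oplus>\<^bsub>E\<^esub>i\<in>I. f i) = (\<Oplus>\<^bsub>A\<^esub>i\<in>I. \<beta> (f i))"
  using assms(2,3)
proof (induction I rule: finite_induct)
  case (insert j I)
  then show ?case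
    by (simp add: \<beta> dual_add dual_closed Pi_def)
qed (simp add: dual_zero[OF \<beta>])

end

section \<open>The pairings of a weak left line module\<close>

lemma words_2: "w \<in> words [E, F] \<longleftrightarrow> (\<exists>x y. w = [x, y] \<and> x \<in> carrier E \<and> y \<in> carrier F)"
  by (auto simp: words_iff less_Suc_eq numeral_2_eq_2 length_Suc_conv)

lemma word_act_2:
  "word_lact [E, F] a [x, y] = [lact E a x, y]" "word_ract [E, F] [x, y] a = [x, ract F y a]"
  by (simp_all add: word_lact_def word_ract_def)

lemma balanced_map_2I:
  assumes "\<And>x y. \<lbrakk>x \<in> carrier E; y \<in> carrier F\<rbrakk> \<Longrightarrow> \<phi> [x, y] \<in> carrier G"
    and "\<And>x x' y. \<lbrakk>x \<in> carrier E; x' \<in> carrier E; y \<in> carrier F\<rbrakk> \<Longrightarrow>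
      \<phi> [x \<oplus>\<^bsub>E\<^esub> x', y] = \<phi> [x, y] \<oplus>\<^bsub>G\<^esub> \<phi> [x', y]"
    and "\<And>x y y'. \<lbrakk>x \<in> carrier E; y \<in> carrier F; y' \<in> carrier F\<rbrakk> \<Longrightarrow>
      \<phi> [x, y \<oplus>\<^bsub>F\<^esub> y'] = \<phi> [x, y] \<oplus>\<^bsub>G\<^esub> \<phi> [x, y']"
    and "\<And>a x y. \<lbrakk>a \<in> carrier A; x \<in> carrier E; y \<in> carrier F\<rbrakk> \<Longrightarrow>
      \<phi> [ract E x a, y] = \<phi> [x, lact F a y]"
  shows "balanced_map A [E, F] G \<phi>"
  unfolding balanced_map_def using assms
  by (auto simp: words_2 less_Suc_eq)

context bimodule_list
begin

lemma balanced_map_cong: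
  assumes bal: "balanced_map A Es G \<phi>" and eq: "\<And>w. w \<in> words Es \<Longrightarrow> \<phi> w = \<psi> w"
  shows "balanced_map A Es G \<psi>"
proof -
  have add: "w[i := x \<oplus>\<^bsub>Es ! i\<^esub> y] \<in> words Es"
    if "w \<in> words Es" "i < length Es" "x \<in> carrier (Es ! i)" "y \<in> carrier (Es ! i)" for w i x y
    using that nth_bimodule[OF that(2)]
    by (intro words_update that abelian_monoid.a_closed[OF abelian_group.axioms(1)[OF bimodule.axioms(2)]])
  have r: "w[i := ract (Es ! i) (w ! i) a] \<in> words Es"
    if "w \<in> words Es" "i < length Es" "a \<in> carrier A" for w i a
    using that by (intro words_update bimodule.ract_closed[OF nth_bimodule[OF that(2)]]) (auto simp: words_iff)
  have l: "w[i := lact (Es ! i) a (w ! i)] \<in> words Es"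
    if "w \<in> words Es" "i < length Es" "a \<in> carrier A" for w i a
    using that by (intro words_update bimodule.lact_closed[OF nth_bimodule[OF that(2)]]) (auto simp: words_iff)
  show ?thesis
    using bal unfolding balanced_map_def
    by (simp add: eq[symmetric] add r l words_update)
qed

lemma gen_add:
  "\<lbrakk>w \<in> words Es; i < length Es; x \<in> carrier (Es ! i); y \<in> carrier (Es ! i)\<rbrakk> \<Longrightarrow>
    gen (w[i := x \<oplus>\<^bsub>Es ! i\<^esub> y]) = gen (w[i := x]) \<oplus>\<^bsub>tensor A Es\<^esub> gen (w[i := y])"
  using gen_balanced unfolding balanced_map_def by blast

lemma gen_balance:
  "\<lbrakk>w \<in> words Es; Suc i < length Es; a \<in> carrier A\<rbrakk> \<Longrightarrow>
    gen (w[i := ract (Es ! i) (w ! i) a]) = gen (w[Suc i := lact (Es ! Suc i) a (w ! Suc i)])"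
  using gen_balanced unfolding balanced_map_def by blast

end

section \<open>Letters and pairings of either sign\<close>

locale weak_line =
  fixes A :: "(complex, 'a) module" and L :: "('a, 'm) bimodule"
  assumes complex_algebra: "complex_algebra A"
    and weak_line: "weak_left_line_module A L"
begin

text \<open>The sign puts \<open>L\<close> and its dual on the same footing: \<open>pair s\<close>
  takes a letter of sign \<open>s\<close> on the left and one of the opposite sign on the right, so
  later arguments cover both kinds of cancellation at once.\<close>

definition B :: "bool \<Rightarrow> ('a, ('a, 'm) letter) bimodule" where
  "B s = (if s then L_bim L else D_bim A L)"

definition pair :: "bool \<Rightarrow> ('a, 'm) letter \<Rightarrow> ('a, 'm) letter \<Rightarrow> 'a" where
  "pair s x y = (if s then ev x y else coev_inv A L x y)"

end

sublocale weak_line \<subseteq> R: ring A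
  using complex_algebra by (simp add: complex_algebra_def)

sublocale weak_line \<subseteq> L: bimodule A L
  using weak_line by (simp add: weak_left_line_module_def)

sublocale weak_line \<subseteq> D: bimodule A "dual A L"
  by (rule L.dual_bimodule)

context weak_line
begin

lemma B_bimodule: "bimodule A (B s)"
  by (simp add: B_def L_bim_def D_bim_def relabel_bimodule L.bimodule_axioms D.bimodule_axioms)

lemma A_bim_bimodule: "bimodule A (A_bim A)"
  by (simp add: A_bim_def relabel_bimodule regular_bimodule complex_algebra)

lemmas B_lact_closed = bimodule.lact_closed[OF B_bimodule]
lemmas B_ract_closed = bimodule.ract_closed[OF B_bimodule]
lemmas B_lact_add = bimodule.lact_add[OF B_bimodule]
lemmas B_add_lact = bimodule.add_lact[OF B_bimodule]
lemmas B_lact_mult = bimodule.lact_mult[OF B_bimodule]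
lemmas B_lact_one = bimodule.lact_one[OF B_bimodule]
lemmas B_ract_add = bimodule.ract_add[OF B_bimodule]
lemmas B_add_ract = bimodule.add_ract[OF B_bimodule]
lemmas B_ract_mult = bimodule.ract_mult[OF B_bimodule]
lemmas B_ract_one = bimodule.ract_one[OF B_bimodule]
lemmas B_lact_ract = bimodule.lact_ract[OF B_bimodule]
lemmas B_central = bimodule.central[OF B_bimodule]

lemma B_add_closed: "\<lbrakk>x \<in> carrier (B s); y \<in> carrier (B s)\<rbrakk> \<Longrightarrow> x \<oplus>\<^bsub>B s\<^esub> y \<in> carrier (B s)"
  by (rule abelian_monoid.a_closed[OF abelian_group.axioms(1)[OF bimodule.axioms(2)[OF B_bimodule]]])

lemma carrier_B:
  "x \<in> carrier (B True) \<longleftrightarrow> (\<exists>e\<in>carrier L. x = Vec e)"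
  "x \<in> carrier (B False) \<longleftrightarrow> (\<exists>\<alpha>\<in>carrier (dual A L). x = Cov \<alpha>)"
  by (auto simp: B_def L_bim_def D_bim_def)

lemma B_simps:
  "lact (B True) a (Vec e) = Vec (lact L a e)" "ract (B True) (Vec e) a = Vec (ract L e a)"
  "Vec e \<oplus>\<^bsub>B True\<^esub> Vec f = Vec (e \<oplus>\<^bsub>L\<^esub> f)"
  "lact (B False) a (Cov \<alpha>) = Cov (lact (dual A L) a \<alpha>)" "ract (B False) (Cov \<alpha>) a = Cov (ract (dual A L) \<alpha> a)"
  "Cov \<alpha> \<oplus>\<^bsub>B False\<^esub> Cov \<beta> = Cov (\<alpha> \<oplus>\<^bsub>dual A L\<^esub> \<beta>)"
  by (simp_all add: B_def L_bim_def D_bim_def)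

lemma DL_list: "bimodule_list A [B False, B True]"
  by (rule bimodule_list.intro) (auto simp: B_bimodule)

abbreviation "DL \<equiv> tensor A [B False, B True]"
abbreviation "dl x y \<equiv> tensor_class A [B False, B True] (frag_of [x, y])"

lemma dl_closed: "\<lbrakk>x \<in> carrier (B False); y \<in> carrier (B True)\<rbrakk> \<Longrightarrow> dl x y \<in> carrier DL"
  using bimodule_list.gen_closed[OF DL_list] by (simp add: words_2)

lemma dl_add_left:
  "\<lbrakk>x \<in> carrier (B False); x' \<in> carrier (B False); y \<in> carrier (B True)\<rbrakk> \<Longrightarrow>
    dl (x \<oplus>\<^bsub>B False\<^esub> x') y = dl x y \<oplus>\<^bsub>DL\<^esub> dl x' y"
  using bimodule_list.gen_add[OF DL_list, of "[x, y]" 0 x x'] by (simp add: words_2)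

lemma dl_add_right:
  "\<lbrakk>x \<in> carrier (B False); y \<in> carrier (B True); y' \<in> carrier (B True)\<rbrakk> \<Longrightarrow>
    dl x (y \<oplus>\<^bsub>B True\<^esub> y') = dl x y \<oplus>\<^bsub>DL\<^esub> dl x y'"
  using bimodule_list.gen_add[OF DL_list, of "[x, y]" 1 y y'] by (simp add: words_2)

lemma dl_balance:
  "\<lbrakk>a \<in> carrier A; x \<in> carrier (B False); y \<in> carrier (B True)\<rbrakk> \<Longrightarrow>
    dl (ract (B False) x a) y = dl x (lact (B True) a y)"
  using bimodule_list.gen_balance[OF DL_list, of "[x, y]" 0 a] by (simp add: words_2)

text \<open>Acting on the first letter respects the relation that moves a scalar between the two
  letters, because left and right actions on a bimodule commute.\<close>

lemma lact_DL:
  assumes a: "a \<in> carrier A" and z: "Poly_Mapping.keys z \<subseteq> words [B False, B True]"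
  shows "lact DL a (tensor_class A [B False, B True] z) =
    tensor_class A [B False, B True] (frag_extend (\<lambda>w. frag_of (word_lact [B False, B True] a w)) z)"
proof -
  show ?thesis
    \<comment> \<open>Unfolding exposes the union over representatives inside \<open>lact\<close>;
      folding \<open>tensor\<close> back leaves the form to which \<open>tensor_lift\<close>
      applies.\<close>
    unfolding tensor_def bimodule.simps
    unfolding tensor_def[symmetric]
  proof (rule tensor_lift[OF DL_list DL_list _ _ z])
    show "balanced_map A [B False, B True] DL
        (\<lambda>w. tensor_class A [B False, B True] (frag_of (word_lact [B False, B True] a w)))"
      by (rule balanced_map_2I) (simp_all add: word_act_2 a dl_closed dl_add_left dl_add_right dl_balance
          B_lact_closed B_lact_add B_lact_ract[symmetric])
  qed (auto simp: words_2 word_act_2 a B_lact_closed)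
qed

lemma ract_DL:
  assumes a: "a \<in> carrier A" and z: "Poly_Mapping.keys z \<subseteq> words [B False, B True]"
  shows "ract DL (tensor_class A [B False, B True] z) a =
    tensor_class A [B False, B True] (frag_extend (\<lambda>w. frag_of (word_ract [B False, B True] w a)) z)"
proof -
  show ?thesis
    unfolding tensor_def bimodule.simps
    unfolding tensor_def[symmetric]
  proof (rule tensor_lift[OF DL_list DL_list _ _ z])
    show "balanced_map A [B False, B True] DL
        (\<lambda>w. tensor_class A [B False, B True] (frag_of (word_ract [B False, B True] w a)))"
      by (rule balanced_map_2I) (simp_all add: word_act_2 a dl_closed dl_add_left dl_add_right dl_balance
          B_ract_closed B_ract_add B_lact_ract)
  qed (auto simp: words_2 word_act_2 a B_ract_closed)
qed

lemma lact_dl: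
  "\<lbrakk>a \<in> carrier A; x \<in> carrier (B False); y \<in> carrier (B True)\<rbrakk> \<Longrightarrow>
    lact DL a (dl x y) = dl (lact (B False) a x) y"
  using lact_DL[of a "frag_of [x, y]"] by (simp add: words_2 word_act_2)

lemma ract_dl:
  "\<lbrakk>a \<in> carrier A; x \<in> carrier (B False); y \<in> carrier (B True)\<rbrakk> \<Longrightarrow>
    ract DL (dl x y) a = dl x (ract (B True) y a)"
  using ract_DL[of a "frag_of [x, y]"] by (simp add: words_2 word_act_2)

lemma coev_iso: "bimodule_iso A (regular A) DL (coev A L)"
  using weak_line by (simp add: weak_left_line_module_def B_def)

lemmas coev_hom = coev_iso[unfolded bimodule_iso_def left_hom_def regular_simps]
lemmas coev_add = coev_hom[THEN conjunct1, THEN conjunct2, THEN conjunct1, rule_format]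
lemmas coev_lact = coev_hom[THEN conjunct1, THEN conjunct2, THEN conjunct2, rule_format]
lemmas coev_ract = coev_hom[THEN conjunct2, THEN conjunct1, rule_format]
lemmas coev_bij = coev_hom[THEN conjunct2, THEN conjunct2]

text \<open>Surjectivity of coev enters here: the class of \<open>[x, y]\<close> has a preimage, so
  \<open>inv_into\<close> returns a true one.\<close>

lemma
  assumes "x \<in> carrier (B False)" "y \<in> carrier (B True)"
  shows pair_False_closed: "pair False x y \<in> carrier A"
    and coev_pair: "coev A L (pair False x y) = dl x y"
proof -
  have "pair False x y = inv_into (carrier A) (coev A L) (dl x y)"
    by (simp add: pair_def coev_inv_def B_def)
  moreover have "dl x y \<in> coev A L ` carrier A"
    using dl_closed[OF assms] coev_bij by (simp add: bij_betw_def)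
  ultimately show "pair False x y \<in> carrier A" "coev A L (pair False x y) = dl x y"
    by (simp_all add: inv_into_into f_inv_into_f)
qed

text \<open>Injectivity of coev: an identity for the inverse pairing is proved by applying coev to
  both sides, where it becomes a rule for \<open>dl\<close>. Each identity for
  \<open>pair False\<close> below is obtained in this way.\<close>

lemma pair_False_eqI:
  assumes "x \<in> carrier (B False)" "y \<in> carrier (B True)" "a \<in> carrier A" "coev A L a = dl x y"
  shows "pair False x y = a"
  using assms coev_pair[OF assms(1,2)] pair_False_closed[OF assms(1,2)] coev_bij
  by (metis bij_betw_def inj_onD)

section \<open>The pairings as balanced bimodule maps\<close>

lemma pair_closed:
  assumes "x \<in> carrier (B s)" "y \<in> carrier (B (\<not> s))"
  shows "pair s x y \<in> carrier A"
proof (cases s)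
  case True
  then show ?thesis
    using assms by (auto simp: carrier_B pair_def ev_def L.dual_closed)
qed (use assms pair_False_closed in simp)

lemma pair_add_left:
  assumes "x \<in> carrier (B s)" "x' \<in> carrier (B s)" "y \<in> carrier (B (\<not> s))"
  shows "pair s (x \<oplus>\<^bsub>B s\<^esub> x') y = pair s x y \<oplus>\<^bsub>A\<^esub> pair s x' y"
proof (cases s)
  case True
  then show ?thesis
    using assms by (auto simp: carrier_B pair_def ev_def L.dual_add B_simps)
next
  case False
  show ?thesis
    using assms False
    by (auto intro!: pair_False_eqI simp: coev_add coev_pair pair_False_closed dl_add_left B_add_closed)
qed

lemma pair_add_right:
  assumes "x \<in> carrier (B s)" "y \<in> carrier (B (\<not> s))" "y' \<in> carrier (B (\<not> s))"
  shows "pair s x (y \<oplus>\<^bsub>B (\<not> s)\<^esub> y') = pair s x y \<oplus>\<^bsub>A\<^esub> pair s x y'"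
proof (cases s)
  case True
  then show ?thesis
    using assms by (auto simp: carrier_B pair_def ev_def B_simps) (simp add: dual_simps)
next
  case False
  show ?thesis
    using assms False
    by (auto intro!: pair_False_eqI simp: coev_add coev_pair pair_False_closed dl_add_right B_add_closed)
qed

lemma pair_balance:
  assumes "a \<in> carrier A" "x \<in> carrier (B s)" "y \<in> carrier (B (\<not> s))"
  shows "pair s (ract (B s) x a) y = pair s x (lact (B (\<not> s)) a y)"
proof (cases s)
  case True
  then show ?thesis
    using assms by (auto simp: carrier_B pair_def ev_def B_simps) (simp add: dual_simps)
next
  case False
  show ?thesis
    using assms False
    by (auto intro!: pair_False_eqI simp: coev_pair pair_False_closed dl_balance B_lact_closed B_ract_closed)
qed

lemma pair_lact:
  assumes "a \<in> carrier A" "x \<in> carrier (B s)" "y \<in> carrier (B (\<not> s))"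
  shows "pair s (lact (B s) a x) y = a \<otimes>\<^bsub>A\<^esub> pair s x y"
proof (cases s)
  case True
  then show ?thesis
    using assms by (auto simp: carrier_B pair_def ev_def B_simps L.dual_lact)
next
  case False
  show ?thesis
    using assms False
    by (auto intro!: pair_False_eqI simp: coev_pair coev_lact pair_False_closed lact_dl B_lact_closed)
qed

text \<open>For ev this is the definition of the right action on the dual. For the inverse of coev
  it rests on coev respecting the right actions, which is part of being a bimodule
  isomorphism.\<close>

lemma pair_ract:
  assumes "a \<in> carrier A" "x \<in> carrier (B s)" "y \<in> carrier (B (\<not> s))"
  shows "pair s x (ract (B (\<not> s)) y a) = pair s x y \<otimes>\<^bsub>A\<^esub> a"
proof (cases s)
  case True
  then show ?thesis
    using assms by (auto simp: carrier_B pair_def ev_def B_simps) (simp add: dual_simps)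
next
  case False
  show ?thesis
    using assms False
    by (auto intro!: pair_False_eqI simp: coev_pair coev_ract pair_False_closed ract_dl B_ract_closed)
qed

text \<open>The lists hidden in the choice of \<open>coev_one\<close> are brought out, one pair of
  lists for all \<open>b\<close>. Projectivity of \<open>L\<close> ensures that the chosen lists are
  a dual basis.\<close>

lemma coev_expand:
  obtains es \<epsilon>s where "dual_basis A L es \<epsilon>s"
    and "\<forall>b\<in>carrier A. coev A L b = tensor_class A [B False, B True]
      (\<Sum>i<length es. frag_of [lact (B False) b (Cov (\<epsilon>s ! i)), Vec (es ! i)])"
proof -
  obtain es \<epsilon>s where *: "(SOME (es, \<epsilon>s). dual_basis A L es \<epsilon>s) = (es, \<epsilon>s)"
    by fastforce
  have ex: "\<exists>p. case p of (es, \<epsilon>s) \<Rightarrow> dual_basis A L es \<epsilon>s"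
    using L.dual_basis_exists weak_line by (auto simp: weak_left_line_module_def)
  have basis: "dual_basis A L es \<epsilon>s"
    using someI_ex[OF ex] unfolding * by simp
  then have mem: "es ! i \<in> carrier L" "\<epsilon>s ! i \<in> carrier (dual A L)" if "i < length es" for i
    using that unfolding dual_basis_def by (metis nth_mem subsetD)+
  let ?z = "\<Sum>i<length es. frag_of [Cov (\<epsilon>s ! i), Vec (es ! i)]"
  have z: "Poly_Mapping.keys ?z \<subseteq> words [B False, B True]"
    using sum_closed_free_Abelian_group[of "{..<length es}" "\<lambda>i. frag_of [Cov (\<epsilon>s ! i), Vec (es ! i)]"
        "words [B False, B True]"] mem
    by (simp add: words_2 carrier_B)
  have "\<forall>b\<in>carrier A. coev A L b = tensor_class A [B False, B True]
      (\<Sum>i<length es. frag_of [lact (B False) b (Cov (\<epsilon>s ! i)), Vec (es ! i)])"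
  proof
    fix b assume b: "b \<in> carrier A"
    have "coev_one A L = tensor_class A [B False, B True] ?z"
      unfolding coev_one_def * by (simp add: B_def)
    then have "coev A L b = lact DL b (tensor_class A [B False, B True] ?z)"
      by (simp add: coev_def B_def)
    then show "coev A L b = tensor_class A [B False, B True]
        (\<Sum>i<length es. frag_of [lact (B False) b (Cov (\<epsilon>s ! i)), Vec (es ! i)])"
      unfolding lact_DL[OF b z] by (simp add: frag_extend_sum word_act_2 o_def)
  qed
  with basis show thesis by (rule that)
qed

text \<open>The class of \<open>[x, y]\<close> is coev of \<open>pair False x y\<close>, hence the
  class of a sum over the dual basis, and a balanced map cannot tell these representatives apart.
  Equations in L\<degree> \<otimes> L thus become equations in a concrete group.\<close>

lemma pair_expand:
  assumes basis: "dual_basis A L es \<epsilon>s"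
    and coev: "\<forall>b\<in>carrier A. coev A L b = tensor_class A [B False, B True]
      (\<Sum>i<length es. frag_of [lact (B False) b (Cov (\<epsilon>s ! i)), Vec (es ! i)])"
    and G: "abelian_group G" and bal: "balanced_map A [B False, B True] G \<phi>"
    and xy: "x \<in> carrier (B False)" "y \<in> carrier (B True)"
  shows "\<phi> [x, y] = (\<Oplus>\<^bsub>G\<^esub>i\<in>{..<length es}. \<phi> [lact (B False) (pair False x y) (Cov (\<epsilon>s ! i)), Vec (es ! i)])"
proof -
  interpret DL: bimodule_list A "[B False, B True]" by (rule DL_list)
  have mem: "Vec (es ! i) \<in> carrier (B True)" "Cov (\<epsilon>s ! i) \<in> carrier (B False)" if "i < length es" for i
    using that basis unfolding dual_basis_def carrier_B by (metis nth_mem subsetD)+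
  have "\<phi> ` words [B False, B True] \<subseteq> carrier (add_monoid G)"
    using bal by (auto simp: balanced_map_def)
  \<comment> \<open>The additive extension of \<open>\<phi>\<close> to the free group; balancedness
    makes it constant on classes.\<close>
  then obtain h where h: "h \<in> hom DL.FG (add_monoid G)"
    and h\<phi>: "\<And>w. w \<in> words [B False, B True] \<Longrightarrow> h (frag_of w) = \<phi> w"
    using comm_group.free_Abelian_group_universal[OF abelian_group.a_comm_group[OF G]] by blast
  let ?f = "\<lambda>i. [lact (B False) (pair False x y) (Cov (\<epsilon>s ! i)), Vec (es ! i)]"
  have f: "?f i \<in> words [B False, B True]" if "i < length es" for i
    using mem[OF that] pair_False_closed[OF xy] by (simp add: words_2 B_lact_closed)
  have closed: "Poly_Mapping.keys (\<Sum>i<length es. frag_of (?f i)) \<subseteq> words [B False, B True]"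
    using sum_closed_free_Abelian_group[of "{..<length es}" "\<lambda>i. frag_of (?f i)" "words [B False, B True]"] f
    by simp
  have balh: "balanced_map A [B False, B True] G (\<lambda>w. h (frag_of w))"
    by (rule DL.balanced_map_cong[OF bal h\<phi>[symmetric]])
  have "dl x y = tensor_class A [B False, B True] (\<Sum>i<length es. frag_of (?f i))"
    using coev[rule_format, OF pair_False_closed[OF xy]] coev_pair[OF xy] by simp
  then have "h (frag_of [x, y]) = h (\<Sum>i<length es. frag_of (?f i))"
    using DL.balanced_hom_eq[OF h G balh _ closed, of "frag_of [x, y]"] xy by (simp add: words_2)
  also have "\<dots> = (\<Oplus>\<^bsub>G\<^esub>i\<in>{..<length es}. h (frag_of (?f i)))"
    using f by (intro frag_hom_sum[OF h G]) auto
  also have "\<dots> = (\<Oplus>\<^bsub>G\<^esub>i\<in>{..<length es}. \<phi> (?f i))"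
    using f bal by (intro abelian_monoid.finsum_cong'[OF abelian_group.axioms(1)[OF G]])
      (auto simp: h\<phi> balanced_map_def)
  finally show ?thesis
    using xy by (simp add: h\<phi> words_2)
qed

section \<open>The zigzag identities\<close>

lemma zigzag_vec:
  assumes e: "e \<in> carrier L" and \<alpha>: "\<alpha> \<in> carrier (dual A L)" and f: "f \<in> carrier L"
  shows "lact L (\<alpha> e) f = ract L e (pair False (Cov \<alpha>) (Vec f))"
proof -
  obtain es \<epsilon>s where basis: "dual_basis A L es \<epsilon>s"
    and coev: "\<forall>b\<in>carrier A. coev A L b = tensor_class A [B False, B True]
      (\<Sum>i<length es. frag_of [lact (B False) b (Cov (\<epsilon>s ! i)), Vec (es ! i)])"
    by (rule coev_expand)
  \<comment> \<open>This sends \<beta> \<otimes> g to \<beta>(e) g. Since b.\<beta> takes the value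
    \<beta>(e.b) at e, the coefficients of the expansion become those of the dual basis formula for
    e.b.\<close>
  let ?\<phi> = "\<lambda>w. lact L (cov (hd w) e) (vec (hd (tl w)))"
  let ?b = "pair False (Cov \<alpha>) (Vec f)"
  have b: "?b \<in> carrier A" using \<alpha> f by (intro pair_False_closed) (auto simp: carrier_B)
  have "balanced_map A [B False, B True] L ?\<phi>"
    by (rule balanced_map_2I)
      (auto simp: carrier_B B_simps L.lact_closed L.dual_closed e L.add_lact L.lact_add dual_simps(3,5) L.lact_mult)
  from pair_expand[OF basis coev L.abelian_group_axioms this, of "Cov \<alpha>" "Vec f"]
  have "lact L (\<alpha> e) f = (\<Oplus>\<^bsub>L\<^esub>i\<in>{..<length es}. lact L ((\<epsilon>s ! i) (ract L e ?b)) (es ! i))"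
    using \<alpha> f e by (simp add: carrier_B B_simps dual_simps(4))
  also have "\<dots> = ract L e ?b"
    using basis L.ract_closed[OF b e] unfolding dual_basis_def by metis
  finally show ?thesis .
qed

text \<open>Two functionals are compared by their values at \<open>e\<close>. Evaluating the first
  letter at \<open>e\<close> and \<open>\<beta>\<close> at the second, and multiplying the results,
  is a balanced map into \<open>A\<close>.\<close>

lemma zigzag_cov:
  assumes \<alpha>: "\<alpha> \<in> carrier (dual A L)" and f: "f \<in> carrier L" and \<beta>: "\<beta> \<in> carrier (dual A L)"
  shows "ract (dual A L) \<alpha> (\<beta> f) = lact (dual A L) (pair False (Cov \<alpha>) (Vec f)) \<beta>"
proof -
  obtain es \<epsilon>s where basis: "dual_basis A L es \<epsilon>s"
    and coev: "\<forall>b\<in>carrier A. coev A L b = tensor_class A [B False, B True]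
      (\<Sum>i<length es. frag_of [lact (B False) b (Cov (\<epsilon>s ! i)), Vec (es ! i)])"
    by (rule coev_expand)
  let ?b = "pair False (Cov \<alpha>) (Vec f)"
  have b: "?b \<in> carrier A" using \<alpha> f by (intro pair_False_closed) (auto simp: carrier_B)
  have mem: "es ! i \<in> carrier L" "\<epsilon>s ! i \<in> carrier (dual A L)" if "i < length es" for i
    using that basis unfolding dual_basis_def by (metis nth_mem subsetD)+
  have "\<alpha> e \<otimes>\<^bsub>A\<^esub> \<beta> f = \<beta> (ract L e ?b)" if e: "e \<in> carrier L" for e
  proof -
    let ?\<phi> = "\<lambda>w. cov (hd w) e \<otimes>\<^bsub>A\<^esub> \<beta> (vec (hd (tl w)))"
    have "balanced_map A [B False, B True] A ?\<phi>"
      by (rule balanced_map_2I)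
        (auto simp: carrier_B B_simps L.dual_closed e \<beta> R.l_distr R.r_distr L.dual_add L.dual_lact
          dual_simps(3,5) R.m_assoc)
    from pair_expand[OF basis coev R.abelian_group_axioms this, of "Cov \<alpha>" "Vec f"]
    have "\<alpha> e \<otimes>\<^bsub>A\<^esub> \<beta> f = (\<Oplus>\<^bsub>A\<^esub>i\<in>{..<length es}. (\<epsilon>s ! i) (ract L e ?b) \<otimes>\<^bsub>A\<^esub> \<beta> (es ! i))"
      using \<alpha> f e by (simp add: carrier_B B_simps dual_simps(4))
    \<comment> \<open>Left linearity of \<open>\<beta>\<close> pulls each coefficient inside, so
      that the sum becomes \<open>\<beta>\<close> of a single dual basis expansion.\<close>
    also have "\<dots> = (\<Oplus>\<^bsub>A\<^esub>i\<in>{..<length es}. \<beta> (lact L ((\<epsilon>s ! i) (ract L e ?b)) (es ! i)))"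
    proof (rule R.finsum_cong'[OF refl])
      show "(\<lambda>i. \<beta> (lact L ((\<epsilon>s ! i) (ract L e ?b)) (es ! i))) \<in> {..<length es} \<rightarrow> carrier A"
        using mem by (auto intro!: L.dual_closed[OF \<beta>] L.lact_closed L.dual_closed L.ract_closed b e)
    next
      fix i assume "i \<in> {..<length es}"
      then show "(\<epsilon>s ! i) (ract L e ?b) \<otimes>\<^bsub>A\<^esub> \<beta> (es ! i) = \<beta> (lact L ((\<epsilon>s ! i) (ract L e ?b)) (es ! i))"
        using mem[of i] by (simp add: L.dual_lact \<beta> L.dual_closed L.ract_closed b e)
    qed
    also have "\<dots> = \<beta> (\<Oplus>\<^bsub>L\<^esub>i\<in>{..<length es}. lact L ((\<epsilon>s ! i) (ract L e ?b)) (es ! i))"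
      using mem by (intro L.dual_finsum[OF \<beta>, symmetric]) (auto intro!: L.lact_closed L.dual_closed L.ract_closed b e)
    also have "\<dots> = \<beta> (ract L e ?b)"
      using basis L.ract_closed[OF b e] unfolding dual_basis_def by metis
    finally show ?thesis .
  qed
  then show ?thesis
    by (auto simp: dual_simps(4,5) intro!: restrict_ext)
qed

lemma zigzag:
  assumes "x \<in> carrier (B s)" "y \<in> carrier (B (\<not> s))" "z \<in> carrier (B s)"
  shows "ract (B s) x (pair (\<not> s) y z) = lact (B s) (pair s x y) z"
proof (cases s)
  case True
  with assms obtain e \<alpha> f where *: "x = Vec e" "y = Cov \<alpha>" "z = Vec f"
    "e \<in> carrier L" "\<alpha> \<in> carrier (dual A L)" "f \<in> carrier L"
    by (auto simp: carrier_B)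
  have "pair True x y = \<alpha> e" by (simp add: pair_def ev_def *)
  then show ?thesis
    using True zigzag_vec[OF *(4-6)] by (simp add: * B_simps)
next
  case False
  with assms obtain \<alpha> f \<beta> where *: "x = Cov \<alpha>" "y = Vec f" "z = Cov \<beta>"
    "\<alpha> \<in> carrier (dual A L)" "f \<in> carrier L" "\<beta> \<in> carrier (dual A L)"
    by (auto simp: carrier_B)
  have "pair True y z = \<beta> f" by (simp add: pair_def ev_def *)
  then show ?thesis
    using False zigzag_cov[OF *(4-6)] by (simp add: * B_simps)
qed

end

section \<open>Cancellation of words\<close>

text \<open>The degree of a word of \<open>k\<close> letters of sign \<open>s\<close>. For
  \<open>k = 0\<close> both signs give degree 0, so the degree does not determine the sign of an
  empty word.\<close>

definition sdeg :: "bool \<Rightarrow> nat \<Rightarrow> int" where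
  "sdeg s k = (if s then int k else - int k)"

text \<open>The fourth rule is the invariance of the total degree when one letter on each side is
  cancelled.\<close>

lemma sdeg_simps [simp]:
  "sdeg s 0 = 0" "sdeg s k = 0 \<longleftrightarrow> k = 0" "nat \<bar>sdeg s k\<bar> = k"
  "s \<noteq> t \<Longrightarrow> sdeg s (Suc k) + sdeg t (Suc l) = sdeg s k + sdeg t l"
  "sdeg s k + sdeg s l = sdeg s (k + l)"
  by (auto simp: sdeg_def)

lemma sdeg_pos: "k \<noteq> 0 \<Longrightarrow> sdeg s k > 0 \<longleftrightarrow> s"
  by (auto simp: sdeg_def)

lemma sdeg_nat_abs: "sdeg (n > 0) (nat \<bar>n\<bar>) = n"
  by (auto simp: sdeg_def)

context weak_line
begin

abbreviation "F \<equiv> pow_factors A L"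
abbreviation "G \<equiv> L_pow A L"
abbreviation "cl n w \<equiv> tensor_class A (F n) (frag_of w)"

lemma F_0: "F 0 = [A_bim A]"
  and F_sdeg: "k \<noteq> 0 \<Longrightarrow> F (sdeg s k) = replicate k (B s)"
  by (simp_all add: pow_factors_def pow_factor_def sdeg_pos B_def sdeg_def)

lemma F_list: "bimodule_list A (F n)"
proof (rule bimodule_list.intro)
  fix E assume "E \<in> set (F n)"
  then have "E = A_bim A \<or> (\<exists>s. E = B s)"
    by (cases "n = 0") (auto simp: F_0 F_sdeg[of "nat \<bar>n\<bar>" "n > 0", unfolded sdeg_nat_abs])
  then show "bimodule A E"
    using A_bim_bimodule B_bimodule by blast
qed

sublocale F: bimodule_list A "F n" for n
  by (rule F_list)

lemma G_abelian: "abelian_group (G n)"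
  unfolding L_pow_def by (rule F.tensor_abelian)

lemma words_F_0: "w \<in> words (F 0) \<longleftrightarrow> (\<exists>a\<in>carrier A. w = [Sca a])"
  by (auto simp: F_0 words_iff A_bim_def length_Suc_conv)

lemma words_F_sdeg:
  "k \<noteq> 0 \<Longrightarrow> w \<in> words (F (sdeg s k)) \<longleftrightarrow> length w = k \<and> set w \<subseteq> carrier (B s)"
  by (auto simp: F_sdeg words_iff subset_code(1) all_set_conv_all_nth)

lemma cl_closed: "w \<in> words (F n) \<Longrightarrow> cl n w \<in> carrier (G n)"
  unfolding L_pow_def by (rule F.gen_closed)

lemma cl_add_Sca:
  assumes "a \<in> carrier A" "b \<in> carrier A"
  shows "cl 0 [Sca (a \<oplus>\<^bsub>A\<^esub> b)] = cl 0 [Sca a] \<oplus>\<^bsub>G 0\<^esub> cl 0 [Sca b]"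
proof -
  have "[Sca a] \<in> words (F 0)" using assms by (simp add: words_F_0)
  from F.gen_add[OF this, of 0 "Sca a" "Sca b"] show ?thesis
    using assms by (simp add: F_0 A_bim_def L_pow_def)
qed

text \<open>The degree is a variable with an equation, so that the rule applies in whatever
  arithmetic form the degree of a product appears.\<close>

lemma cl_add:
  assumes "set u \<subseteq> carrier (B s)" "set v \<subseteq> carrier (B s)" "x \<in> carrier (B s)" "y \<in> carrier (B s)"
    and n: "n = sdeg s (Suc (length u + length v))"
  shows "cl n (u @ (x \<oplus>\<^bsub>B s\<^esub> y) # v) = cl n (u @ x # v) \<oplus>\<^bsub>G n\<^esub> cl n (u @ y # v)"
proof -
  have F: "F n = replicate (Suc (length u + length v)) (B s)"
    unfolding n by (rule F_sdeg) simp
  have "u @ x # v \<in> words (F n)"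
    using assms by (simp add: words_F_sdeg)
  moreover have "length u < length (F n)" "F n ! length u = B s"
    by (simp_all add: F del: replicate_Suc)
  ultimately show ?thesis
    using F.gen_add[of "u @ x # v" n "length u" x y] assms(3,4) by (simp add: L_pow_def)
qed

lemma cl_balance:
  assumes "set u \<subseteq> carrier (B s)" "set v \<subseteq> carrier (B s)" "x \<in> carrier (B s)" "y \<in> carrier (B s)"
    and a: "a \<in> carrier A" and n: "n = sdeg s (Suc (Suc (length u + length v)))"
  shows "cl n (u @ ract (B s) x a # y # v) = cl n (u @ x # lact (B s) a y # v)"
proof -
  have F: "F n = replicate (Suc (Suc (length u + length v))) (B s)"
    unfolding n by (rule F_sdeg) simp
  have "u @ x # y # v \<in> words (F n)"
    using assms by (simp add: words_F_sdeg)
  moreover have "Suc (length u) < length (F n)" "F n ! length u = B s" "F n ! Suc (length u) = B s"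
    by (simp_all add: F del: replicate_Suc)
  ultimately show ?thesis
    using F.gen_balance[of "u @ x # y # v" n "length u" a] a
    by (simp add: list_update_append nth_append)
qed

text \<open>The product of a word of sign s, a scalar and a word of sign t. The first word is given in
  reverse, so that the letters which are paired first come first, and an empty word stands for the
  unit of A.\<close>

fun cat :: "bool \<Rightarrow> bool \<Rightarrow> ('a, 'm) letter list \<Rightarrow> 'a \<Rightarrow> ('a, 'm) letter list \<Rightarrow> ('a, 'm) letter list" where
  "cat s t [] a [] = [Sca a]"
| "cat s t [] a (y # v) = lact (B t) a y # v"
| "cat s t (x # r) a [] = rev r @ [ract (B s) x a]"
| "cat s t (x # r) a (y # v) =
     (if s = t then rev r @ ract (B s) x a # y # v else cat s t r (pair s (ract (B s) x a) y) v)"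

lemmas B_closed = B_lact_closed B_ract_closed B_add_closed

lemma pair_closed': "\<lbrakk>x \<in> carrier (B s); y \<in> carrier (B t); s \<noteq> t\<rbrakk> \<Longrightarrow> pair s x y \<in> carrier A"
  using pair_closed by (cases t; cases s) auto

lemma cat_words:
  assumes "set r \<subseteq> carrier (B s)" "set v \<subseteq> carrier (B t)" "a \<in> carrier A"
  shows "cat s t r a v \<in> words (F (sdeg s (length r) + sdeg t (length v)))"
  using assms
proof (induction s t r a v rule: cat.induct)
  case (1 s t a)
  then show ?case by (simp add: words_F_0)
next
  case (2 s t a y v)
  then show ?case by (simp add: words_F_sdeg B_closed)
next
  case (3 s t x r a)
  then show ?case by (simp add: words_F_sdeg B_closed)
next
  case (4 s t x r a y v)
  show ?case
  proof (cases "s = t")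
    case True
    then show ?thesis using 4 by (simp add: words_F_sdeg B_closed)
  next
    case False
    then show ?thesis using 4 by (simp add: pair_closed B_closed)
  qed
qed

text \<open>Each cancellation feeds the scalar through a pairing, which is additive in it, so a sum
  is carried to the end of the recursion, where it lands on one letter or in degree 0. The second
  summand changes at each step and is therefore kept arbitrary.\<close>

lemma cat_add_scalar:
  assumes "set r \<subseteq> carrier (B s)" "set v \<subseteq> carrier (B t)" "a \<in> carrier A" "b \<in> carrier A"
    and "n = sdeg s (length r) + sdeg t (length v)"
  shows "cl n (cat s t r (a \<oplus>\<^bsub>A\<^esub> b) v) = cl n (cat s t r a v) \<oplus>\<^bsub>G n\<^esub> cl n (cat s t r b v)"
  using assms
proof (induction s t r a v arbitrary: b rule: cat.induct)
  case (1 s t a)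
  then show ?case by (simp add: cl_add_Sca)
next
  case (2 s t a y v)
  then show ?case
    using cl_add[of "[]" s v] by (simp add: B_add_lact B_closed cl_add[where u = "[]", simplified])
next
  case (3 s t x r a)
  then show ?case by (simp add: B_add_ract B_closed cl_add)
next
  case (4 s t x r a y v)
  show ?case
  proof (cases "s = t")
    case True
    then show ?thesis using 4 by (simp add: B_add_ract B_closed cl_add)
  next
    case False
    then have "pair s (ract (B s) x (a \<oplus>\<^bsub>A\<^esub> b)) y = pair s (ract (B s) x a) y \<oplus>\<^bsub>A\<^esub> pair s (ract (B s) x b) y"
      using 4 pair_add_left[of "ract (B s) x a" s "ract (B s) x b" y]
      by (simp add: B_add_ract B_closed)
    then show ?thesis using 4 False by (simp add: pair_closed B_closed)
  qed
qed

lemma cat_ract: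
  "\<lbrakk>x \<in> carrier (B s); a \<in> carrier A; b \<in> carrier A\<rbrakk> \<Longrightarrow>
    cat s t (ract (B s) x b # r) a v = cat s t (x # r) (b \<otimes>\<^bsub>A\<^esub> a) v"
  by (cases v; cases "s = t") (simp_all add: B_ract_mult)

lemma pair_balance_opp:
  "\<lbrakk>a \<in> carrier A; x \<in> carrier (B s); y \<in> carrier (B t); s \<noteq> t\<rbrakk> \<Longrightarrow>
    pair s (ract (B s) x a) y = pair s x (lact (B t) a y)"
  and pair_lact_opp: "\<lbrakk>a \<in> carrier A; x \<in> carrier (B s); y \<in> carrier (B t); s \<noteq> t\<rbrakk> \<Longrightarrow>
    pair s (lact (B s) a x) y = a \<otimes>\<^bsub>A\<^esub> pair s x y"
  and pair_ract_opp: "\<lbrakk>a \<in> carrier A; x \<in> carrier (B s); y \<in> carrier (B t); s \<noteq> t\<rbrakk> \<Longrightarrow>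
    pair s x (ract (B t) y a) = pair s x y \<otimes>\<^bsub>A\<^esub> a"
  using pair_balance[of a x s y] pair_lact[of a x s y] pair_ract[of a x s y] by (cases t; cases s; simp)+

lemma pair_add_right_opp:
  "\<lbrakk>x \<in> carrier (B s); y \<in> carrier (B t); y' \<in> carrier (B t); s \<noteq> t\<rbrakk> \<Longrightarrow>
    pair s x (y \<oplus>\<^bsub>B t\<^esub> y') = pair s x y \<oplus>\<^bsub>A\<^esub> pair s x y'"
  using pair_add_right[of x s y y'] by (cases t; cases s; simp)

text \<open>Here the words agree literally: \<open>y\<close> is either absorbed into a pairing or,
  for empty \<open>r\<close>, carries the scalar itself.\<close>

lemma cat_lact_opp:
  assumes "set r \<subseteq> carrier (B s)" "y \<in> carrier (B t)" "a \<in> carrier A" "b \<in> carrier A" "s \<noteq> t"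
  shows "cat s t r a (lact (B t) b y # v) = cat s t r (a \<otimes>\<^bsub>A\<^esub> b) (y # v)"
  using assms by (cases r) (simp_all add: B_lact_mult B_ract_mult pair_balance_opp B_closed)

text \<open>For equal signs and nonempty \<open>r\<close> the accumulated scalar sits on the last
  letter of the left word, so moving \<open>b\<close> there crosses a tensor sign and only the
  classes agree.\<close>

lemma cat_lact:
  assumes "set r \<subseteq> carrier (B s)" "y \<in> carrier (B t)" "set v \<subseteq> carrier (B t)" "a \<in> carrier A" "b \<in> carrier A"
    and "n = sdeg s (length r) + sdeg t (Suc (length v))"
  shows "cl n (cat s t r a (lact (B t) b y # v)) = cl n (cat s t r (a \<otimes>\<^bsub>A\<^esub> b) (y # v))"
proof (cases "s = t \<and> r \<noteq> []")
  case True
  then obtain x r' where r: "r = x # r'" by (cases r) auto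
  have "cl n (rev r' @ ract (B s) (ract (B s) x a) b # y # v) = cl n (rev r' @ ract (B s) x a # lact (B s) b y # v)"
    by (rule cl_balance) (use assms True r in \<open>simp_all add: B_closed\<close>)
  then show ?thesis using assms True r by (simp add: B_ract_mult)
next
  case False
  then show ?thesis
    using assms cat_lact_opp[of r s y t a b v] by (cases "r = []") (auto simp: B_lact_mult)
qed

text \<open>The induction follows the cancellation. If the varied letter is reached, the sum passes
  through the pairing into the scalar and \<open>cat_add_scalar\<close> takes over; if the
  cancellation stops earlier, the letter survives and \<open>cl_add\<close> applies.\<close>

lemma cat_add_left:
  assumes "set r \<subseteq> carrier (B s)" "set r' \<subseteq> carrier (B s)" "set v \<subseteq> carrier (B t)" "a \<in> carrier A"
    and "x \<in> carrier (B s)" "y \<in> carrier (B s)"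
    and "n = sdeg s (Suc (length r + length r')) + sdeg t (length v)"
  shows "cl n (cat s t (r @ (x \<oplus>\<^bsub>B s\<^esub> y) # r') a v) =
    cl n (cat s t (r @ x # r') a v) \<oplus>\<^bsub>G n\<^esub> cl n (cat s t (r @ y # r') a v)"
  using assms
proof (induction r arbitrary: a v n)
  case Nil
  show ?case
  proof (cases v)
    case Nil
    then show ?thesis
      using Nil.prems Nil cl_add[of "rev r'" s "[]" "ract (B s) x a" "ract (B s) y a" n]
      by (simp add: B_ract_add B_closed)
  next
    case (Cons z v')
    then show ?thesis
      using Nil.prems cl_add[of "rev r'" s "z # v'" "ract (B s) x a" "ract (B s) y a" n]
      by (cases "s = t") (simp_all add: B_ract_add B_closed pair_add_left pair_closed cat_add_scalar)
  qed
next
  case (Cons z r)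
  show ?case
  proof (cases v)
    case Nil
    then show ?thesis
      using Cons.prems cl_add[of "rev r'" s "rev r @ [ract (B s) z a]" x y n]
      by (simp add: B_closed add_ac)
  next
    case (Cons w v')
    then show ?thesis
      using Cons.prems Cons.IH cl_add[of "rev r'" s "rev r @ ract (B s) z a # w # v'" x y n]
      by (cases "s = t") (simp_all add: B_closed pair_closed add_ac)
  qed
qed

lemma cat_add_right:
  assumes "set r \<subseteq> carrier (B s)" "set v \<subseteq> carrier (B t)" "set v' \<subseteq> carrier (B t)" "a \<in> carrier A"
    and "x \<in> carrier (B t)" "y \<in> carrier (B t)"
    and "n = sdeg s (length r) + sdeg t (Suc (length v + length v'))"
  shows "cl n (cat s t r a (v @ (x \<oplus>\<^bsub>B t\<^esub> y) # v')) =
    cl n (cat s t r a (v @ x # v')) \<oplus>\<^bsub>G n\<^esub> cl n (cat s t r a (v @ y # v'))"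
  using assms
proof (induction r arbitrary: a v n)
  case Nil
  show ?case
  proof (cases v)
    case Nil
    then show ?thesis
      using Nil.prems cl_add[of "[]" t v' "lact (B t) a x" "lact (B t) a y" n]
      by (simp add: B_lact_add B_closed)
  next
    case (Cons z w)
    then show ?thesis
      using Nil.prems cl_add[of "lact (B t) a z # w" t v' x y n]
      by (simp add: B_closed)
  qed
next
  case (Cons z r)
  show ?case
  proof (cases "s = t")
    case True
    then have "cat s t (z # r) a (v @ w # v') = (rev r @ ract (B t) z a # v) @ w # v'" for w
      by (cases v) simp_all
    then show ?thesis
      using Cons.prems True cl_add[of "rev r @ ract (B t) z a # v" t v' x y n]
      by (simp add: B_closed add_ac del: cat.simps)
  next
    case False
    show ?thesis
    proof (cases v)
      case Nil
      then show ?thesis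
        using Cons.prems False by (simp add: B_closed pair_add_right_opp pair_closed cat_add_scalar)
    next
      case (Cons w v'')
      then show ?thesis
        using Cons.prems Cons.IH False by (simp add: B_closed pair_closed)
    qed
  qed
qed

text \<open>The left word is stored in reverse, so \<open>y # ract (B s) x b\<close> stands for x.b
  \<otimes> y. When the second letter is cancelled in the form b.y, the factor b comes out of the
  pairing on the left, and \<open>cat_ract\<close> returns it to x.\<close>

lemma cat_balance_left:
  assumes "set r \<subseteq> carrier (B s)" "set r' \<subseteq> carrier (B s)" "set v \<subseteq> carrier (B t)" "a \<in> carrier A"
    and "x \<in> carrier (B s)" "y \<in> carrier (B s)" "b \<in> carrier A"
    and "n = sdeg s (Suc (Suc (length r + length r'))) + sdeg t (length v)"
  shows "cl n (cat s t (r @ y # ract (B s) x b # r') a v) = cl n (cat s t (r @ lact (B s) b y # x # r') a v)"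
  using assms
proof (induction r arbitrary: a v n)
  case Nil
  show ?case
  proof (cases v)
    case Nil
    then show ?thesis
      using Nil.prems cl_balance[of "rev r'" s "[]" x "ract (B s) y a" b n]
      by (simp add: B_lact_ract B_closed)
  next
    case (Cons z v')
    then show ?thesis
      using Nil.prems cl_balance[of "rev r'" s "z # v'" x "ract (B s) y a" b n]
      by (cases "s = t") (simp_all add: B_lact_ract B_closed pair_lact pair_closed cat_ract)
  qed
next
  case (Cons z r)
  show ?case
  proof (cases v)
    case Nil
    then show ?thesis
      using Cons.prems cl_balance[of "rev r'" s "rev r @ [ract (B s) z a]" x y b n]
      by (simp add: B_closed add_ac)
  next
    case (Cons w v')
    then show ?thesis
      using Cons.prems Cons.IH cl_balance[of "rev r'" s "rev r @ ract (B s) z a # w # v'" x y b n]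
      by (cases "s = t") (simp_all add: B_closed pair_closed add_ac)
  qed
qed

text \<open>The mirror image: when \<open>x\<close> is cancelled, \<open>b\<close> comes out of the
  pairing as the right factor of the scalar, and \<open>cat_lact_opp\<close> hands it to the next
  letter.\<close>

lemma cat_balance_right:
  assumes "set r \<subseteq> carrier (B s)" "set v \<subseteq> carrier (B t)" "set v' \<subseteq> carrier (B t)" "a \<in> carrier A"
    and "x \<in> carrier (B t)" "y \<in> carrier (B t)" "b \<in> carrier A"
    and "n = sdeg s (length r) + sdeg t (Suc (Suc (length v + length v')))"
  shows "cl n (cat s t r a (v @ ract (B t) x b # y # v')) = cl n (cat s t r a (v @ x # lact (B t) b y # v'))"
  using assms
proof (induction r arbitrary: a v n)
  case Nil
  show ?case
  proof (cases v)
    case Nil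
    then show ?thesis
      using Nil.prems cl_balance[of "[]" t v' "lact (B t) a x" y b n]
      by (simp add: B_lact_ract B_closed)
  next
    case (Cons z w)
    then show ?thesis
      using Nil.prems cl_balance[of "lact (B t) a z # w" t v' x y b n]
      by (simp add: B_closed)
  qed
next
  case (Cons z r)
  show ?case
  proof (cases "s = t")
    case True
    then have "cat s t (z # r) a (v @ w # w' # v') = (rev r @ ract (B t) z a # v) @ w # w' # v'" for w w'
      by (cases v) simp_all
    then show ?thesis
      using Cons.prems True cl_balance[of "rev r @ ract (B t) z a # v" t v' x y b n]
      by (simp add: B_closed add_ac del: cat.simps)
  next
    case False
    show ?thesis
    proof (cases v)
      case Nil
      then show ?thesis
        using Cons.prems False by (simp add: B_closed pair_ract_opp pair_closed cat_lact_opp)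
    next
      case (Cons w v'')
      then show ?thesis
        using Cons.prems Cons.IH False by (simp add: B_closed pair_closed)
    qed
  qed
qed

end

section \<open>The product of words\<close>

context weak_line
begin

text \<open>For opposite signs this is the scalar that \<open>cat\<close> has accumulated once one
  of the words is used up. It consumes letters from the inside, whereas \<open>nested\<close>
  recurses from the outside; \<open>peel_snoc\<close> reconciles the two.\<close>

fun peel :: "bool \<Rightarrow> ('a, 'm) letter list \<Rightarrow> 'a \<Rightarrow> ('a, 'm) letter list \<Rightarrow> 'a" where
  "peel s (x # r) a (y # v) = peel s r (pair s (ract (B s) x a) y) v"
| "peel s r a v = a"

lemma cat_peel:
  "\<lbrakk>length r = length v; s \<noteq> t\<rbrakk> \<Longrightarrow> cat s t (r @ r') a (v @ v') = cat s t r' (peel s r a v) v'"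
  by (induction r v arbitrary: a rule: list_induct2) simp_all

lemma peel_snoc:
  "length r = length v \<Longrightarrow> peel s (r @ [x]) a (v @ [y]) = pair s (ract (B s) x (peel s r a v)) y"
  by (induction r v arbitrary: a rule: list_induct2) simp_all

lemma nested_peel:
  assumes "length u = length v" "u \<noteq> []" "set u \<subseteq> carrier (B s)"
  shows "nested (pair s) (B s) u v = peel s (rev u) \<one>\<^bsub>A\<^esub> v"
  using assms
proof (induction u arbitrary: v)
  case (Cons x u)
  show ?case
  proof (cases u)
    case Nil
    with Cons.prems obtain y where "v = [y]" by (cases v) auto
    then show ?thesis using Cons.prems Nil by (simp add: B_ract_one)
  next
    case (Cons x' u')
    then have v: "v \<noteq> []" "length (butlast v) = length u" using Cons.prems by auto
    have "nested (pair s) (B s) (x # u) v = pair s (ract (B s) x (nested (pair s) (B s) u (butlast v))) (last v)"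
      by (simp add: Cons)
    also have "nested (pair s) (B s) u (butlast v) = peel s (rev u) \<one>\<^bsub>A\<^esub> (butlast v)"
      using Cons.IH[of "butlast v"] Cons.prems v Cons by simp
    also have "pair s (ract (B s) x \<dots>) (last v) = peel s (rev u @ [x]) \<one>\<^bsub>A\<^esub> (butlast v @ [last v])"
      by (rule peel_snoc[symmetric]) (simp only: length_rev v(2))
    finally show ?thesis using v by simp
  qed
qed simp

text \<open>A word of degree 0 is one \<open>Sca\<close> letter, which counts as a scalar without
  letters; in other degrees the scalar is 1. With this convention \<open>cat\<close> covers degree 0
  as well.\<close>

definition letters :: "int \<Rightarrow> ('a, 'm) letter list \<Rightarrow> ('a, 'm) letter list" where
  "letters n u = (if n = 0 then [] else u)"

definition scalar :: "int \<Rightarrow> ('a, 'm) letter list \<Rightarrow> 'a" where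
  "scalar n u = (if n = 0 then sca (hd u) else \<one>\<^bsub>A\<^esub>)"

lemma words_F_split:
  assumes "w \<in> words (F n)"
  shows "scalar n w \<in> carrier A" "set (letters n w) \<subseteq> carrier (B (n > 0))"
    "length (letters n w) = nat \<bar>n\<bar>" "sdeg (n > 0) (length (letters n w)) = n"
proof -
  have "scalar n w \<in> carrier A \<and> set (letters n w) \<subseteq> carrier (B (n > 0)) \<and> length (letters n w) = nat \<bar>n\<bar>"
  proof (cases "n = 0")
    case True
    then show ?thesis using assms by (auto simp: words_F_0 letters_def scalar_def)
  next
    case False
    then show ?thesis
      using assms words_F_sdeg[of "nat \<bar>n\<bar>" w "n > 0"] by (simp add: sdeg_nat_abs letters_def scalar_def)
  qed
  then show "scalar n w \<in> carrier A" "set (letters n w) \<subseteq> carrier (B (n > 0))"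
    "length (letters n w) = nat \<bar>n\<bar>" "sdeg (n > 0) (length (letters n w)) = n"
    by (simp_all add: sdeg_nat_abs)
qed

lemma F_nonzero: "n \<noteq> 0 \<Longrightarrow> F n = replicate (nat \<bar>n\<bar>) (B (n > 0))"
  using F_sdeg[of "nat \<bar>n\<bar>" "n > 0"] by (simp add: sdeg_nat_abs)

lemma word_lact_cat:
  assumes "n \<noteq> 0" "v \<noteq> []"
  shows "word_lact (F n) a v = cat s (n > 0) [] a v"
  using assms by (cases v; cases "nat \<bar>n\<bar>") (simp_all add: word_lact_def F_nonzero)

lemma word_ract_cat:
  assumes "n \<noteq> 0" "u \<noteq> []"
  shows "word_ract (F n) u a = cat (n > 0) t (rev u) a []"
  using assms by (cases u rule: rev_cases) (simp_all add: word_ract_def F_nonzero)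

text \<open>The comparison of the lengths of two words is confined to this proof. With opposite
  signs the shorter word is peeled off completely against the inner end of the longer one, and
  \<open>cat_peel\<close> identifies what remains.\<close>

lemma word_prod_cat:
  assumes u: "u \<in> words (F n)" and v: "v \<in> words (F m)"
  shows "word_prod A L n m u v =
    cat (n > 0) (m > 0) (rev (letters n u)) (scalar n u \<otimes>\<^bsub>A\<^esub> scalar m v) (letters m v)"
proof -
  note uv = words_F_split[OF u] words_F_split[OF v]
  show ?thesis
  proof (cases "n = 0 \<or> m = 0")
    case True
    show ?thesis
    proof (cases "n = 0 \<and> m = 0")
      case True
      then obtain a b where "u = [Sca a]" "v = [Sca b]"
        using u v by (auto simp: words_F_0)
      then show ?thesis
        using True by (simp add: word_prod_def letters_def scalar_def word_lact_def F_0 A_bim_def)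
    next
      case False
      moreover have "n \<noteq> 0 \<Longrightarrow> u \<noteq> []" "m \<noteq> 0 \<Longrightarrow> v \<noteq> []"
        using uv(3,7) by (auto simp: letters_def)
      ultimately show ?thesis
        using True uv by (auto simp: word_prod_def letters_def scalar_def word_lact_cat[where s = False]
            word_ract_cat[where t = False])
    qed
  next
    case False
    define s where "s = (n > 0)"
    define t where "t = (m > 0)"
    define k where "k = nat \<bar>n\<bar>"
    define l where "l = nat \<bar>m\<bar>"
    have [simp]: "letters n u = u" "letters m v = v" "scalar n u = \<one>\<^bsub>A\<^esub>" "scalar m v = \<one>\<^bsub>A\<^esub>"
      using False by (simp_all add: letters_def scalar_def)
    have len: "length u = k" "length v = l" "k \<noteq> 0" "l \<noteq> 0"
      using uv False by (simp_all add: k_def l_def)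
    have us: "set u \<subseteq> carrier (B s)" and vt: "set v \<subseteq> carrier (B t)"
      using uv by (simp_all add: s_def t_def)
    show ?thesis
    proof (cases "s = t")
      case True
      have "u \<noteq> []" "v \<noteq> []" using len by auto
      then obtain u' x y v' where *: "u = u' @ [x]" "v = y # v'" by (metis list.exhaust rev_exhaust)
      have "cat s t (rev u) \<one>\<^bsub>A\<^esub> v = u @ v"
        unfolding * using True us * by (simp add: B_ract_one)
      moreover have "sgn n = sgn m" using True False by (auto simp: s_def t_def sgn_if)
      ultimately show ?thesis
        using False by (simp add: word_prod_def s_def[symmetric] t_def[symmetric])
    next
      case st: False
      have sgn: "sgn n \<noteq> sgn m" using st False by (auto simp: s_def t_def sgn_if)
      have p: "nested (if n > 0 then ev else coev_inv A L) (pow_factor A L n) = nested (pair s) (B s)"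
      proof -
        have "pair s = (if n > 0 then ev else coev_inv A L)" by (auto simp: pair_def fun_eq_iff s_def)
        moreover have "B s = pow_factor A L n" using False by (auto simp: s_def pow_factor_def B_def)
        ultimately show ?thesis by simp
      qed
      have ne: "u \<noteq> []" using len by auto
      consider "k = l" | "k < l" | "l < k" by linarith
      then show ?thesis
      proof cases
        case 1
        have "word_prod A L n m u v = [Sca (peel s (rev u) \<one>\<^bsub>A\<^esub> v)]"
          using False sgn 1 len us p ne
          by (simp add: word_prod_def k_def[symmetric] l_def[symmetric] nested_peel Let_def)
        then show ?thesis
          using cat_peel[of "rev u" v s t "[]" "\<one>\<^bsub>A\<^esub>" "[]"] 1 len st
          by (simp add: s_def[symmetric] t_def[symmetric])
      next
        case 2
        have nm: "n + m \<noteq> 0" "(n + m > 0) = t" using 2 False st by (auto simp: k_def l_def s_def t_def)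
        have "word_prod A L n m u v = word_lact (F (n + m)) (peel s (rev u) \<one>\<^bsub>A\<^esub> (take k v)) (drop k v)"
          using False sgn 2 len us p ne
          by (simp add: word_prod_def k_def[symmetric] l_def[symmetric] nested_peel Let_def)
        also have "\<dots> = cat s t [] (peel s (rev u) \<one>\<^bsub>A\<^esub> (take k v)) (drop k v)"
          using word_lact_cat[OF nm(1), of "drop k v" _ s] 2 len nm(2) by simp
        also have "\<dots> = cat s t (rev u @ []) \<one>\<^bsub>A\<^esub> (take k v @ drop k v)"
          using 2 len st by (subst cat_peel) simp_all
        finally show ?thesis
          by (simp add: s_def[symmetric] t_def[symmetric])
      next
        case 3
        have nm: "n + m \<noteq> 0" "(n + m > 0) = s" using 3 False st by (auto simp: k_def l_def s_def t_def)
        \<comment> \<open>Only the last \<open>l\<close> letters of \<open>u\<close>, those nearest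
          to \<open>v\<close>, take part in the pairing.\<close>
        have d: "set (drop (k - l) u) \<subseteq> carrier (B s)"
          using us set_drop_subset by (rule order_trans[rotated])
        have "word_prod A L n m u v = word_ract (F (n + m)) (take (k - l) u) (peel s (rev (drop (k - l) u)) \<one>\<^bsub>A\<^esub> v)"
          using False sgn 3 len d p
          by (simp add: word_prod_def k_def[symmetric] l_def[symmetric] nested_peel Let_def)
        also have "\<dots> = cat s t (rev (take (k - l) u)) (peel s (rev (drop (k - l) u)) \<one>\<^bsub>A\<^esub> v) []"
          using word_ract_cat[OF nm(1), of "take (k - l) u" _ t] 3 len nm(2) ne by simp
        also have "\<dots> = cat s t (rev (drop (k - l) u) @ rev (take (k - l) u)) \<one>\<^bsub>A\<^esub> (v @ [])"
          using 3 len st by (subst cat_peel) simp_all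
        also have "rev (drop (k - l) u) @ rev (take (k - l) u) = rev u"
          by (metis append_take_drop_id rev_append)
        finally show ?thesis
          by (simp add: s_def[symmetric] t_def[symmetric])
      qed
    qed
  qed
qed

lemma word_prod_closed:
  assumes u: "u \<in> words (F n)" and v: "v \<in> words (F m)"
  shows "word_prod A L n m u v \<in> words (F (n + m))"
  unfolding word_prod_cat[OF assms]
  using cat_words[of "rev (letters n u)" "n > 0" "letters m v" "m > 0" "scalar n u \<otimes>\<^bsub>A\<^esub> scalar m v"]
    words_F_split[OF u] words_F_split[OF v] by simp

lemma balanced_map_F_0:
  assumes "\<And>a. a \<in> carrier A \<Longrightarrow> \<phi> [Sca a] \<in> carrier H"
    and "\<And>a b. \<lbrakk>a \<in> carrier A; b \<in> carrier A\<rbrakk> \<Longrightarrow> \<phi> [Sca (a \<oplus>\<^bsub>A\<^esub> b)] = \<phi> [Sca a] \<oplus>\<^bsub>H\<^esub> \<phi> [Sca b]"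
  shows "balanced_map A (F 0) H \<phi>"
  unfolding balanced_map_def Ball_def words_F_0 using assms by (auto simp: F_0 A_bim_def)

text \<open>Replaces positions and list updates by splittings \<open>u @ x # v\<close>, the form in
  which the rules for \<open>cat\<close> are stated.\<close>

lemma balanced_map_F:
  assumes n: "n \<noteq> 0" and s: "s = (n > 0)"
    and closed: "\<And>w. w \<in> words (F n) \<Longrightarrow> \<phi> w \<in> carrier H"
    and add: "\<And>u x y v. \<lbrakk>set u \<subseteq> carrier (B s); set v \<subseteq> carrier (B s); x \<in> carrier (B s); y \<in> carrier (B s);
      n = sdeg s (Suc (length u + length v))\<rbrakk> \<Longrightarrow>
      \<phi> (u @ (x \<oplus>\<^bsub>B s\<^esub> y) # v) = \<phi> (u @ x # v) \<oplus>\<^bsub>H\<^esub> \<phi> (u @ y # v)"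
    and bal: "\<And>u x y v a. \<lbrakk>set u \<subseteq> carrier (B s); set v \<subseteq> carrier (B s); x \<in> carrier (B s); y \<in> carrier (B s);
      a \<in> carrier A; n = sdeg s (Suc (Suc (length u + length v)))\<rbrakk> \<Longrightarrow>
      \<phi> (u @ ract (B s) x a # y # v) = \<phi> (u @ x # lact (B s) a y # v)"
  shows "balanced_map A (F n) H \<phi>"
proof -
  have F: "F n = replicate (nat \<bar>n\<bar>) (B s)" using n s F_nonzero by simp
  have sdeg: "n = sdeg s (nat \<bar>n\<bar>)" by (simp add: s sdeg_nat_abs)
  have w: "length w = nat \<bar>n\<bar>" "set w \<subseteq> carrier (B s)" if "w \<in> words (F n)" for w
    using words_F_split[OF that] n by (simp_all add: letters_def s)
  show ?thesis
    unfolding balanced_map_def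
  proof (intro conjI ballI allI impI)
    fix w i x y
    assume *: "w \<in> words (F n)" "i < length (F n)" "x \<in> carrier (F n ! i)" "y \<in> carrier (F n ! i)"
    then have i: "i < length w" and xy: "x \<in> carrier (B s)" "y \<in> carrier (B s)" and Fi: "F n ! i = B s"
      by (simp_all add: F w(1)[OF *(1)])
    have "set (take i w) \<subseteq> carrier (B s)" "set (drop (Suc i) w) \<subseteq> carrier (B s)"
      using w(2)[OF *(1)] set_take_subset set_drop_subset by (meson order_trans)+
    moreover have "n = sdeg s (Suc (length (take i w) + length (drop (Suc i) w)))"
      using i w(1)[OF *(1)] sdeg by simp
    ultimately show "\<phi> (w[i := x \<oplus>\<^bsub>F n ! i\<^esub> y]) = \<phi> (w[i := x]) \<oplus>\<^bsub>H\<^esub> \<phi> (w[i := y])"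
      unfolding Fi using add[of "take i w" "drop (Suc i) w" x y] i xy by (simp add: upd_conv_take_nth_drop)
  next
    fix w i a
    assume *: "w \<in> words (F n)" "Suc i < length (F n)" "a \<in> carrier A"
    then have i: "Suc i < length w" and Fi: "F n ! i = B s" "F n ! Suc i = B s"
      by (simp_all add: F w(1)[OF *(1)])
    define u where "u = take i w"
    define v where "v = drop (Suc (Suc i)) w"
    have wuv: "w = u @ w ! i # w ! Suc i # v"
      using i by (simp add: u_def v_def Cons_nth_drop_Suc id_take_nth_drop[of i w, symmetric])
    have lu: "length u = i" using i by (simp add: u_def)
    have "set w \<subseteq> carrier (B s)" using w(2)[OF *(1)] .
    then have "set u \<subseteq> carrier (B s)" "set v \<subseteq> carrier (B s)" "w ! i \<in> carrier (B s)" "w ! Suc i \<in> carrier (B s)"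
      by (subst (asm) wuv; simp)+
    moreover have "Suc (Suc (length u + length v)) = nat \<bar>n\<bar>"
      using i w(1)[OF *(1)] by (simp add: u_def v_def)
    then have "n = sdeg s (Suc (Suc (length u + length v)))"
      using sdeg by simp
    ultimately have "\<phi> (u @ ract (B s) (w ! i) a # w ! Suc i # v) = \<phi> (u @ w ! i # lact (B s) a (w ! Suc i) # v)"
      using bal *(3) by blast
    moreover have "w[i := z] = u @ z # w ! Suc i # v" "w[Suc i := z] = u @ w ! i # z # v" for z
      by (subst (1) wuv; simp add: list_update_append lu)+
    ultimately show "\<phi> (w[i := ract (F n ! i) (w ! i) a]) = \<phi> (w[Suc i := lact (F n ! Suc i) a (w ! Suc i)])"
      by (simp add: Fi)
  qed (rule closed)
qed

lemma word_prod_balanced_left: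
  assumes v: "v \<in> words (F m)"
  shows "balanced_map A (F n) (G (n + m)) (\<lambda>u. cl (n + m) (word_prod A L n m u v))"
proof -
  note vs = words_F_split[OF v]
  show ?thesis
  proof (cases "n = 0")
    case True
    have "balanced_map A (F 0) (G (0 + m)) (\<lambda>u. cl (0 + m) (word_prod A L 0 m u v))"
    proof (rule balanced_map_F_0)
      fix a assume a: "a \<in> carrier A"
      then have w: "[Sca a] \<in> words (F 0)" by (simp add: words_F_0)
      show "cl (0 + m) (word_prod A L 0 m [Sca a] v) \<in> carrier (G (0 + m))"
        by (rule cl_closed[OF word_prod_closed[OF w v]])
      fix b assume b: "b \<in> carrier A"
      have wp: "word_prod A L 0 m [Sca c] v = cat False (m > 0) [] (c \<otimes>\<^bsub>A\<^esub> scalar m v) (letters m v)"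
        if "c \<in> carrier A" for c
        using word_prod_cat[of "[Sca c]" 0 v m] v that
        by (simp add: words_F_0 letters_def[of 0] scalar_def[of 0])
      show "cl (0 + m) (word_prod A L 0 m [Sca (a \<oplus>\<^bsub>A\<^esub> b)] v) =
          cl (0 + m) (word_prod A L 0 m [Sca a] v) \<oplus>\<^bsub>G (0 + m)\<^esub> cl (0 + m) (word_prod A L 0 m [Sca b] v)"
        using a b vs by (simp add: wp R.l_distr cat_add_scalar[where s = False])
    qed
    then show ?thesis by (simp add: True)
  next
    case False
    let ?s = "n > 0" and ?t = "m > 0"
    have wp: "word_prod A L n m u v = cat ?s ?t (rev u) (scalar m v) (letters m v)"
      if "set u \<subseteq> carrier (B ?s)" "n = sdeg ?s (length u)" for u
    proof -
      have "u \<in> words (F n)"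
        using words_F_sdeg[of "length u" u ?s] that False by (metis sdeg_simps(1) list.size(3))
      then show ?thesis
        using word_prod_cat[of u n v m] v vs False by (simp add: letters_def[of n] scalar_def[of n])
    qed
    show ?thesis
    proof (rule balanced_map_F[OF False refl])
      fix u x y w assume *: "set u \<subseteq> carrier (B ?s)" "set w \<subseteq> carrier (B ?s)" "x \<in> carrier (B ?s)" "y \<in> carrier (B ?s)"
        and n: "n = sdeg ?s (Suc (length u + length w))"
      \<comment> \<open>\<open>cat\<close> takes the left word in reverse, which exchanges the parts
        before and after the varied letter.\<close>
      have nm: "n + m = sdeg ?s (Suc (length (rev w) + length (rev u))) + sdeg ?t (length (letters m v))"
        using n vs(4) by (simp add: add.commute)
      show "cl (n + m) (word_prod A L n m (u @ (x \<oplus>\<^bsub>B ?s\<^esub> y) # w) v) =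
          cl (n + m) (word_prod A L n m (u @ x # w) v) \<oplus>\<^bsub>G (n + m)\<^esub> cl (n + m) (word_prod A L n m (u @ y # w) v)"
        using cat_add_left[OF _ _ vs(2,1) *(3,4) nm] *
        by (subst (1 2 3) wp) (simp_all add: B_closed n[symmetric])
    next
      fix u x y w a assume *: "set u \<subseteq> carrier (B ?s)" "set w \<subseteq> carrier (B ?s)" "x \<in> carrier (B ?s)" "y \<in> carrier (B ?s)"
        and a: "a \<in> carrier A" and n: "n = sdeg ?s (Suc (Suc (length u + length w)))"
      have nm: "n + m = sdeg ?s (Suc (Suc (length (rev w) + length (rev u)))) + sdeg ?t (length (letters m v))"
        using n vs(4) by (simp add: add.commute)
      show "cl (n + m) (word_prod A L n m (u @ ract (B ?s) x a # y # w) v) =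
          cl (n + m) (word_prod A L n m (u @ x # lact (B ?s) a y # w) v)"
        using cat_balance_left[OF _ _ vs(2,1) *(3,4) a nm] * a
        by (subst (1 2) wp) (simp_all add: B_closed n[symmetric])
    qed (rule cl_closed[OF word_prod_closed[OF _ v]])
  qed
qed

lemma word_prod_balanced_right:
  assumes u: "u \<in> words (F n)"
  shows "balanced_map A (F m) (G (n + m)) (\<lambda>v. cl (n + m) (word_prod A L n m u v))"
proof -
  note us = words_F_split[OF u]
  have us': "set (rev (letters n u)) \<subseteq> carrier (B (n > 0))" using us by simp
  show ?thesis
  proof (cases "m = 0")
    case True
    have "balanced_map A (F 0) (G (n + 0)) (\<lambda>v. cl (n + 0) (word_prod A L n 0 u v))"
    proof (rule balanced_map_F_0)
      fix a assume a: "a \<in> carrier A"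
      then have w: "[Sca a] \<in> words (F 0)" by (simp add: words_F_0)
      show "cl (n + 0) (word_prod A L n 0 u [Sca a]) \<in> carrier (G (n + 0))"
        by (rule cl_closed[OF word_prod_closed[OF u w]])
      fix b assume b: "b \<in> carrier A"
      have wp: "word_prod A L n 0 u [Sca c] = cat (n > 0) False (rev (letters n u)) (scalar n u \<otimes>\<^bsub>A\<^esub> c) []"
        if "c \<in> carrier A" for c
        using word_prod_cat[of u n "[Sca c]" 0] u that
        by (simp add: words_F_0 letters_def[of 0] scalar_def[of 0])
      show "cl (n + 0) (word_prod A L n 0 u [Sca (a \<oplus>\<^bsub>A\<^esub> b)]) =
          cl (n + 0) (word_prod A L n 0 u [Sca a]) \<oplus>\<^bsub>G (n + 0)\<^esub> cl (n + 0) (word_prod A L n 0 u [Sca b])"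
        using a b us by (simp add: wp R.r_distr cat_add_scalar[where t = False])
    qed
    then show ?thesis by (simp add: True)
  next
    case False
    let ?s = "n > 0" and ?t = "m > 0"
    have wp: "word_prod A L n m u v = cat ?s ?t (rev (letters n u)) (scalar n u) v"
      if "set v \<subseteq> carrier (B ?t)" "m = sdeg ?t (length v)" for v
    proof -
      have "v \<in> words (F m)"
        using words_F_sdeg[of "length v" v ?t] that False by (metis sdeg_simps(1) list.size(3))
      then show ?thesis
        using word_prod_cat[of u n v m] u us False by (simp add: letters_def[of m] scalar_def[of m])
    qed
    show ?thesis
    proof (rule balanced_map_F[OF False refl])
      fix v x y w assume *: "set v \<subseteq> carrier (B ?t)" "set w \<subseteq> carrier (B ?t)" "x \<in> carrier (B ?t)" "y \<in> carrier (B ?t)"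
        and m: "m = sdeg ?t (Suc (length v + length w))"
      have nm: "n + m = sdeg ?s (length (rev (letters n u))) + sdeg ?t (Suc (length v + length w))"
        using m us(4) by simp
      show "cl (n + m) (word_prod A L n m u (v @ (x \<oplus>\<^bsub>B ?t\<^esub> y) # w)) =
          cl (n + m) (word_prod A L n m u (v @ x # w)) \<oplus>\<^bsub>G (n + m)\<^esub> cl (n + m) (word_prod A L n m u (v @ y # w))"
        using cat_add_right[OF us' *(1,2) us(1) *(3,4) nm] *
        by (subst (1 2 3) wp) (simp_all add: B_closed m[symmetric])
    next
      fix v x y w a assume *: "set v \<subseteq> carrier (B ?t)" "set w \<subseteq> carrier (B ?t)" "x \<in> carrier (B ?t)" "y \<in> carrier (B ?t)"
        and a: "a \<in> carrier A" and m: "m = sdeg ?t (Suc (Suc (length v + length w)))"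
      have nm: "n + m = sdeg ?s (length (rev (letters n u))) + sdeg ?t (Suc (Suc (length v + length w)))"
        using m us(4) by simp
      show "cl (n + m) (word_prod A L n m u (v @ ract (B ?t) x a # y # w)) =
          cl (n + m) (word_prod A L n m u (v @ x # lact (B ?t) a y # w))"
        using cat_balance_right[OF us' *(1,2) us(1) *(3,4) a nm] * a
        by (subst (1 2) wp) (simp_all add: B_closed m[symmetric])
    qed (rule cl_closed[OF word_prod_closed[OF u]])
  qed
qed

end

section \<open>The product of classes\<close>

text \<open>Additivity in the map itself, which yields additivity of a bilinear extension in its
  second argument.\<close>

lemma frag_extend_add_fun: "frag_extend (\<lambda>w. f w + g w) z = frag_extend f z + frag_extend g z"
  by (simp add: frag_extend_def frag_cmul_distrib2 sum.distrib)

context weak_line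
begin

definition frag_prod :: "int \<Rightarrow> int \<Rightarrow> (('a, 'm) letter list \<Rightarrow>\<^sub>0 int) \<Rightarrow> (('a, 'm) letter list \<Rightarrow>\<^sub>0 int) \<Rightarrow>
    (('a, 'm) letter list \<Rightarrow>\<^sub>0 int)" where
  "frag_prod n m x y = frag_extend (\<lambda>u. frag_extend (\<lambda>v. frag_of (word_prod A L n m u v)) y) x"

abbreviation "tc n \<equiv> tensor_class A (F n)"

lemma frag_prod_hom_left:
  assumes y: "Poly_Mapping.keys y \<subseteq> words (F m)"
  shows "(\<lambda>x. frag_prod n m x y) \<in> hom (F.FG n) (F.FG (n + m))"
  unfolding frag_prod_def
proof (rule frag_extend_hom)
  fix u assume u: "u \<in> words (F n)"
  have "frag_extend (\<lambda>v. frag_of (word_prod A L n m u v)) \<in> hom (F.FG m) (F.FG (n + m))"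
    by (rule frag_extend_hom) (use u word_prod_closed in auto)
  then show "Poly_Mapping.keys (frag_extend (\<lambda>v. frag_of (word_prod A L n m u v)) y) \<subseteq> words (F (n + m))"
    using hom_in_carrier[of _ "F.FG m" "F.FG (n + m)" y] y by simp
qed

lemma frag_prod_hom_right:
  assumes x: "Poly_Mapping.keys x \<subseteq> words (F n)"
  shows "(\<lambda>y. frag_prod n m x y) \<in> hom (F.FG m) (F.FG (n + m))"
proof (rule homI)
  fix y assume "y \<in> carrier (F.FG m)"
  then show "frag_prod n m x y \<in> carrier (F.FG (n + m))"
    using hom_in_carrier[OF frag_prod_hom_left[of y m n], of x] x by simp
qed (simp add: frag_prod_def frag_extend_add frag_extend_add_fun)

lemma tc_frag_prod_hom_left:
  assumes "Poly_Mapping.keys y \<subseteq> words (F m)"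
  shows "(\<lambda>x. tc (n + m) (frag_prod n m x y)) \<in> hom (F.FG n) (add_monoid (G (n + m)))"
  using Group.hom_compose[OF frag_prod_hom_left[OF assms, of n] F.tensor_class_hom]
  by (simp add: o_def L_pow_def)

lemma tc_frag_prod_hom_right:
  assumes "Poly_Mapping.keys x \<subseteq> words (F n)"
  shows "(\<lambda>y. tc (n + m) (frag_prod n m x y)) \<in> hom (F.FG m) (add_monoid (G (n + m)))"
  using Group.hom_compose[OF frag_prod_hom_right[OF assms, of m] F.tensor_class_hom]
  by (simp add: o_def L_pow_def)

lemma frag_prod_gen: "frag_prod n m (frag_of u) (frag_of v) = frag_of (word_prod A L n m u v)"
  by (simp add: frag_prod_def)

text \<open>Linearity in \<open>y\<close> reduces the claim to a single word on the right; for that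
  word the product is balanced in the left argument.\<close>

lemma tc_frag_prod_cong_left:
  assumes x: "Poly_Mapping.keys x \<subseteq> words (F n)" "Poly_Mapping.keys x' \<subseteq> words (F n)" "tc n x = tc n x'"
    and y: "Poly_Mapping.keys y \<subseteq> words (F m)"
  shows "tc (n + m) (frag_prod n m x y) = tc (n + m) (frag_prod n m x' y)"
proof (rule frag_hom_eqI[OF tc_frag_prod_hom_right[OF x(1)] tc_frag_prod_hom_right[OF x(2)] G_abelian _ y])
  fix v assume v: "v \<in> words (F m)"
  show "tc (n + m) (frag_prod n m x (frag_of v)) = tc (n + m) (frag_prod n m x' (frag_of v))"
  proof (rule F.balanced_hom_eq[OF tc_frag_prod_hom_left G_abelian _ x])
    show "balanced_map A (F n) (G (n + m)) (\<lambda>u. tc (n + m) (frag_prod n m (frag_of u) (frag_of v)))"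
      unfolding frag_prod_gen by (rule word_prod_balanced_left[OF v])
  qed (use v in simp)
qed

lemma tc_frag_prod_cong_right:
  assumes y: "Poly_Mapping.keys y \<subseteq> words (F m)" "Poly_Mapping.keys y' \<subseteq> words (F m)" "tc m y = tc m y'"
    and x: "Poly_Mapping.keys x \<subseteq> words (F n)"
  shows "tc (n + m) (frag_prod n m x y) = tc (n + m) (frag_prod n m x y')"
proof (rule frag_hom_eqI[OF tc_frag_prod_hom_left[OF y(1)] tc_frag_prod_hom_left[OF y(2)] G_abelian _ x])
  fix u assume u: "u \<in> words (F n)"
  show "tc (n + m) (frag_prod n m (frag_of u) y) = tc (n + m) (frag_prod n m (frag_of u) y')"
  proof (rule F.balanced_hom_eq[OF tc_frag_prod_hom_right G_abelian _ y])
    show "balanced_map A (F m) (G (n + m)) (\<lambda>v. tc (n + m) (frag_prod n m (frag_of u) (frag_of v)))"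
      unfolding frag_prod_gen by (rule word_prod_balanced_right[OF u])
  qed (use u in simp)
qed

abbreviation "mul \<equiv> pow_mult A L"

text \<open>The representatives are exchanged one at a time, the left one while \<open>y'\<close> is
  kept and then the right one while \<open>x\<close> is kept.\<close>

lemma mul_tc:
  assumes x: "Poly_Mapping.keys x \<subseteq> words (F n)" and y: "Poly_Mapping.keys y \<subseteq> words (F m)"
  shows "mul n m (tc n x) (tc m y) = tc (n + m) (frag_prod n m x y)"
proof -
  have "tc (n + m) (frag_prod n m x' y') = tc (n + m) (frag_prod n m x y)"
    if "x' \<in> tc n x" "y' \<in> tc m y" for x' y'
  proof -
    have x': "Poly_Mapping.keys x' \<subseteq> words (F n)" "tc n x' = tc n x"
      and y': "Poly_Mapping.keys y' \<subseteq> words (F m)" "tc m y' = tc m y"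
      using that F.mem_tensor_class_iff[OF x] F.mem_tensor_class_iff[OF y] by blast+
    show ?thesis
      using tc_frag_prod_cong_left[OF x'(1) x x'(2) y'(1)] tc_frag_prod_cong_right[OF y'(1) y y'(2) x]
      by (rule trans)
  qed
  moreover have "x \<in> tc n x" "y \<in> tc m y"
    unfolding F.mem_tensor_class_iff[OF x] F.mem_tensor_class_iff[OF y] using x y by blast+
  moreover have "mul n m (tc n x) (tc m y) = (\<Union>x'\<in>tc n x. \<Union>y'\<in>tc m y. tc (n + m) (frag_prod n m x' y'))"
    by (simp only: pow_mult_def frag_prod_def)
  ultimately show ?thesis by blast
qed

lemma G_carrier_iff: "P \<in> carrier (G n) \<longleftrightarrow> (\<exists>z. Poly_Mapping.keys z \<subseteq> words (F n) \<and> P = tc n z)"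
  unfolding L_pow_def by (rule F.tensor_carrier_iff)

lemmas G_induct [consumes 1, case_names zero gen diff] = F.tensor_induct[of _ n for n, folded L_pow_def]

lemma mul_closed:
  assumes "P \<in> carrier (G n)" "Q \<in> carrier (G m)"
  shows "mul n m P Q \<in> carrier (G (n + m))"
proof -
  obtain x y where "Poly_Mapping.keys x \<subseteq> words (F n)" "P = tc n x"
    and "Poly_Mapping.keys y \<subseteq> words (F m)" "Q = tc m y"
    using assms by (auto simp: G_carrier_iff)
  then show ?thesis
    using hom_in_carrier[OF tc_frag_prod_hom_left[of y m n], of x] by (simp add: mul_tc)
qed

lemma mul_diff_left:
  assumes "P \<in> carrier (G n)" "P' \<in> carrier (G n)" "Q \<in> carrier (G m)"
  shows "mul n m (P \<ominus>\<^bsub>G n\<^esub> P') Q = mul n m P Q \<ominus>\<^bsub>G (n + m)\<^esub> mul n m P' Q"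
proof -
  obtain x x' y where x: "Poly_Mapping.keys x \<subseteq> words (F n)" "P = tc n x"
    and x': "Poly_Mapping.keys x' \<subseteq> words (F n)" "P' = tc n x'"
    and y: "Poly_Mapping.keys y \<subseteq> words (F m)" "Q = tc m y"
    using assms by (auto simp: G_carrier_iff)
  have d: "Poly_Mapping.keys (x - x') \<subseteq> words (F n)"
    using keys_diff[of x x'] x x' by blast
  have "P \<ominus>\<^bsub>G n\<^esub> P' = tc n (x - x')"
    using x x' by (simp add: F.tensor_class_diff L_pow_def)
  then show ?thesis
    using x(1) x'(1) y(1) d
    by (simp add: x(2) x'(2) y(2) mul_tc frag_hom_diff[OF tc_frag_prod_hom_left G_abelian])
qed

lemma mul_diff_right:
  assumes "P \<in> carrier (G n)" "Q \<in> carrier (G m)" "Q' \<in> carrier (G m)"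
  shows "mul n m P (Q \<ominus>\<^bsub>G m\<^esub> Q') = mul n m P Q \<ominus>\<^bsub>G (n + m)\<^esub> mul n m P Q'"
proof -
  obtain x y y' where x: "Poly_Mapping.keys x \<subseteq> words (F n)" "P = tc n x"
    and y: "Poly_Mapping.keys y \<subseteq> words (F m)" "Q = tc m y"
    and y': "Poly_Mapping.keys y' \<subseteq> words (F m)" "Q' = tc m y'"
    using assms by (auto simp: G_carrier_iff)
  have d: "Poly_Mapping.keys (y - y') \<subseteq> words (F m)"
    using keys_diff[of y y'] y y' by blast
  have "Q \<ominus>\<^bsub>G m\<^esub> Q' = tc m (y - y')"
    using y y' by (simp add: F.tensor_class_diff L_pow_def)
  then show ?thesis
    using x(1) y(1) y'(1) d
    by (simp add: x(2) y(2) y'(2) mul_tc frag_hom_diff[OF tc_frag_prod_hom_right G_abelian])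
qed

lemma mul_add_left:
  assumes "P \<in> carrier (G n)" "P' \<in> carrier (G n)" "Q \<in> carrier (G m)"
  shows "mul n m (P \<oplus>\<^bsub>G n\<^esub> P') Q = mul n m P Q \<oplus>\<^bsub>G (n + m)\<^esub> mul n m P' Q"
proof -
  obtain x x' y where x: "Poly_Mapping.keys x \<subseteq> words (F n)" "P = tc n x"
    and x': "Poly_Mapping.keys x' \<subseteq> words (F n)" "P' = tc n x'"
    and y: "Poly_Mapping.keys y \<subseteq> words (F m)" "Q = tc m y"
    using assms by (auto simp: G_carrier_iff)
  have d: "Poly_Mapping.keys (x + x') \<subseteq> words (F n)"
    using keys_add[of x x'] x x' by blast
  have "P \<oplus>\<^bsub>G n\<^esub> P' = tc n (x + x')"
    using x x' by (simp add: F.tensor_class_add L_pow_def)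
  then show ?thesis
    using x(1) x'(1) y(1) d hom_mult[OF tc_frag_prod_hom_left[of y m n], of x x']
    by (simp add: x(2) x'(2) y(2) mul_tc)
qed

lemma mul_add_right:
  assumes "P \<in> carrier (G n)" "Q \<in> carrier (G m)" "Q' \<in> carrier (G m)"
  shows "mul n m P (Q \<oplus>\<^bsub>G m\<^esub> Q') = mul n m P Q \<oplus>\<^bsub>G (n + m)\<^esub> mul n m P Q'"
proof -
  obtain x y y' where x: "Poly_Mapping.keys x \<subseteq> words (F n)" "P = tc n x"
    and y: "Poly_Mapping.keys y \<subseteq> words (F m)" "Q = tc m y"
    and y': "Poly_Mapping.keys y' \<subseteq> words (F m)" "Q' = tc m y'"
    using assms by (auto simp: G_carrier_iff)
  have d: "Poly_Mapping.keys (y + y') \<subseteq> words (F m)"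
    using keys_add[of y y'] y y' by blast
  have "Q \<oplus>\<^bsub>G m\<^esub> Q' = tc m (y + y')"
    using y y' by (simp add: F.tensor_class_add L_pow_def)
  then show ?thesis
    using x(1) y(1) y'(1) d hom_mult[OF tc_frag_prod_hom_right[of x n m], of y y']
    by (simp add: x(2) y(2) y'(2) mul_tc)
qed

lemma mul_cl:
  "\<lbrakk>u \<in> words (F n); v \<in> words (F m)\<rbrakk> \<Longrightarrow> mul n m (cl n u) (cl m v) = cl (n + m) (word_prod A L n m u v)"
  by (simp add: mul_tc frag_prod_gen)

lemma G_zero_closed: "\<zero>\<^bsub>G n\<^esub> \<in> carrier (G n)"
  using G_abelian[of n] by (simp add: abelian_group_def abelian_monoid.zero_closed)

lemma G_diff_self: "P \<in> carrier (G n) \<Longrightarrow> P \<ominus>\<^bsub>G n\<^esub> P = \<zero>\<^bsub>G n\<^esub>"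
  using G_abelian[of n] by (simp add: abelian_group.minus_eq abelian_group.r_neg)

lemma mul_zero_left: "Q \<in> carrier (G m) \<Longrightarrow> mul n m \<zero>\<^bsub>G n\<^esub> Q = \<zero>\<^bsub>G (n + m)\<^esub>"
  using mul_diff_left[of "\<zero>\<^bsub>G n\<^esub>" n "\<zero>\<^bsub>G n\<^esub>" Q m] by (simp add: G_zero_closed G_diff_self mul_closed)

lemma mul_zero_right: "P \<in> carrier (G n) \<Longrightarrow> mul n m P \<zero>\<^bsub>G m\<^esub> = \<zero>\<^bsub>G (n + m)\<^esub>"
  using mul_diff_right[of P n "\<zero>\<^bsub>G m\<^esub>" m "\<zero>\<^bsub>G m\<^esub>"] by (simp add: G_zero_closed G_diff_self mul_closed)

section \<open>Associativity\<close>

text \<open>\<open>s\<close> is consulted only through a left letter and \<open>t\<close> only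
  through a right letter. This matters because a degree that drops to 0 gets the sign
  \<open>False\<close>, whatever sign it came from.\<close>

lemma cat_sign: "cat s t [] a v = cat s' t [] a v" "cat s t r a [] = cat s t' r a []"
  by (cases v, simp_all) (cases r, simp_all)

lemma cat_one: "\<lbrakk>set u \<subseteq> carrier (B s); u \<noteq> []\<rbrakk> \<Longrightarrow> cat s t (rev u) \<one>\<^bsub>A\<^esub> [] = u"
  by (cases u rule: rev_cases) (simp_all add: B_ract_one)

lemma word_prod_cat_left:
  assumes r: "set r \<subseteq> carrier (B s)" and c: "c \<in> carrier A" and w: "w \<in> words (F k)"
    and n: "n = sdeg s (length r)"
  shows "word_prod A L n k (cat s t r c []) w = cat s (k > 0) r (c \<otimes>\<^bsub>A\<^esub> scalar k w) (letters k w)"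
proof -
  have "cat s t r c [] \<in> words (F n)"
    using cat_words[of r s "[]" t c] r c n by simp
  note wp = word_prod_cat[OF this w]
  note ws = words_F_split[OF w]
  show ?thesis
  proof (cases r)
    case Nil
    then show ?thesis
      using wp n by (simp add: letters_def[of 0] scalar_def[of 0] cat_sign(1)[of s _ _ _ False])
  next
    case (Cons x r')
    then have "n \<noteq> 0" "(n > 0) = s" using n by (simp_all add: sdeg_pos)
    then show ?thesis
      using wp Cons r c ws by (simp add: letters_def[of n] scalar_def[of n] cat_ract)
  qed
qed

text \<open>In contrast to \<open>word_prod_cat_left\<close>, only classes agree: the scalar
  \<open>c\<close> starts on the first letter of \<open>v\<close> and has to move into the
  accumulated scalar, which by \<open>cat_lact\<close> may cross a tensor sign.\<close>

lemma word_prod_cat_right: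
  assumes v: "set v \<subseteq> carrier (B t)" and c: "c \<in> carrier A" and u: "u \<in> words (F n)"
    and m: "m = sdeg t (length v)"
  shows "cl (n + m) (word_prod A L n m u (cat s t [] c v)) =
    cl (n + m) (cat (n > 0) t (rev (letters n u)) (scalar n u \<otimes>\<^bsub>A\<^esub> c) v)"
proof -
  have "cat s t [] c v \<in> words (F m)"
    using cat_words[of "[]" s v t c] v c m by simp
  note wp = word_prod_cat[OF u this]
  note us = words_F_split[OF u]
  show ?thesis
  proof (cases v)
    case Nil
    then show ?thesis
      using wp m by (simp add: letters_def[of 0] scalar_def[of 0] cat_sign(2)[of _ t _ _ False])
  next
    case (Cons y v')
    then have mt: "m \<noteq> 0" "(m > 0) = t" using m by (simp_all add: sdeg_pos)
    have "cl (n + m) (cat (n > 0) t (rev (letters n u)) (scalar n u) (lact (B t) c y # v')) =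
      cl (n + m) (cat (n > 0) t (rev (letters n u)) (scalar n u \<otimes>\<^bsub>A\<^esub> c) (y # v'))"
      by (rule cat_lact) (use us v c m Cons in simp_all)
    then show ?thesis
      using wp Cons us mt by (simp add: letters_def[of m] scalar_def[of m])
  qed
qed

lemma word_prod_letters_left:
  assumes u: "set u \<subseteq> carrier (B s)" "u \<noteq> []" and w: "w \<in> words (F k)" and n: "n = sdeg s (length u)"
  shows "word_prod A L n k u w = cat s (k > 0) (rev u) (scalar k w) (letters k w)"
  using word_prod_cat_left[of "rev u" s "\<one>\<^bsub>A\<^esub>" w k n True] words_F_split(1)[OF w] assms by (simp add: cat_one)

lemma word_prod_letters_right:
  assumes v: "set v \<subseteq> carrier (B t)" "v \<noteq> []" and u: "u \<in> words (F n)" and m: "m = sdeg t (length v)"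
  shows "word_prod A L n m u v = cat (n > 0) t (rev (letters n u)) (scalar n u) v"
proof -
  have "v \<in> words (F m)" "m \<noteq> 0" "(m > 0) = t"
    using v words_F_sdeg[of "length v" v t] by (simp_all add: m sdeg_pos)
  then show ?thesis
    using word_prod_cat[OF u, of v m] words_F_split(1)[OF u] by (simp add: letters_def[of m] scalar_def[of m])
qed

lemma zigzag_opp:
  "\<lbrakk>x \<in> carrier (B s); y \<in> carrier (B t); z \<in> carrier (B s); s \<noteq> t\<rbrakk> \<Longrightarrow>
    ract (B s) x (pair t y z) = lact (B s) (pair s x y) z"
  using zigzag[of x s y z] by (cases t; cases s; simp)

text \<open>The cases are the possible neighbours of \<open>y\<close>: the last letter of
  \<open>u\<close>, which heads \<open>ru\<close>, and the first letter of \<open>w\<close>, which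
  heads \<open>v\<close>. Each is absent, of the sign of \<open>y\<close>, or of the opposite
  sign.\<close>

lemma word_prod_assoc_letter:
  assumes u: "u \<in> words (F n)" and w: "w \<in> words (F k)" and y: "y \<in> carrier (B t)" and m: "m = sdeg t 1"
  shows "cl (n + m + k) (word_prod A L (n + m) k (word_prod A L n m u [y]) w) =
    cl (n + m + k) (word_prod A L n (m + k) u (word_prod A L m k [y] w))"
proof -
  define s where "s = (n > 0)"
  define r where "r = (k > 0)"
  define ru where "ru = rev (letters n u)"
  define v where "v = letters k w"
  define a where "a = scalar n u"
  define b where "b = scalar k w"
  note us = words_F_split[OF u] and ws = words_F_split[OF w]
  have ru: "set ru \<subseteq> carrier (B s)" "n = sdeg s (length ru)" and a: "a \<in> carrier A"
    using us by (simp_all add: ru_def s_def a_def)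
  have v: "set v \<subseteq> carrier (B r)" "k = sdeg r (length v)" and b: "b \<in> carrier A"
    using ws by (simp_all add: v_def r_def b_def)
  have left: "word_prod A L n m u [y] = cat s t ru a [y]"
    using word_prod_letters_right[of "[y]" t u n m] u y m by (simp add: s_def ru_def a_def)
  have right: "word_prod A L m k [y] w = cat t r [y] b v"
    using word_prod_letters_left[of "[y]" t w k m] w y m by (simp add: r_def v_def b_def)
  have L1: "word_prod A L N k Z w = cat s' r (rev Z) b v"
    if "set Z \<subseteq> carrier (B s')" "Z \<noteq> []" "N = sdeg s' (length Z)" for N Z s'
    using word_prod_letters_left[OF that(1,2) w that(3)] by (simp add: r_def v_def b_def)
  have L2: "word_prod A L N k (cat s' t' q c []) w = cat s' r q (c \<otimes>\<^bsub>A\<^esub> b) v"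
    if "set q \<subseteq> carrier (B s')" "c \<in> carrier A" "N = sdeg s' (length q)" for N q c s' t'
    using word_prod_cat_left[OF that(1,2) w that(3)] by (simp add: r_def v_def b_def)
  have R1: "word_prod A L n M u Y = cat s t' ru a Y"
    if "set Y \<subseteq> carrier (B t')" "Y \<noteq> []" "M = sdeg t' (length Y)" for M Y t'
    using word_prod_letters_right[OF that(1,2) u that(3)] by (simp add: s_def ru_def a_def)
  have R2: "cl (n + M) (word_prod A L n M u (cat s' t' [] c q)) = cl (n + M) (cat s t' ru (a \<otimes>\<^bsub>A\<^esub> c) q)"
    if "set q \<subseteq> carrier (B t')" "c \<in> carrier A" "M = sdeg t' (length q)" for M q c s' t'
    using word_prod_cat_right[OF that(1,2) u that(3)] by (simp add: s_def ru_def a_def)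
  consider (unit) "ru = []" | (same) x r' where "ru = x # r'" "s = t" | (opp) x r' where "ru = x # r'" "s \<noteq> t"
    by (cases ru) auto
  \<comment> \<open>One formula for all left neighbours, which serves every case of the right
    neighbour below.\<close>
  then have lhs: "word_prod A L (n + m) k (cat s t ru a [y]) w =
      (case ru of [] \<Rightarrow> cat t r [lact (B t) a y] b v
       | x # r' \<Rightarrow> if s = t then cat t r (y # ract (B t) x a # r') b v
          else cat s r r' (pair s (ract (B s) x a) y \<otimes>\<^bsub>A\<^esub> b) v)"
  proof cases
    case unit
    then show ?thesis
      using L1[of "[lact (B t) a y]" t "n + m"] ru y a m by (simp add: B_closed)
  next
    case same
    then show ?thesis
      using L1[of "rev r' @ [ract (B t) x a, y]" t "n + m"] ru y a m by (simp add: B_closed)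
  next
    case opp
    have "pair s (ract (B s) x a) y \<in> carrier A"
      using opp ru y a by (intro pair_closed'[OF _ y]) (simp_all add: B_closed)
    moreover have "cat s t ru a [y] = cat s t r' (pair s (ract (B s) x a) y) []" using opp by simp
    moreover have "n + m = sdeg s (length r')"
      using opp m ru sdeg_simps(4)[of s t "length r'" 0] by simp
    ultimately show ?thesis
      using L2[of r' s "pair s (ract (B s) x a) y" "n + m" t] opp ru by simp
  qed
  show ?thesis
  proof (cases "v = [] \<or> t = r")
    case True
    \<comment> \<open>\<open>y\<close> is not paired to the right, so it stays in front of
      \<open>v\<close> with the scalar \<open>b\<close> attached; both bracketings then give
      literally the same word.\<close>
    have Y: "cat t r [y] b v = ract (B t) y b # v"
      using True by (cases v) auto
    have set_Y: "set (ract (B t) y b # v) \<subseteq> carrier (B t)" and mk: "m + k = sdeg t (length (ract (B t) y b # v))"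
      using True v y b m by (auto simp: B_closed)
    have "word_prod A L n (m + k) u (cat t r [y] b v) = cat s t ru a (ract (B t) y b # v)"
      unfolding Y by (rule R1[OF set_Y _ mk]) simp
    moreover have "cat s t ru a (ract (B t) y b # v) = word_prod A L (n + m) k (cat s t ru a [y]) w"
    proof (cases ru)
      case Nil
      then show ?thesis
        using lhs True a b y by (cases v) (auto simp: B_lact_ract)
    next
      case (Cons x r')
      show ?thesis
      proof (cases "s = t")
        case st: True
        then show ?thesis
          using lhs True Cons by (cases v) auto
      next
        case st: False
        have xa: "ract (B s) x a \<in> carrier (B s)" using Cons ru a by (simp add: B_closed)
        have "pair s (ract (B s) x a) (ract (B t) y b) = pair s (ract (B s) x a) y \<otimes>\<^bsub>A\<^esub> b"
          by (rule pair_ract_opp[OF b xa y st])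
        then have "cat s t ru a (ract (B t) y b # v) = cat s t r' (pair s (ract (B s) x a) y \<otimes>\<^bsub>A\<^esub> b) v"
          using Cons st by simp
        also have "\<dots> = cat s r r' (pair s (ract (B s) x a) y \<otimes>\<^bsub>A\<^esub> b) v"
          using True cat_sign(2)[of s t r' _ r] by (cases "t = r") simp_all
        finally show ?thesis
          using lhs Cons st by simp
      qed
    qed
    ultimately show ?thesis by (simp add: left right)
  next
    case False
    then obtain z v' where vz: "v = z # v'" and tr: "t \<noteq> r" by (cases v) auto
    have z: "z \<in> carrier (B r)" and v': "set v' \<subseteq> carrier (B r)" using v vz by auto
    \<comment> \<open>The scalar left by cancelling \<open>y\<close> against its right neighbour
      \<open>z\<close>.\<close>
    define d where "d = pair t (ract (B t) y b) z"
    have yb: "ract (B t) y b \<in> carrier (B t)" using y b by (simp add: B_closed)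
    have d: "d \<in> carrier A" unfolding d_def by (rule pair_closed'[OF yb z tr])
    have mk: "m + k = sdeg r (length v')"
      using m v vz sdeg_simps(4)[OF tr, of 0 "length v'"] by simp
    have "cat t r [y] b v = cat t r [] d v'" using tr by (simp add: vz d_def)
    then have rhs: "cl (n + m + k) (word_prod A L n (m + k) u (cat t r [y] b v)) =
        cl (n + m + k) (cat s r ru (a \<otimes>\<^bsub>A\<^esub> d) v')"
      using R2[OF v' d mk] by (simp add: add.assoc)
    have "cl (n + m + k) (word_prod A L (n + m) k (cat s t ru a [y]) w) =
        cl (n + m + k) (cat s r ru (a \<otimes>\<^bsub>A\<^esub> d) v')"
    proof (cases ru)
      case Nil
      have "pair t (ract (B t) (lact (B t) a y) b) z = a \<otimes>\<^bsub>A\<^esub> d"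
        unfolding d_def using pair_lact_opp[OF a yb z tr] a b y by (simp add: B_lact_ract)
      then have "cat t r [lact (B t) a y] b v = cat s r [] (a \<otimes>\<^bsub>A\<^esub> d) v'"
        using tr cat_sign(1)[of t r "a \<otimes>\<^bsub>A\<^esub> d" v' s] by (simp add: vz)
      then show ?thesis using lhs Nil by simp
    next
      case (Cons x r')
      have x: "x \<in> carrier (B s)" and r': "set r' \<subseteq> carrier (B s)" using Cons ru by auto
      show ?thesis
      proof (cases "s = t")
        case True
        then have "cat t r (y # ract (B t) x a # r') b v = cat t r (ract (B t) x a # r') d v'"
          using tr by (simp add: vz d_def)
        also have "\<dots> = cat t r (x # r') (a \<otimes>\<^bsub>A\<^esub> d) v'"
          using x a d True by (intro cat_ract) simp_all
        finally show ?thesis using lhs Cons True by simp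
      next
        case st: False
        \<comment> \<open>Both neighbours of \<open>y\<close> can be paired with it: one bracketing
          cancels \<open>y\<close> with \<open>x\<close> and keeps \<open>z\<close>, the other
          cancels it with \<open>z\<close> and keeps \<open>x\<close>.\<close>
        then have sr: "r = s" using tr by auto
        define c where "c = pair s (ract (B s) x a) y \<otimes>\<^bsub>A\<^esub> b"
        have xa: "ract (B s) x a \<in> carrier (B s)" using x a by (simp add: B_closed)
        have c': "c = pair s (ract (B s) x a) (ract (B t) y b)"
          unfolding c_def by (rule pair_ract_opp[OF b xa y st, symmetric])
        have c: "c \<in> carrier A" unfolding c' by (rule pair_closed'[OF xa yb st])
        have zs: "z \<in> carrier (B s)" using z sr by simp
        have zz: "ract (B s) x (a \<otimes>\<^bsub>A\<^esub> d) = lact (B s) c z"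
          unfolding c' d_def using zigzag_opp[OF xa yb zs st] x a d by (simp add: B_ract_mult d_def)
        have "cat s r ru (a \<otimes>\<^bsub>A\<^esub> d) v' = rev r' @ lact (B s) c z # v'"
          using Cons sr zz by (cases v') simp_all
        \<comment> \<open>What remains is the place of the scalar \<open>c\<close>: it sits on the
          letter before \<open>z\<close>, if there is one, and is moved onto
          \<open>z\<close>.\<close>
        moreover have "cl (n + m + k) (cat s r r' c v) = cl (n + m + k) (rev r' @ lact (B s) c z # v')"
        proof (cases r')
          case Nil
          then show ?thesis by (simp add: vz sr)
        next
          case r'': (Cons x' r'')
          have nmk: "n + m + k = sdeg s (Suc (Suc (length (rev r'') + length v')))"
            unfolding add.assoc mk using ru(2) Cons r'' by (simp add: sr)
          have "cl (n + m + k) (rev r'' @ ract (B s) x' c # z # v') = cl (n + m + k) (rev r'' @ x' # lact (B s) c z # v')"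
            by (rule cl_balance[OF _ _ _ zs c nmk]) (use r' r'' v' sr in simp_all)
          then show ?thesis by (simp add: r'' vz sr)
        qed
        ultimately show ?thesis using lhs Cons st by (simp add: c_def)
      qed
    qed
    with rhs show ?thesis by (simp add: left right)
  qed
qed

text \<open>The scalars of \<open>u\<close>, of the middle factor and of \<open>w\<close> meet in
  one accumulated scalar, so this is associativity in \<open>A\<close>.\<close>

lemma word_prod_assoc_scalar:
  assumes u: "u \<in> words (F n)" and w: "w \<in> words (F k)" and c: "c \<in> carrier A"
  shows "cl (n + k) (word_prod A L n k (word_prod A L n 0 u [Sca c]) w) =
    cl (n + k) (word_prod A L n k u (word_prod A L 0 k [Sca c] w))"
proof -
  note us = words_F_split[OF u] and ws = words_F_split[OF w]
  have w0: "[Sca c] \<in> words (F 0)" using c by (simp add: words_F_0)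
  have 1: "word_prod A L n 0 u [Sca c] = cat (n > 0) False (rev (letters n u)) (scalar n u \<otimes>\<^bsub>A\<^esub> c) []"
    using word_prod_cat[OF u w0] by (simp add: letters_def[of 0] scalar_def[of 0])
  have 2: "word_prod A L 0 k [Sca c] w = cat False (k > 0) [] (c \<otimes>\<^bsub>A\<^esub> scalar k w) (letters k w)"
    using word_prod_cat[OF w0 w] by (simp add: letters_def[of 0] scalar_def[of 0])
  have "word_prod A L n k (word_prod A L n 0 u [Sca c]) w =
      cat (n > 0) (k > 0) (rev (letters n u)) (scalar n u \<otimes>\<^bsub>A\<^esub> c \<otimes>\<^bsub>A\<^esub> scalar k w) (letters k w)"
    unfolding 1 by (rule word_prod_cat_left) (use us c w in simp_all)
  moreover have "cl (n + k) (word_prod A L n k u (word_prod A L 0 k [Sca c] w)) =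
      cl (n + k) (cat (n > 0) (k > 0) (rev (letters n u)) (scalar n u \<otimes>\<^bsub>A\<^esub> (c \<otimes>\<^bsub>A\<^esub> scalar k w)) (letters k w))"
    unfolding 2 by (rule word_prod_cat_right) (use ws c u in simp_all)
  ultimately show ?thesis
    using us ws c by (simp add: R.m_assoc)
qed

section \<open>The middle nucleus of the graded product\<close>

definition middle_nucleus :: "int \<Rightarrow> (('a, 'm) letter list \<Rightarrow>\<^sub>0 int) set set" where
  "middle_nucleus m = {Q \<in> carrier (G m). \<forall>n k. \<forall>P\<in>carrier (G n). \<forall>R\<in>carrier (G k).
     mul (n + m) k (mul n m P Q) R = mul n (m + k) P (mul m k Q R)}"

lemma middle_nucleus_diff:
  assumes "Q \<in> middle_nucleus m" "Q' \<in> middle_nucleus m"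
  shows "Q \<ominus>\<^bsub>G m\<^esub> Q' \<in> middle_nucleus m"
  using assms G_abelian[of m] unfolding middle_nucleus_def
  by (simp add: mul_diff_left mul_diff_right mul_closed abelian_group.minus_closed add.assoc[symmetric])

text \<open>(P(QQ'))R = ((PQ)Q')R = (PQ)(Q'R) = P(Q(Q'R)) = P((QQ')R): each rebracketing has
  \<open>Q\<close> or \<open>Q'\<close> in the middle. The degrees are rebracketed along with the
  products.\<close>

lemma middle_nucleus_mul:
  assumes Q: "Q \<in> middle_nucleus m" and Q': "Q' \<in> middle_nucleus m'"
  shows "mul m m' Q Q' \<in> middle_nucleus (m + m')"
proof -
  have QQ: "Q \<in> carrier (G m)" "Q' \<in> carrier (G m')"
    using assms by (simp_all add: middle_nucleus_def)
  have q: "mul (n + m) k (mul n m P Q) R = mul n (m + k) P (mul m k Q R)"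
    if "P \<in> carrier (G n)" "R \<in> carrier (G k)" for n k P R
    using Q that by (simp add: middle_nucleus_def)
  have q': "mul (n + m') k (mul n m' P Q') R = mul n (m' + k) P (mul m' k Q' R)"
    if "P \<in> carrier (G n)" "R \<in> carrier (G k)" for n k P R
    using Q' that by (simp add: middle_nucleus_def)
  have "mul (n + (m + m')) k (mul n (m + m') P (mul m m' Q Q')) R =
      mul n (m + m' + k) P (mul (m + m') k (mul m m' Q Q') R)"
    if P: "P \<in> carrier (G n)" and R: "R \<in> carrier (G k)" for n k P R
  proof -
    have "mul (n + (m + m')) k (mul n (m + m') P (mul m m' Q Q')) R =
        mul (n + m + m') k (mul (n + m) m' (mul n m P Q) Q') R"
      using q[OF P QQ(2)] by (simp add: add.assoc)
    also have "\<dots> = mul (n + m) (m' + k) (mul n m P Q) (mul m' k Q' R)"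
      by (rule q'[OF mul_closed[OF P QQ(1)] R])
    also have "\<dots> = mul n (m + (m' + k)) P (mul m (m' + k) Q (mul m' k Q' R))"
      by (rule q[OF P mul_closed[OF QQ(2) R]])
    also have "mul m (m' + k) Q (mul m' k Q' R) = mul (m + m') k (mul m m' Q Q') R"
      by (rule q'[OF QQ(1) R, symmetric])
    finally show ?thesis by (simp add: add.assoc)
  qed
  then show ?thesis
    using mul_closed[OF QQ] by (simp add: middle_nucleus_def)
qed

text \<open>Both sides are additive in \<open>P\<close> and in \<open>R\<close>; \<open>P\<close> is
  reduced to a word while the right factor is a word, and then \<open>R\<close> is reduced for
  arbitrary \<open>P\<close>.\<close>

lemma middle_nucleus_gen:
  assumes v: "v \<in> words (F m)"
    and assoc: "\<And>n k u w. \<lbrakk>u \<in> words (F n); w \<in> words (F k)\<rbrakk> \<Longrightarrow>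
      cl (n + m + k) (word_prod A L (n + m) k (word_prod A L n m u v) w) =
      cl (n + m + k) (word_prod A L n (m + k) u (word_prod A L m k v w))"
  shows "cl m v \<in> middle_nucleus m"
proof -
  have V: "cl m v \<in> carrier (G m)" by (rule cl_closed[OF v])
  have gen_assoc: "mul (n + m) k (mul n m P (cl m v)) (cl k w) = mul n (m + k) P (mul m k (cl m v) (cl k w))"
    if P: "P \<in> carrier (G n)" and w: "w \<in> words (F k)" for n k P w
    using P
  proof (induction rule: G_induct)
    case zero
    show ?case
      using w V by (simp add: mul_zero_left mul_closed cl_closed add.assoc)
  next
    case (gen u)
    then show ?case
      using assoc[OF gen w] v w by (simp add: mul_cl word_prod_closed add.assoc)
  next
    case (diff P P')
    then show ?case
      using w V by (simp add: mul_diff_left mul_closed cl_closed add.assoc)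
  qed
  have "mul (n + m) k (mul n m P (cl m v)) R = mul n (m + k) P (mul m k (cl m v) R)"
    if P: "P \<in> carrier (G n)" and R: "R \<in> carrier (G k)" for n k P R
    using R
  proof (induction rule: G_induct)
    case zero
    show ?case
      using P V by (simp add: mul_zero_right mul_closed add.assoc)
  next
    case (gen w)
    then show ?case using \<open>P \<in> carrier (G n)\<close> by (intro gen_assoc)
  next
    case (diff R R')
    then show ?case
      using P V by (simp add: mul_diff_right mul_closed add.assoc)
  qed
  then show ?thesis
    using V by (simp add: middle_nucleus_def)
qed

text \<open>A word is its first letter times the remaining word, so closure under products leads
  from single letters to all nonempty words.\<close>

lemma middle_nucleus_letters:
  assumes "set v \<subseteq> carrier (B t)" "v \<noteq> []"
  shows "cl (sdeg t (length v)) v \<in> middle_nucleus (sdeg t (length v))"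
  using assms
proof (induction v)
  case (Cons y v)
  have y: "y \<in> carrier (B t)" using Cons.prems by simp
  have wy: "[y] \<in> words (F (sdeg t 1))" using y words_F_sdeg[of 1 "[y]" t] by simp
  have Y: "cl (sdeg t 1) [y] \<in> middle_nucleus (sdeg t 1)"
    by (rule middle_nucleus_gen[OF wy]) (rule word_prod_assoc_letter[OF _ _ y refl])
  show ?case
  proof (cases "v = []")
    case True
    then show ?thesis using Y by simp
  next
    case False
    have V: "cl (sdeg t (length v)) v \<in> middle_nucleus (sdeg t (length v))"
      using Cons False by simp
    have wv: "v \<in> words (F (sdeg t (length v)))"
      using Cons.prems False by (simp add: words_F_sdeg)
    have "word_prod A L (sdeg t 1) (sdeg t (length v)) [y] v = y # v"
      using word_prod_letters_left[of "[y]" t v "sdeg t (length v)" "sdeg t 1"] y wv False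
      by (cases v) (simp_all add: sdeg_pos letters_def scalar_def B_ract_one)
    then show ?thesis
      using middle_nucleus_mul[OF Y V] mul_cl[OF wy wv] by simp
  qed
qed simp

lemma middle_nucleus_all: "P \<in> carrier (G m) \<Longrightarrow> P \<in> middle_nucleus m"
proof (induction rule: G_induct)
  case zero
  show ?case
    by (simp add: middle_nucleus_def G_zero_closed mul_zero_left mul_zero_right add.assoc)
next
  case (gen v)
  show ?case
  proof (cases "m = 0")
    case True
    then obtain c where v: "v = [Sca c]" and c: "c \<in> carrier A"
      using gen by (auto simp: words_F_0)
    have "cl 0 [Sca c] \<in> middle_nucleus 0"
    proof (rule middle_nucleus_gen)
      show "[Sca c] \<in> words (F 0)" using c by (simp add: words_F_0)
    qed (use word_prod_assoc_scalar[OF _ _ c] in simp)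
    then show ?thesis using v True by simp
  next
    case False
    then have "letters m v = v" by (simp add: letters_def)
    then show ?thesis
      using words_F_split[OF gen] middle_nucleus_letters[of v "m > 0"] False by force
  qed
next
  case (diff P Q)
  then show ?case by (intro middle_nucleus_diff)
qed

lemma mul_assoc:
  "\<lbrakk>P \<in> carrier (G n); Q \<in> carrier (G m); R \<in> carrier (G k)\<rbrakk> \<Longrightarrow>
    mul (n + m) k (mul n m P Q) R = mul n (m + k) P (mul m k Q R)"
  using middle_nucleus_all[of Q m] by (simp add: middle_nucleus_def)

section \<open>The unit and the complex scalars of degree 0\<close>

lemma mul_unit_left:
  assumes "P \<in> carrier (G n)" shows "mul 0 n (cl 0 [Sca \<one>\<^bsub>A\<^esub>]) P = P"
proof -
  have w1: "[Sca \<one>\<^bsub>A\<^esub>] \<in> words (F 0)" by (simp add: words_F_0)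
  from assms show ?thesis
  proof (induction rule: G_induct)
    case zero
    show ?case using mul_zero_right[OF cl_closed[OF w1], of n] by simp
  next
    case (gen w)
    note ws = words_F_split[OF gen]
    have "word_prod A L 0 n [Sca \<one>\<^bsub>A\<^esub>] w = w"
    proof (cases "n = 0")
      case True
      then show ?thesis
        using word_prod_cat[OF w1 gen] gen by (auto simp: letters_def scalar_def words_F_0)
    next
      case False
      then have "w \<noteq> []" using ws by (auto simp: letters_def)
      then show ?thesis
        using word_prod_cat[OF w1 gen] ws False
        by (cases w) (simp_all add: letters_def scalar_def B_lact_one)
    qed
    then show ?case using mul_cl[OF w1 gen] by simp
  next
    case (diff P Q)
    then show ?case using mul_diff_right[OF cl_closed[OF w1], of P n Q] by simp
  qed
qed

text \<open>Scalars pass from the right to the left end of a word one letter at a time.\<close>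

lemma mul_scalar_central:
  assumes "P \<in> carrier (G n)"
  shows "mul 0 n (cl 0 [Sca (c \<odot>\<^bsub>A\<^esub> \<one>\<^bsub>A\<^esub>)]) P = mul n 0 P (cl 0 [Sca (c \<odot>\<^bsub>A\<^esub> \<one>\<^bsub>A\<^esub>)])"
proof -
  let ?c = "c \<odot>\<^bsub>A\<^esub> \<one>\<^bsub>A\<^esub>"
  have c: "?c \<in> carrier A" by (rule complex_algebra.scalar_closed[OF complex_algebra])
  have wc: "[Sca ?c] \<in> words (F 0)" using c by (simp add: words_F_0)
  have shift: "cl m (u @ lact (B s) ?c x # v) = cl m (cat s True (rev (u @ x # v)) ?c [])"
    if "set u \<subseteq> carrier (B s)" "x \<in> carrier (B s)" "set v \<subseteq> carrier (B s)" "m = sdeg s (Suc (length u + length v))"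
    for s u x v m
    using that
  proof (induction v arbitrary: u x)
    case Nil
    then show ?case by (simp add: B_central)
  next
    case (Cons y v)
    have "cl m (u @ lact (B s) ?c x # y # v) = cl m (u @ ract (B s) x ?c # y # v)"
      using Cons.prems by (simp add: B_central)
    also have "\<dots> = cl m (u @ x # lact (B s) ?c y # v)"
      by (rule cl_balance) (use Cons.prems c in simp_all)
    also have "\<dots> = cl m (cat s True (rev ((u @ [x]) @ y # v)) ?c [])"
      using Cons.IH[of "u @ [x]" y] Cons.prems by simp
    finally show ?case by simp
  qed
  from assms show ?thesis
  proof (induction rule: G_induct)
    case zero
    show ?case using mul_zero_right[OF cl_closed[OF wc], of n] mul_zero_left[OF cl_closed[OF wc], of n] by simp
  next
    case (gen w)
    note ws = words_F_split[OF gen]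
    have "cl n (word_prod A L 0 n [Sca ?c] w) = cl n (word_prod A L n 0 w [Sca ?c])"
    proof (cases "n = 0")
      case True
      then show ?thesis
        using word_prod_cat[OF wc gen] word_prod_cat[OF gen wc] gen
          complex_algebra.scalar_central[OF complex_algebra]
        by (auto simp: letters_def scalar_def words_F_0)
    next
      case False
      then obtain x v where w: "w = x # v" using ws by (cases w) (auto simp: letters_def)
      have "cl n ([] @ lact (B (n > 0)) ?c x # v) = cl n (cat (n > 0) True (rev ([] @ x # v)) ?c [])"
        by (rule shift) (use ws w False in \<open>simp_all add: letters_def\<close>)
      then show ?thesis
        using word_prod_cat[OF wc gen] word_prod_cat[OF gen wc] c w False
        by (simp add: letters_def scalar_def cat_sign(2)[of _ True _ _ False])
    qed
    then show ?case using mul_cl[OF wc gen] mul_cl[OF gen wc] by simp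
  next
    case (diff P Q)
    then show ?case
      using mul_diff_right[OF cl_closed[OF wc], of P n Q] mul_diff_left[OF _ _ cl_closed[OF wc], of P n Q] by simp
  qed
qed

end

section \<open>Direct sums of graded pieces\<close>

lemma (in abelian_monoid) finsum_mono_neutral:
  assumes "finite T" "S \<subseteq> T" "\<And>i. i \<in> T - S \<Longrightarrow> f i = \<zero>" "f \<in> T \<rightarrow> carrier G"
  shows "finsum G f S = finsum G f T"
  using add.finprod_mono_neutral_cong_left[of T S f f] assms by (simp add: finsum_def)

lemma (in abelian_monoid) finsum_swap:
  assumes "finite S" "finite T" "\<And>i j. \<lbrakk>i \<in> S; j \<in> T\<rbrakk> \<Longrightarrow> f i j \<in> carrier G"
  shows "(\<Oplus>i\<in>S. \<Oplus>j\<in>T. f i j) = (\<Oplus>j\<in>T. \<Oplus>i\<in>S. f i j)"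
  using assms(1,3)
proof (induction S rule: finite_induct)
  case empty
  then show ?case by simp
next
  case (insert i S)
  have "(\<Oplus>i\<in>insert i S. \<Oplus>j\<in>T. f i j) = (\<Oplus>j\<in>T. f i j) \<oplus> (\<Oplus>j\<in>T. \<Oplus>i\<in>S. f i j)"
    using insert by (subst finsum_insert) (auto intro!: finsum_closed)
  also have "\<dots> = (\<Oplus>j\<in>T. f i j \<oplus> (\<Oplus>i\<in>S. f i j))"
    using insert by (intro finsum_addf[symmetric]) (auto intro!: finsum_closed)
  also have "\<dots> = (\<Oplus>j\<in>T. \<Oplus>i\<in>insert i S. f i j)"
    using insert by (intro finsum_cong') (auto intro!: finsum_closed)
  finally show ?case .
qed

text \<open>Separates the convolution on the direct sum from the construction of the pieces: up to
  the ring axioms nothing refers to words or classes.\<close>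

locale graded_ring =
  fixes G :: "int \<Rightarrow> ('g, 'h) ring_scheme" and mul :: "int \<Rightarrow> int \<Rightarrow> 'g \<Rightarrow> 'g \<Rightarrow> 'g" and e :: 'g
  assumes abelian: "abelian_group (G n)"
    and mul_closed: "\<lbrakk>P \<in> carrier (G n); Q \<in> carrier (G m)\<rbrakk> \<Longrightarrow> mul n m P Q \<in> carrier (G (n + m))"
    and mul_add_left: "\<lbrakk>P \<in> carrier (G n); P' \<in> carrier (G n); Q \<in> carrier (G m)\<rbrakk> \<Longrightarrow>
      mul n m (P \<oplus>\<^bsub>G n\<^esub> P') Q = mul n m P Q \<oplus>\<^bsub>G (n + m)\<^esub> mul n m P' Q"
    and mul_add_right: "\<lbrakk>P \<in> carrier (G n); Q \<in> carrier (G m); Q' \<in> carrier (G m)\<rbrakk> \<Longrightarrow>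
      mul n m P (Q \<oplus>\<^bsub>G m\<^esub> Q') = mul n m P Q \<oplus>\<^bsub>G (n + m)\<^esub> mul n m P Q'"
    and mul_assoc: "\<lbrakk>P \<in> carrier (G n); Q \<in> carrier (G m); R \<in> carrier (G k)\<rbrakk> \<Longrightarrow>
      mul (n + m) k (mul n m P Q) R = mul n (m + k) P (mul m k Q R)"
    and unit_closed: "e \<in> carrier (G 0)"
    and unit_left: "P \<in> carrier (G n) \<Longrightarrow> mul 0 n e P = P"
    and unit_right: "P \<in> carrier (G n) \<Longrightarrow> mul n 0 P e = P"

sublocale graded_ring \<subseteq> G: abelian_group "G n" for n
  by (rule abelian)

context graded_ring
begin

definition sum_carrier :: "(int \<Rightarrow> 'g) set" where
  "sum_carrier = {t. (\<forall>n. t n \<in> carrier (G n)) \<and> finite {n. t n \<noteq> \<zero>\<^bsub>G n\<^esub>}}"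

definition conv :: "(int \<Rightarrow> 'g) \<Rightarrow> (int \<Rightarrow> 'g) \<Rightarrow> int \<Rightarrow> 'g" where
  "conv s t k = (\<Oplus>\<^bsub>G k\<^esub>n\<in>{n. s n \<noteq> \<zero>\<^bsub>G n\<^esub>}. mul n (k - n) (s n) (t (k - n)))"

definition single :: "'g \<Rightarrow> int \<Rightarrow> 'g" where
  "single P n = (if n = 0 then P else \<zero>\<^bsub>G n\<^esub>)"

lemma mul_zero_left: "Q \<in> carrier (G m) \<Longrightarrow> mul n m \<zero>\<^bsub>G n\<^esub> Q = \<zero>\<^bsub>G (n + m)\<^esub>"
  using mul_add_left[of "\<zero>\<^bsub>G n\<^esub>" n "\<zero>\<^bsub>G n\<^esub>" Q m] mul_closed[of "\<zero>\<^bsub>G n\<^esub>" n Q m] by simp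

lemma mul_zero_right: "P \<in> carrier (G n) \<Longrightarrow> mul n m P \<zero>\<^bsub>G m\<^esub> = \<zero>\<^bsub>G (n + m)\<^esub>"
  using mul_add_right[of P n "\<zero>\<^bsub>G m\<^esub>" m "\<zero>\<^bsub>G m\<^esub>"] mul_closed[of P n "\<zero>\<^bsub>G m\<^esub>" m] by simp

lemma mul_finsum_left:
  assumes "finite I" "\<And>i. i \<in> I \<Longrightarrow> f i \<in> carrier (G n)" "Q \<in> carrier (G m)"
  shows "mul n m (\<Oplus>\<^bsub>G n\<^esub>i\<in>I. f i) Q = (\<Oplus>\<^bsub>G (n + m)\<^esub>i\<in>I. mul n m (f i) Q)"
  using assms(1,2)
proof (induction I rule: finite_induct)
  case (insert i I)
  then show ?case
    using assms(3) by (simp add: mul_add_left mul_closed Pi_def)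
qed (simp add: mul_zero_left assms(3))

lemma mul_finsum_right:
  assumes "finite I" "\<And>i. i \<in> I \<Longrightarrow> f i \<in> carrier (G m)" "P \<in> carrier (G n)"
  shows "mul n m P (\<Oplus>\<^bsub>G m\<^esub>i\<in>I. f i) = (\<Oplus>\<^bsub>G (n + m)\<^esub>i\<in>I. mul n m P (f i))"
  using assms(1,2)
proof (induction I rule: finite_induct)
  case (insert i I)
  then show ?case
    using assms(3) by (simp add: mul_add_right mul_closed Pi_def)
qed (simp add: mul_zero_right assms(3))

lemma term_closed:
  assumes "s \<in> sum_carrier" "t \<in> sum_carrier"
  shows "mul n (k - n) (s n) (t (k - n)) \<in> carrier (G k)"
  using mul_closed[of "s n" n "t (k - n)" "k - n"] assms by (simp add: sum_carrier_def)

text \<open>\<open>conv\<close> sums over the support of its left factor. Two such sums can be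
  compared only over a common finite index set, and the terms added for this vanish.\<close>

lemma conv_superset:
  assumes s: "s \<in> sum_carrier" and t: "t \<in> sum_carrier"
    and S: "finite S" "\<And>n. s n \<noteq> \<zero>\<^bsub>G n\<^esub> \<Longrightarrow> n \<in> S"
  shows "conv s t k = (\<Oplus>\<^bsub>G k\<^esub>n\<in>S. mul n (k - n) (s n) (t (k - n)))"
  unfolding conv_def
proof (rule G.finsum_mono_neutral[OF S(1)])
  fix n assume "n \<in> S - {n. s n \<noteq> \<zero>\<^bsub>G n\<^esub>}"
  then show "mul n (k - n) (s n) (t (k - n)) = \<zero>\<^bsub>G k\<^esub>"
    using mul_zero_left[of "t (k - n)" "k - n" n] t by (simp add: sum_carrier_def)
qed (use S term_closed[OF s t] in auto)

text \<open>A finite bound for the support of a product; the support can be smaller, since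
  homogeneous products may vanish or cancel.\<close>

definition supp_sums :: "(int \<Rightarrow> 'g) \<Rightarrow> (int \<Rightarrow> 'g) \<Rightarrow> int set" where
  "supp_sums s t = (\<Union>i\<in>{n. s n \<noteq> \<zero>\<^bsub>G n\<^esub>}. (+) i ` {n. t n \<noteq> \<zero>\<^bsub>G n\<^esub>})"

lemma finite_supp_sums: "\<lbrakk>s \<in> sum_carrier; t \<in> sum_carrier\<rbrakk> \<Longrightarrow> finite (supp_sums s t)"
  by (simp add: supp_sums_def sum_carrier_def)

lemma supp_sumsI: "\<lbrakk>s i \<noteq> \<zero>\<^bsub>G i\<^esub>; t j \<noteq> \<zero>\<^bsub>G j\<^esub>; i + j = n\<rbrakk> \<Longrightarrow> n \<in> supp_sums s t"
  unfolding supp_sums_def by force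

lemma conv_support:
  assumes s: "s \<in> sum_carrier" and t: "t \<in> sum_carrier" and n: "conv s t n \<noteq> \<zero>\<^bsub>G n\<^esub>"
  shows "n \<in> supp_sums s t"
proof (rule ccontr)
  assume not: "n \<notin> supp_sums s t"
  have "mul i (n - i) (s i) (t (n - i)) = \<zero>\<^bsub>G n\<^esub>" if "s i \<noteq> \<zero>\<^bsub>G i\<^esub>" for i
  proof -
    have "t (n - i) = \<zero>\<^bsub>G (n - i)\<^esub>" using supp_sumsI[of s i t "n - i" n] that not by auto
    then show ?thesis using mul_zero_right[of "s i" i "n - i"] s by (simp add: sum_carrier_def)
  qed
  then have "conv s t n = (\<Oplus>\<^bsub>G n\<^esub>i\<in>{i. s i \<noteq> \<zero>\<^bsub>G i\<^esub>}. \<zero>\<^bsub>G n\<^esub>)"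
    unfolding conv_def by (intro G.finsum_cong') auto
  with n show False by simp
qed

lemma conv_closed:
  assumes s: "s \<in> sum_carrier" and t: "t \<in> sum_carrier"
  shows "conv s t \<in> sum_carrier"
proof -
  have "conv s t k \<in> carrier (G k)" for k
    unfolding conv_def using term_closed[OF s t] by (intro G.finsum_closed) auto
  moreover have "finite {n. conv s t n \<noteq> \<zero>\<^bsub>G n\<^esub>}"
    by (rule finite_subset[OF _ finite_supp_sums[OF s t]]) (use conv_support[OF s t] in blast)
  ultimately show ?thesis by (simp add: sum_carrier_def)
qed

lemma conv_assoc:
  assumes s: "s \<in> sum_carrier" and t: "t \<in> sum_carrier" and r: "r \<in> sum_carrier"
  shows "conv (conv s t) r = conv s (conv t r)"
proof
  fix k
  let ?S = "{n. s n \<noteq> \<zero>\<^bsub>G n\<^esub>}" and ?U = "supp_sums s t"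
  have fin: "finite ?S" "finite ?U"
    using s finite_supp_sums[OF s t] by (simp_all add: sum_carrier_def)
  have mem: "s n \<in> carrier (G n)" "t n \<in> carrier (G n)" "r n \<in> carrier (G n)" for n
    using s t r by (simp_all add: sum_carrier_def)
  \<comment> \<open>\<open>m\<close> is the degree taken from \<open>s\<close> and \<open>n\<close>
    the joint degree taken from \<open>s\<close> and \<open>t\<close>, so \<open>t\<close>
    contributes \<open>n - m\<close> and \<open>r\<close> contributes \<open>k - n\<close>.\<close>
  let ?f = "\<lambda>n m. mul m (k - m) (s m) (mul (n - m) (k - n) (t (n - m)) (r (k - n)))"
  have tr: "mul (n - m) (k - n) (t (n - m)) (r (k - n)) \<in> carrier (G (k - m))" for n m
    using mul_closed[OF mem(2)[of "n - m"] mem(3)[of "k - n"]] by simp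
  have f: "?f n m \<in> carrier (G k)" for n m
    using mul_closed[OF mem(1)[of m] tr[of n m]] by simp
  have "conv (conv s t) r k = (\<Oplus>\<^bsub>G k\<^esub>n\<in>?U. mul n (k - n) (conv s t n) (r (k - n)))"
    by (rule conv_superset[OF conv_closed[OF s t] r fin(2) conv_support[OF s t]])
  also have "\<dots> = (\<Oplus>\<^bsub>G k\<^esub>n\<in>?U. \<Oplus>\<^bsub>G k\<^esub>m\<in>?S. ?f n m)"
  proof (rule G.finsum_cong'[OF refl])
    fix n
    have "mul n (k - n) (conv s t n) (r (k - n)) =
        (\<Oplus>\<^bsub>G k\<^esub>m\<in>?S. mul n (k - n) (mul m (n - m) (s m) (t (n - m))) (r (k - n)))"
      unfolding conv_def
      using mul_finsum_left[OF fin(1), of "\<lambda>m. mul m (n - m) (s m) (t (n - m))" n "r (k - n)" "k - n"]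
        term_closed[OF s t] mem by simp
    also have "\<dots> = (\<Oplus>\<^bsub>G k\<^esub>m\<in>?S. ?f n m)"
    proof (rule G.finsum_cong'[OF refl])
      fix m
      show "mul n (k - n) (mul m (n - m) (s m) (t (n - m))) (r (k - n)) = ?f n m"
        using mul_assoc[OF mem(1)[of m] mem(2)[of "n - m"] mem(3)[of "k - n"]] by simp
    qed (use f in auto)
    finally show "mul n (k - n) (conv s t n) (r (k - n)) = (\<Oplus>\<^bsub>G k\<^esub>m\<in>?S. ?f n m)" .
  qed (use f in \<open>auto intro!: G.finsum_closed\<close>)
  also have "\<dots> = (\<Oplus>\<^bsub>G k\<^esub>m\<in>?S. \<Oplus>\<^bsub>G k\<^esub>n\<in>?U. ?f n m)"
    by (rule G.finsum_swap) (use fin f in auto)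
  also have "\<dots> = conv s (conv t r) k"
    unfolding conv_def[of s]
  proof (rule G.finsum_cong'[OF refl])
    fix m assume m: "m \<in> ?S"
    \<comment> \<open>The index set is shifted by \<open>m\<close> so that both double sums run over
      the same pairs; it contains the support of \<open>t\<close> because \<open>m\<close> lies in
      the support of \<open>s\<close>.\<close>
    have "conv t r (k - m) = (\<Oplus>\<^bsub>G (k - m)\<^esub>j\<in>(\<lambda>n. n - m) ` ?U. mul j (k - m - j) (t j) (r (k - m - j)))"
    proof (rule conv_superset[OF t r finite_imageI[OF fin(2)]])
      fix j assume "t j \<noteq> \<zero>\<^bsub>G j\<^esub>"
      then have "m + j \<in> ?U" using m by (intro supp_sumsI[of s m t j]) auto
      then show "j \<in> (\<lambda>n. n - m) ` ?U" by (intro image_eqI[of _ _ "m + j"]) auto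
    qed
    also have "\<dots> = (\<Oplus>\<^bsub>G (k - m)\<^esub>n\<in>?U. mul (n - m) (k - n) (t (n - m)) (r (k - n)))"
      by (subst G.finsum_reindex) (use tr in \<open>auto simp: inj_on_def\<close>)
    finally have "mul m (k - m) (s m) (conv t r (k - m)) = (\<Oplus>\<^bsub>G k\<^esub>n\<in>?U. ?f n m)"
      using mul_finsum_right[OF fin(2), of "\<lambda>n. mul (n - m) (k - n) (t (n - m)) (r (k - n))" "k - m" "s m" m]
        tr mem by simp
    then show "(\<Oplus>\<^bsub>G k\<^esub>n\<in>?U. ?f n m) = mul m (k - m) (s m) (conv t r (k - m))" ..
  qed (use term_closed[OF s conv_closed[OF t r]] in auto)
  finally show "conv (conv s t) r k = conv s (conv t r) k" .
qed

lemma single_closed: "P \<in> carrier (G 0) \<Longrightarrow> single P \<in> sum_carrier"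
  by (auto simp: sum_carrier_def single_def intro: finite_subset[of _ "{0}"])

lemma conv_single_left:
  assumes P: "P \<in> carrier (G 0)" and t: "t \<in> sum_carrier"
  shows "conv (single P) t k = mul 0 k P (t k)"
proof -
  have "conv (single P) t k = (\<Oplus>\<^bsub>G k\<^esub>n\<in>{0}. mul n (k - n) (single P n) (t (k - n)))"
    by (rule conv_superset[OF single_closed[OF P] t]) (auto simp: single_def split: if_splits)
  then show ?thesis
    using term_closed[OF single_closed[OF P] t, of 0 k] by (simp add: single_def)
qed

lemma conv_single_right:
  assumes P: "P \<in> carrier (G 0)" and t: "t \<in> sum_carrier"
  shows "conv t (single P) k = mul k 0 (t k) P"
proof -
  \<comment> \<open>\<open>k\<close> is added so that the one surviving term is present even when
    \<open>t k\<close> is zero.\<close>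
  let ?S = "insert k {n. t n \<noteq> \<zero>\<^bsub>G n\<^esub>}"
  let ?f = "\<lambda>n. mul n (k - n) (t n) (single P (k - n))"
  have f: "?f n \<in> carrier (G k)" for n by (rule term_closed[OF t single_closed[OF P]])
  have "conv t (single P) k = (\<Oplus>\<^bsub>G k\<^esub>n\<in>?S. ?f n)"
    by (rule conv_superset[OF t single_closed[OF P]]) (use t in \<open>auto simp: sum_carrier_def\<close>)
  also have "\<dots> = (\<Oplus>\<^bsub>G k\<^esub>n\<in>{k}. ?f n)"
  proof (rule G.finsum_mono_neutral[symmetric])
    fix n assume "n \<in> ?S - {k}"
    then show "?f n = \<zero>\<^bsub>G k\<^esub>"
      using mul_zero_right[of "t n" n "k - n"] t by (simp add: single_def sum_carrier_def)
  qed (use t f f[of k] in \<open>auto simp: sum_carrier_def\<close>)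
  finally show ?thesis using f[of k] by (simp add: single_def)
qed

lemma add_closed:
  assumes "s \<in> sum_carrier" "t \<in> sum_carrier"
  shows "(\<lambda>n. s n \<oplus>\<^bsub>G n\<^esub> t n) \<in> sum_carrier"
  using assms unfolding sum_carrier_def
  by (auto intro: finite_subset[of _ "{n. s n \<noteq> \<zero>\<^bsub>G n\<^esub>} \<union> {n. t n \<noteq> \<zero>\<^bsub>G n\<^esub>}"])

lemma conv_add_left:
  assumes s: "s \<in> sum_carrier" and t: "t \<in> sum_carrier" and r: "r \<in> sum_carrier"
  shows "conv (\<lambda>n. s n \<oplus>\<^bsub>G n\<^esub> t n) r k = conv s r k \<oplus>\<^bsub>G k\<^esub> conv t r k"
proof -
  \<comment> \<open>Summands may cancel in a degree, so all three products are summed over the union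
    of the supports rather than the support of the sum.\<close>
  let ?S = "{n. s n \<noteq> \<zero>\<^bsub>G n\<^esub>} \<union> {n. t n \<noteq> \<zero>\<^bsub>G n\<^esub>}"
  have fin: "finite ?S" using s t by (simp add: sum_carrier_def)
  have mem: "s n \<in> carrier (G n)" "t n \<in> carrier (G n)" "r n \<in> carrier (G n)" for n
    using s t r by (simp_all add: sum_carrier_def)
  have "conv (\<lambda>n. s n \<oplus>\<^bsub>G n\<^esub> t n) r k = (\<Oplus>\<^bsub>G k\<^esub>n\<in>?S. mul n (k - n) (s n \<oplus>\<^bsub>G n\<^esub> t n) (r (k - n)))"
    by (rule conv_superset[OF add_closed[OF s t] r fin]) auto
  also have "\<dots> = (\<Oplus>\<^bsub>G k\<^esub>n\<in>?S. mul n (k - n) (s n) (r (k - n)) \<oplus>\<^bsub>G k\<^esub> mul n (k - n) (t n) (r (k - n)))"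
  proof (rule G.finsum_cong'[OF refl])
    fix n
    show "mul n (k - n) (s n \<oplus>\<^bsub>G n\<^esub> t n) (r (k - n)) =
        mul n (k - n) (s n) (r (k - n)) \<oplus>\<^bsub>G k\<^esub> mul n (k - n) (t n) (r (k - n))"
      using mul_add_left[OF mem(1)[of n] mem(2)[of n] mem(3)[of "k - n"]] by simp
  qed (use term_closed[OF s r] term_closed[OF t r] in auto)
  also have "\<dots> = (\<Oplus>\<^bsub>G k\<^esub>n\<in>?S. mul n (k - n) (s n) (r (k - n))) \<oplus>\<^bsub>G k\<^esub> (\<Oplus>\<^bsub>G k\<^esub>n\<in>?S. mul n (k - n) (t n) (r (k - n)))"
    by (rule G.finsum_addf) (use term_closed[OF s r] term_closed[OF t r] in auto)
  also have "(\<Oplus>\<^bsub>G k\<^esub>n\<in>?S. mul n (k - n) (s n) (r (k - n))) = conv s r k"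
    by (rule conv_superset[OF s r fin, symmetric]) simp
  also have "(\<Oplus>\<^bsub>G k\<^esub>n\<in>?S. mul n (k - n) (t n) (r (k - n))) = conv t r k"
    by (rule conv_superset[OF t r fin, symmetric]) simp
  finally show ?thesis .
qed

lemma conv_add_right:
  assumes s: "s \<in> sum_carrier" and t: "t \<in> sum_carrier" and r: "r \<in> sum_carrier"
  shows "conv r (\<lambda>n. s n \<oplus>\<^bsub>G n\<^esub> t n) k = conv r s k \<oplus>\<^bsub>G k\<^esub> conv r t k"
proof -
  let ?S = "{n. r n \<noteq> \<zero>\<^bsub>G n\<^esub>}"
  have mem: "s n \<in> carrier (G n)" "t n \<in> carrier (G n)" "r n \<in> carrier (G n)" for n
    using s t r by (simp_all add: sum_carrier_def)
  have "conv r (\<lambda>n. s n \<oplus>\<^bsub>G n\<^esub> t n) k =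
      (\<Oplus>\<^bsub>G k\<^esub>n\<in>?S. mul n (k - n) (r n) (s (k - n)) \<oplus>\<^bsub>G k\<^esub> mul n (k - n) (r n) (t (k - n)))"
    unfolding conv_def
  proof (rule G.finsum_cong'[OF refl])
    fix n
    show "mul n (k - n) (r n) (s (k - n) \<oplus>\<^bsub>G (k - n)\<^esub> t (k - n)) =
        mul n (k - n) (r n) (s (k - n)) \<oplus>\<^bsub>G k\<^esub> mul n (k - n) (r n) (t (k - n))"
      using mul_add_right[OF mem(3)[of n] mem(1)[of "k - n"] mem(2)[of "k - n"]] by simp
  qed (use term_closed[OF r s] term_closed[OF r t] in auto)
  also have "\<dots> = conv r s k \<oplus>\<^bsub>G k\<^esub> conv r t k"
    unfolding conv_def by (rule G.finsum_addf) (use term_closed[OF r s] term_closed[OF r t] in auto)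
  finally show ?thesis .
qed

text \<open>Stated by equations for the operations because the record \<open>TZ\<close> carries a
  scalar multiplication as well.\<close>

lemma direct_sum_ring:
  fixes R :: "(int \<Rightarrow> 'g, 'x) ring_scheme"
  assumes R: "carrier R = sum_carrier" "\<And>s t. s \<otimes>\<^bsub>R\<^esub> t = conv s t" "\<one>\<^bsub>R\<^esub> = single e"
    "\<zero>\<^bsub>R\<^esub> = (\<lambda>n. \<zero>\<^bsub>G n\<^esub>)" "\<And>s t. s \<oplus>\<^bsub>R\<^esub> t = (\<lambda>n. s n \<oplus>\<^bsub>G n\<^esub> t n)"
  shows "ring R"
proof (rule ringI)
  have mem: "s n \<in> carrier (G n)" if "s \<in> sum_carrier" for s n
    using that by (simp add: sum_carrier_def)
  show "abelian_group R"
  proof (rule abelian_groupI; unfold R)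
    show "(\<lambda>n. \<zero>\<^bsub>G n\<^esub>) \<in> sum_carrier" by (simp add: sum_carrier_def)
    fix s assume s: "s \<in> sum_carrier"
    have "{n. \<ominus>\<^bsub>G n\<^esub> s n \<noteq> \<zero>\<^bsub>G n\<^esub>} \<subseteq> {n. s n \<noteq> \<zero>\<^bsub>G n\<^esub>}" by auto
    then have "(\<lambda>n. \<ominus>\<^bsub>G n\<^esub> s n) \<in> sum_carrier"
      using s finite_subset by (auto simp: sum_carrier_def)
    moreover have "(\<lambda>n. \<ominus>\<^bsub>G n\<^esub> s n \<oplus>\<^bsub>G n\<^esub> s n) = (\<lambda>n. \<zero>\<^bsub>G n\<^esub>)"
      using mem[OF s] G.l_neg by blast
    ultimately show "\<exists>t\<in>sum_carrier. (\<lambda>n. t n \<oplus>\<^bsub>G n\<^esub> s n) = (\<lambda>n. \<zero>\<^bsub>G n\<^esub>)"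
      by (intro bexI[of _ "\<lambda>n. \<ominus>\<^bsub>G n\<^esub> s n"])
  qed (auto simp: add_closed mem G.a_assoc fun_eq_iff intro: G.a_comm)
  show "monoid R"
    by (rule monoidI; unfold R)
      (auto simp: conv_closed conv_assoc single_closed unit_closed fun_eq_iff conv_single_left conv_single_right
        unit_left unit_right mem)
  show "(s \<oplus>\<^bsub>R\<^esub> t) \<otimes>\<^bsub>R\<^esub> r = s \<otimes>\<^bsub>R\<^esub> r \<oplus>\<^bsub>R\<^esub> t \<otimes>\<^bsub>R\<^esub> r"
    if "s \<in> carrier R" "t \<in> carrier R" "r \<in> carrier R" for s t r
    using that by (simp add: R fun_eq_iff conv_add_left)
  show "r \<otimes>\<^bsub>R\<^esub> (s \<oplus>\<^bsub>R\<^esub> t) = r \<otimes>\<^bsub>R\<^esub> s \<oplus>\<^bsub>R\<^esub> r \<otimes>\<^bsub>R\<^esub> t"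
    if "s \<in> carrier R" "t \<in> carrier R" "r \<in> carrier R" for s t r
    using that by (simp add: R fun_eq_iff conv_add_right)
qed

end

section \<open>The algebra \<open>T\<^sub>\<int>(L)\<close>\<close>

context weak_line
begin

abbreviation "sca_class a \<equiv> cl 0 [Sca a]"

lemma sca_word: "a \<in> carrier A \<Longrightarrow> [Sca a] \<in> words (F 0)"
  by (simp add: words_F_0)

lemma smult_one: "1 \<odot>\<^bsub>A\<^esub> \<one>\<^bsub>A\<^esub> = \<one>\<^bsub>A\<^esub>"
  using module.smult_one[of "ring_of_type_algebra :: complex ring" A "\<one>\<^bsub>A\<^esub>"] complex_algebra
  by (simp add: complex_algebra_def ring_of_type_algebra_def)

text \<open>With a left factor of degree 0 the product of words is by definition the left action, so
  that action is itself a product. This reduces the module axioms of \<open>TZ\<close> to its ring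
  axioms.\<close>

lemma lact_G:
  assumes a: "a \<in> carrier A" and P: "P \<in> carrier (G n)"
  shows "lact (G n) a P = mul 0 n (sca_class a) P"
proof -
  obtain z where z: "Poly_Mapping.keys z \<subseteq> words (F n)" and Pz: "P = tc n z"
    using P by (auto simp: G_carrier_iff)
  have wp: "word_prod A L 0 n [Sca a] w = word_lact (F n) a w" for w
    by (simp add: word_prod_def)
  have "lact (G n) a P = (\<Union>x\<in>tc n z. tc n (frag_extend (\<lambda>w. frag_of (word_lact (F n) a w)) x))"
    unfolding Pz L_pow_def tensor_def by simp
  also have "\<dots> = tc n (frag_extend (\<lambda>w. frag_of (word_lact (F n) a w)) z)"
    by (rule tensor_lift[OF F_list F_list _ _ z])
      (use word_prod_closed[OF sca_word[OF a], of _ n] word_prod_balanced_right[OF sca_word[OF a], of n]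
        in \<open>simp_all add: wp L_pow_def\<close>)
  also have "\<dots> = mul 0 n (sca_class a) P"
    unfolding Pz using mul_tc[of "frag_of [Sca a]" 0 z n] z sca_word[OF a] by (simp add: frag_prod_def wp)
  finally show ?thesis .
qed

lemma sca_mul:
  assumes "a \<in> carrier A" "b \<in> carrier A"
  shows "mul 0 0 (sca_class a) (sca_class b) = sca_class (a \<otimes>\<^bsub>A\<^esub> b)"
  using assms by (simp add: mul_cl sca_word word_prod_cat letters_def scalar_def)

lemma graded: "graded_ring G mul (sca_class \<one>\<^bsub>A\<^esub>)"
proof (rule graded_ring.intro)
  fix P n assume P: "P \<in> carrier (G n)"
  show "mul 0 n (sca_class \<one>\<^bsub>A\<^esub>) P = P" using P by (rule mul_unit_left)
  \<comment> \<open>The unit of \<open>A\<close> is its scalar multiple by 1, hence a central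
    scalar, so the right unit law follows from the left one.\<close>
  then show "mul n 0 P (sca_class \<one>\<^bsub>A\<^esub>) = P"
    using mul_scalar_central[OF P, of 1] by (simp add: smult_one)
qed (simp_all add: G_abelian mul_closed mul_add_left mul_add_right mul_assoc cl_closed sca_word)

sublocale T: graded_ring G mul "sca_class \<one>\<^bsub>A\<^esub>"
  by (rule graded)

lemma TZ_simps:
  "carrier (TZ A L) = T.sum_carrier" "s \<otimes>\<^bsub>TZ A L\<^esub> t = T.conv s t" "\<one>\<^bsub>TZ A L\<^esub> = T.single (sca_class \<one>\<^bsub>A\<^esub>)"
  "\<zero>\<^bsub>TZ A L\<^esub> = (\<lambda>n. \<zero>\<^bsub>G n\<^esub>)" "s \<oplus>\<^bsub>TZ A L\<^esub> t = (\<lambda>n. s n \<oplus>\<^bsub>G n\<^esub> t n)"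
  by (auto simp: TZ_def T.sum_carrier_def T.conv_def T.single_def F_0 fun_eq_iff)

lemma TZ_ring: "ring (TZ A L)"
  by (rule T.direct_sum_ring) (rule TZ_simps)+

text \<open>The image of \<open>c\<close> under the structure map from the complex numbers to
  \<open>TZ\<close>. Scalar multiplication is multiplication by it, and it commutes with every
  element, so the algebra axioms become computations in the ring.\<close>

definition scal :: "complex \<Rightarrow> int \<Rightarrow> (('a, 'm) letter list \<Rightarrow>\<^sub>0 int) set" where
  "scal c = T.single (sca_class (c \<odot>\<^bsub>A\<^esub> \<one>\<^bsub>A\<^esub>))"

lemma scalar_A: "c \<odot>\<^bsub>A\<^esub> \<one>\<^bsub>A\<^esub> \<in> carrier A"
  by (rule complex_algebra.scalar_closed[OF complex_algebra])

lemma sca_class_scalar: "sca_class (c \<odot>\<^bsub>A\<^esub> \<one>\<^bsub>A\<^esub>) \<in> carrier (G 0)"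
  by (rule cl_closed[OF sca_word[OF scalar_A]])

lemma scal_closed: "scal c \<in> carrier (TZ A L)"
  unfolding scal_def TZ_simps by (rule T.single_closed[OF sca_class_scalar])

lemma TZ_smult:
  assumes "t \<in> carrier (TZ A L)"
  shows "c \<odot>\<^bsub>TZ A L\<^esub> t = scal c \<otimes>\<^bsub>TZ A L\<^esub> t"
proof
  fix n
  have t: "t \<in> T.sum_carrier" "t n \<in> carrier (G n)"
    using assms by (simp_all add: TZ_simps T.sum_carrier_def)
  have "(c \<odot>\<^bsub>TZ A L\<^esub> t) n = lact (G n) (c \<odot>\<^bsub>A\<^esub> \<one>\<^bsub>A\<^esub>) (t n)"
    by (simp add: TZ_def)
  then show "(c \<odot>\<^bsub>TZ A L\<^esub> t) n = (scal c \<otimes>\<^bsub>TZ A L\<^esub> t) n"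
    using t by (simp add: TZ_simps scal_def T.conv_single_left sca_class_scalar lact_G scalar_A)
qed

lemma scal_commute:
  assumes "t \<in> carrier (TZ A L)"
  shows "scal c \<otimes>\<^bsub>TZ A L\<^esub> t = t \<otimes>\<^bsub>TZ A L\<^esub> scal c"
proof
  fix n
  have t: "t \<in> T.sum_carrier" "t n \<in> carrier (G n)"
    using assms by (simp_all add: TZ_simps T.sum_carrier_def)
  then show "(scal c \<otimes>\<^bsub>TZ A L\<^esub> t) n = (t \<otimes>\<^bsub>TZ A L\<^esub> scal c) n"
    using mul_scalar_central[OF t(2)]
    by (simp add: TZ_simps scal_def T.conv_single_left T.conv_single_right sca_class_scalar)
qed

lemma scal_add: "scal (c + d) = scal c \<oplus>\<^bsub>TZ A L\<^esub> scal d"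
proof -
  have "(c + d) \<odot>\<^bsub>A\<^esub> \<one>\<^bsub>A\<^esub> = c \<odot>\<^bsub>A\<^esub> \<one>\<^bsub>A\<^esub> \<oplus>\<^bsub>A\<^esub> d \<odot>\<^bsub>A\<^esub> \<one>\<^bsub>A\<^esub>"
    using module.smult_l_distr[of "ring_of_type_algebra :: complex ring" A c d "\<one>\<^bsub>A\<^esub>"] complex_algebra
    by (simp add: complex_algebra_def ring_of_type_algebra_def)
  then show ?thesis
    by (simp add: fun_eq_iff scal_def T.single_def TZ_simps cl_add_Sca scalar_A)
qed

lemma scal_mult: "scal (c * d) = scal c \<otimes>\<^bsub>TZ A L\<^esub> scal d"
proof
  fix n
  have "(c * d) \<odot>\<^bsub>A\<^esub> \<one>\<^bsub>A\<^esub> = c \<odot>\<^bsub>A\<^esub> (d \<odot>\<^bsub>A\<^esub> \<one>\<^bsub>A\<^esub>)"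
    using module.smult_assoc1[of "ring_of_type_algebra :: complex ring" A c d "\<one>\<^bsub>A\<^esub>"] complex_algebra
    by (simp add: complex_algebra_def ring_of_type_algebra_def)
  also have "\<dots> = (c \<odot>\<^bsub>A\<^esub> \<one>\<^bsub>A\<^esub>) \<otimes>\<^bsub>A\<^esub> (d \<odot>\<^bsub>A\<^esub> \<one>\<^bsub>A\<^esub>)"
    using complex_algebra.smult_mult_left[OF complex_algebra, of "\<one>\<^bsub>A\<^esub>" "d \<odot>\<^bsub>A\<^esub> \<one>\<^bsub>A\<^esub>" c] scalar_A by simp
  finally have "sca_class ((c * d) \<odot>\<^bsub>A\<^esub> \<one>\<^bsub>A\<^esub>) = mul 0 0 (sca_class (c \<odot>\<^bsub>A\<^esub> \<one>\<^bsub>A\<^esub>)) (sca_class (d \<odot>\<^bsub>A\<^esub> \<one>\<^bsub>A\<^esub>))"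
    by (simp add: sca_mul scalar_A)
  then show "scal (c * d) n = (scal c \<otimes>\<^bsub>TZ A L\<^esub> scal d) n"
    using scal_closed[of d] mul_zero_right[OF sca_class_scalar, of n c]
    by (simp add: scal_def TZ_simps T.conv_single_left sca_class_scalar) (simp add: T.single_def)
qed

lemma scal_one: "scal 1 = \<one>\<^bsub>TZ A L\<^esub>"
  by (simp add: scal_def TZ_simps smult_one)

lemma TZ_complex_algebra: "complex_algebra (TZ A L)"
proof (intro complex_algebra.intro complex_algebra_axioms.intro moduleI TZ_ring)
  interpret T: ring "TZ A L" by (rule TZ_ring)
  have C [simp]: "x \<oplus>\<^bsub>ring_of_type_algebra\<^esub> y = x + y" "x \<otimes>\<^bsub>ring_of_type_algebra\<^esub> y = x * y"
    "\<one>\<^bsub>ring_of_type_algebra\<^esub> = (1 :: complex)" for x y :: complex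
    by (simp_all add: ring_of_type_algebra_def)
  show "abelian_group (TZ A L)" by (rule T.abelian_group_axioms)
  show "cring (ring_of_type_algebra :: complex ring)"
    using complex_algebra by (simp add: complex_algebra_def module_def)
  fix c d x y assume x: "x \<in> carrier (TZ A L)"
  show smult: "c \<odot>\<^bsub>TZ A L\<^esub> x \<in> carrier (TZ A L)"
    using x scal_closed by (simp add: TZ_smult)
  show "(c \<oplus>\<^bsub>ring_of_type_algebra\<^esub> d) \<odot>\<^bsub>TZ A L\<^esub> x = c \<odot>\<^bsub>TZ A L\<^esub> x \<oplus>\<^bsub>TZ A L\<^esub> d \<odot>\<^bsub>TZ A L\<^esub> x"
    using x scal_closed by (simp add: TZ_smult scal_add T.l_distr)
  show "(c \<otimes>\<^bsub>ring_of_type_algebra\<^esub> d) \<odot>\<^bsub>TZ A L\<^esub> x = c \<odot>\<^bsub>TZ A L\<^esub> (d \<odot>\<^bsub>TZ A L\<^esub> x)"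
    using x scal_closed by (simp add: TZ_smult scal_mult T.m_assoc)
  show "\<one>\<^bsub>ring_of_type_algebra\<^esub> \<odot>\<^bsub>TZ A L\<^esub> x = x"
    using x by (simp add: TZ_smult scal_one)
  assume y: "y \<in> carrier (TZ A L)"
  show "c \<odot>\<^bsub>TZ A L\<^esub> (x \<oplus>\<^bsub>TZ A L\<^esub> y) = c \<odot>\<^bsub>TZ A L\<^esub> x \<oplus>\<^bsub>TZ A L\<^esub> c \<odot>\<^bsub>TZ A L\<^esub> y"
    using x y scal_closed by (simp add: TZ_smult T.r_distr)
  show "c \<odot>\<^bsub>TZ A L\<^esub> x \<otimes>\<^bsub>TZ A L\<^esub> y = c \<odot>\<^bsub>TZ A L\<^esub> (x \<otimes>\<^bsub>TZ A L\<^esub> y)"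
    using x y scal_closed by (simp add: TZ_smult T.m_assoc)
  \<comment> \<open>With c central: x(cy) = (xc)y = (cx)y = c(xy).\<close>
  have "x \<otimes>\<^bsub>TZ A L\<^esub> (scal c \<otimes>\<^bsub>TZ A L\<^esub> y) = scal c \<otimes>\<^bsub>TZ A L\<^esub> (x \<otimes>\<^bsub>TZ A L\<^esub> y)"
    using x y scal_closed[of c] scal_commute[OF x, of c] by (metis T.m_assoc)
  then show "x \<otimes>\<^bsub>TZ A L\<^esub> (c \<odot>\<^bsub>TZ A L\<^esub> y) = c \<odot>\<^bsub>TZ A L\<^esub> (x \<otimes>\<^bsub>TZ A L\<^esub> y)"
    using x y by (simp add: TZ_smult)
qed

end

theorem proposition6p1:
  fixes A :: "(complex, 'a) module" and L :: "('a, 'm) bimodule"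
  assumes "complex_algebra A"
    and "weak_left_line_module A L"
  shows "complex_algebra (TZ A L)"
  using weak_line.TZ_complex_algebra[OF weak_line.intro[OF assms]] .

end
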